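(* Let $\alpha\ge0$ and let $(r,N,\kappa,W,U)$ be a maximally extended (to increasing $\tau$) solution of the autonomous system $$\dot r=rN,\quad \dot N=(\kappa-N)N-2U^2,\quad \dot\kappa=1-\kappa^2+2U^2-2\alpha^2W^2,\quad \dot W=rU,\quad \dot U=\frac{W(W^2-1)}{r}+\alpha^2 rW-(\kappa-N)U$$ (with $\dot{}=d/d\tau$) satisfying the constraint $$2\kappa N=1+N^2+2U^2-\frac{(1-W^2)^2}{r^2}-2\alpha^2W^2,$$ and satisfying either the quasi regular boundary conditions at $r=0$ (which requires $\alpha\le 1/\sqrt2$) or the black hole boundary conditions at some horizon radius $r=r_h>0$. Then the global behaviour of the solution is completely classified by the following three cases, exactly one of which occurs. (i) $N(\tau)$ changes sign at some finite value of $\tau$, i.e. $r(\tau)$ attains a maximum there. After this $N$ stays negative and $r$ turns back to $0$. This leads to a compact singular 3-space $t=\mathrm{const}$ ("bag of gold"). (ii) $N$ stays positive and tends to $1$ for $\tau\to\infty$, and hence $r\to\infty$. In this limit $W\to0$, $U\to0$ and $\kappa\to1$. (These are the global quasi regular, respectively black hole, solutions.) (iii) $N$ stays positive and tends to $0$ for $\tau\to\infty$, and the solution approaches the fixed point $N=U=W=0$, $r=\kappa=1$. In this case, if $0\le\alpha<\sqrt3/2$ the function $W(\tau)$ oscillates as $\tau\to\infty$ (it has infinitely many zeros), whereas for larger values of $\alpha$ (that is, $\alpha\ge\sqrt3/2$) the behaviour of $W$ for $\tau\to\infty$ is exponential rather than oscillatory, i.e. $|W(\tau)|$ decreases monotonically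 to $0$ for all sufficiently large $\tau$.
   Context: The system describes static, spherically symmetric solutions of the Einstein-Yang-Mills-Higgs equations (gauge group $SU(2)$, Higgs triplet) in the limit of infinite Higgs mass, where the Higgs field is frozen at its vacuum value $\alpha$. For $\alpha=0$ it is the system of the pure Einstein-Yang-Mills theory. The metric is $ds^2=e^{2\nu}dt^2-r^2d\tau^2-r^2(d\theta^2+\sin^2\theta\,d\varphi^2)$ with $\nu,r$ functions of $\tau$, $N=\dot r/r$, $\kappa=\dot\nu+N$; $W$ is the Yang-Mills amplitude and $U=\dot W/r$. All functions are real functions of $\tau$; $r>0$. Quasi regular boundary conditions at $r=0$ ($\alpha\le1/\sqrt2$): the solution is defined for all sufficiently negative $\tau$, and as $\tau\to-\infty$: - if $\alpha<1/\sqrt2$: $r\to0^+$, $(W-1)/r\to0$, $U\to0$, $N\to\sqrt{1-2\alpha^2}$ and $\kappa\to\sqrt{1-2\alpha^2}$; - if $\alpha=1/\sqrt2$: $r\to0^+$, $W=1-\frac{r^2}{4}+o(r^2)$, $U=o(r)$ and $N=\frac{r}{\sqrt{12}}+o(r^2)$ (and then $\kappa/r\to1/\sqrt3$). In both cases $N>0$ for sufficiently negative $\tau$. Black hole boundary conditions (regular horizon) at $r_h>0$: the horizon is placed at $\tau=0$ and the solution is defined for small $\tau>0$. Near $\tau=0$ the functions $r,N,W,U$ and $\kappa-\frac1\tau$ are analytic in $\tau$ and, as $\tau\to0^+$, $$r=r_h\Bigl(1+N_1\frac{\tau^2}{2}\Bigr)+O(\tau^4),\quad N=N_1\tau+O(\tau^3),\quad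 W=W_h+r_hW_1\frac{\tau^2}{2}+O(\tau^4),\quad U=W_1\tau+O(\tau^3),$$ where $$N_1=\frac12-\frac{(1-W_h^2)^2}{2r_h^2}-\alpha^2W_h^2,\qquad W_1=\frac12\Bigl(\frac{W_h(W_h^2-1)}{r_h}+\alpha^2r_hW_h\Bigr),$$ and the parameters $r_h>0$, $W_h\in\mathbb R$ are arbitrary subject to $N_1>0$. For each such $(r_h,W_h)$ there is a unique such local solution.
   Formalization: In case (ii) with α=0, W→0 is replaced by W→0, 1 or −1 (Minkowski space has W=1); in case (i), for the quasi regular origin with α=1/√2, finite total length (compactness) is claimed only towards the singular end, as the origin is at infinite distance. *)

theory Defs
  imports "HOL-Analysis.Analysis" "HOL-Library.Landau_Symbols"
begin

definition eymh_solution ::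
  "real \<Rightarrow> real set \<Rightarrow> (real \<Rightarrow> real) \<Rightarrow> (real \<Rightarrow> real) \<Rightarrow> (real \<Rightarrow> real) \<Rightarrow> (real \<Rightarrow> real) \<Rightarrow> (real \<Rightarrow> real) \<Rightarrow> bool"
where
  "eymh_solution \<alpha> S r N \<kappa> W U \<longleftrightarrow>
    (\<forall>\<tau>\<in>S.
      r \<tau> > 0 \<and>
      (r has_real_derivative r \<tau> * N \<tau>) (at \<tau>) \<and>
      (N has_real_derivative (\<kappa> \<tau> - N \<tau>) * N \<tau> - 2 * (U \<tau>)\<^sup>2) (at \<tau>) \<and>
      (\<kappa> has_real_derivative 1 - (\<kappa> \<tau>)\<^sup>2 + 2 * (U \<tau>)\<^sup>2 - 2 * \<alpha>\<^sup>2 * (W \<tau>)\<^sup>2) (at \<tau>) \<and>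
      (W has_real_derivative r \<tau> * U \<tau>) (at \<tau>) \<and>
      (U has_real_derivative
         W \<tau> * ((W \<tau>)\<^sup>2 - 1) / r \<tau> + \<alpha>\<^sup>2 * r \<tau> * W \<tau> - (\<kappa> \<tau> - N \<tau>) * U \<tau>) (at \<tau>) \<and>
      2 * \<kappa> \<tau> * N \<tau> =
        1 + (N \<tau>)\<^sup>2 + 2 * (U \<tau>)\<^sup>2 - (1 - (W \<tau>)\<^sup>2)\<^sup>2 / (r \<tau>)\<^sup>2 - 2 * \<alpha>\<^sup>2 * (W \<tau>)\<^sup>2)"

text \<open>A solution lives on the open interval \<open>einterval a T\<close>; the values of the functions
  elsewhere are irrelevant. It is maximal to the right: it has no continuation beyond \<open>T\<close>.\<close>

definition right_maximal_solution ::
  "real \<Rightarrow> ereal \<Rightarrow> ereal \<Rightarrow> (real \<Rightarrow> real) \<Rightarrow> (real \<Rightarrow> real) \<Rightarrow> (real \<Rightarrow> real) \<Rightarrow> (real \<Rightarrow> real) \<Rightarrow> (real \<Rightarrow> real) \<Rightarrow> bool"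
where
  "right_maximal_solution \<alpha> a T r N \<kappa> W U \<longleftrightarrow>
    a < T \<and> eymh_solution \<alpha> (einterval a T) r N \<kappa> W U \<and>
    \<not> (\<exists>T' r' N' \<kappa>' W' U'. T < T' \<and> eymh_solution \<alpha> (einterval a T') r' N' \<kappa>' W' U' \<and>
         (\<forall>\<tau>\<in>einterval a T. r' \<tau> = r \<tau> \<and> N' \<tau> = N \<tau> \<and> \<kappa>' \<tau> = \<kappa> \<tau> \<and> W' \<tau> = W \<tau> \<and> U' \<tau> = U \<tau>))"

definition quasi_regular ::
  "real \<Rightarrow> (real \<Rightarrow> real) \<Rightarrow> (real \<Rightarrow> real) \<Rightarrow> (real \<Rightarrow> real) \<Rightarrow> (real \<Rightarrow> real) \<Rightarrow> (real \<Rightarrow> real) \<Rightarrow> bool"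
where
  "quasi_regular \<alpha> r N \<kappa> W U \<longleftrightarrow>
    (\<alpha> < 1 / sqrt 2 \<and>
      (r \<longlongrightarrow> 0) at_bot \<and>
      ((\<lambda>\<tau>. (W \<tau> - 1) / r \<tau>) \<longlongrightarrow> 0) at_bot \<and>
      (U \<longlongrightarrow> 0) at_bot \<and>
      (N \<longlongrightarrow> sqrt (1 - 2 * \<alpha>\<^sup>2)) at_bot \<and>
      (\<kappa> \<longlongrightarrow> sqrt (1 - 2 * \<alpha>\<^sup>2)) at_bot) \<or>
    (\<alpha> = 1 / sqrt 2 \<and>
      (r \<longlongrightarrow> 0) at_bot \<and>
      (\<lambda>\<tau>. W \<tau> - (1 - (r \<tau>)\<^sup>2 / 4)) \<in> o[at_bot](\<lambda>\<tau>. (r \<tau>)\<^sup>2) \<and>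
      U \<in> o[at_bot](r) \<and>
      (\<lambda>\<tau>. N \<tau> - r \<tau> / sqrt 12) \<in> o[at_bot](\<lambda>\<tau>. (r \<tau>)\<^sup>2))"

text \<open>For \<open>\<tau> > 0\<close> near \<open>0\<close> the function is given by a convergent power series in \<open>\<tau>\<close>, which
  extends it analytically to a neighbourhood of \<open>0\<close>.\<close>

definition analytic_at_right_0 :: "(real \<Rightarrow> real) \<Rightarrow> bool" where
  "analytic_at_right_0 f \<longleftrightarrow>
    (\<exists>c \<epsilon>. \<epsilon> > 0 \<and> (\<forall>\<tau>. 0 < \<tau> \<and> \<tau> < \<epsilon> \<longrightarrow> (\<lambda>n. c n * \<tau> ^ n) sums f \<tau>))"

definition horizon_N1 :: "real \<Rightarrow> real \<Rightarrow> real \<Rightarrow> real" where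
  "horizon_N1 \<alpha> r\<^sub>h W\<^sub>h = 1 / 2 - (1 - W\<^sub>h\<^sup>2)\<^sup>2 / (2 * r\<^sub>h\<^sup>2) - \<alpha>\<^sup>2 * W\<^sub>h\<^sup>2"

definition horizon_W1 :: "real \<Rightarrow> real \<Rightarrow> real \<Rightarrow> real" where
  "horizon_W1 \<alpha> r\<^sub>h W\<^sub>h = 1 / 2 * (W\<^sub>h * (W\<^sub>h\<^sup>2 - 1) / r\<^sub>h + \<alpha>\<^sup>2 * r\<^sub>h * W\<^sub>h)"

definition regular_horizon ::
  "real \<Rightarrow> real \<Rightarrow> real \<Rightarrow> (real \<Rightarrow> real) \<Rightarrow> (real \<Rightarrow> real) \<Rightarrow> (real \<Rightarrow> real) \<Rightarrow> (real \<Rightarrow> real) \<Rightarrow> (real \<Rightarrow> real) \<Rightarrow> bool"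
where
  "regular_horizon \<alpha> r\<^sub>h W\<^sub>h r N \<kappa> W U \<longleftrightarrow>
    r\<^sub>h > 0 \<and> horizon_N1 \<alpha> r\<^sub>h W\<^sub>h > 0 \<and>
    analytic_at_right_0 r \<and> analytic_at_right_0 N \<and> analytic_at_right_0 W \<and>
    analytic_at_right_0 U \<and> analytic_at_right_0 (\<lambda>\<tau>. \<kappa> \<tau> - 1 / \<tau>) \<and>
    (\<lambda>\<tau>. r \<tau> - r\<^sub>h * (1 + horizon_N1 \<alpha> r\<^sub>h W\<^sub>h * (\<tau>\<^sup>2 / 2))) \<in> O[at_right 0](\<lambda>\<tau>. \<tau> ^ 4) \<and>
    (\<lambda>\<tau>. N \<tau> - horizon_N1 \<alpha> r\<^sub>h W\<^sub>h * \<tau>) \<in> O[at_right 0](\<lambda>\<tau>. \<tau> ^ 3) \<and>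
    (\<lambda>\<tau>. W \<tau> - (W\<^sub>h + r\<^sub>h * horizon_W1 \<alpha> r\<^sub>h W\<^sub>h * (\<tau>\<^sup>2 / 2))) \<in> O[at_right 0](\<lambda>\<tau>. \<tau> ^ 4) \<and>
    (\<lambda>\<tau>. U \<tau> - horizon_W1 \<alpha> r\<^sub>h W\<^sub>h * \<tau>) \<in> O[at_right 0](\<lambda>\<tau>. \<tau> ^ 3)"

definition changes_sign_at :: "(real \<Rightarrow> real) \<Rightarrow> real \<Rightarrow> bool" where
  "changes_sign_at f \<tau>\<^sub>0 \<longleftrightarrow>
    f \<tau>\<^sub>0 = 0 \<and> (\<forall>\<^sub>F \<tau> in at_left \<tau>\<^sub>0. f \<tau> > 0) \<and> (\<forall>\<^sub>F \<tau> in at_right \<tau>\<^sub>0. f \<tau> < 0)"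

text \<open>The slice \<open>t = const\<close> carries the metric \<open>r\<^sup>2 d\<tau>\<^sup>2 + r\<^sup>2 d\<Omega>\<^sup>2\<close>, so its radial proper length
  element is \<open>r d\<tau>\<close>, and the sectional curvature of the planes tangent to the round spheres is
  \<open>(1 - (dr/ds)\<^sup>2) / r\<^sup>2\<close> with \<open>ds = r d\<tau>\<close> and hence \<open>dr/ds = N\<close>.\<close>

definition sphere_curvature :: "(real \<Rightarrow> real) \<Rightarrow> (real \<Rightarrow> real) \<Rightarrow> real \<Rightarrow> real" where
  "sphere_curvature r N \<tau> = (1 - (N \<tau>)\<^sup>2) / (r \<tau>)\<^sup>2"

text \<open>The end \<open>\<tau> \<rightarrow> T\<close> of the slice closes up (\<open>r \<rightarrow> 0\<close>) at finite proper distance, in a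
  curvature singularity. The other end is a regular centre or a horizon and is at finite
  proper distance too, so that the slice has finite total length, except for the quasi regular
  origin with \<open>\<alpha> = 1 / sqrt 2\<close>: there \<open>r\<close> behaves like \<open>-sqrt 12 / \<tau>\<close>.\<close>

definition bag_of_gold :: "real \<Rightarrow> ereal \<Rightarrow> ereal \<Rightarrow> (real \<Rightarrow> real) \<Rightarrow> (real \<Rightarrow> real) \<Rightarrow> bool" where
  "bag_of_gold \<alpha> a T r N \<longleftrightarrow>
    ((r \<circ> real_of_ereal) \<longlongrightarrow> 0) (at_left T) \<and>
    (\<forall>\<tau>\<^sub>1\<in>einterval a T. set_integrable lborel (einterval (ereal \<tau>\<^sub>1) T) r) \<and>
    (\<not> (a = -\<infinity> \<and> \<alpha> = 1 / sqrt 2) \<longrightarrow> set_integrable lborel (einterval a T) r) \<and>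
    filterlim (sphere_curvature r N \<circ> real_of_ereal) at_bot (at_left T)"

definition stays_positive_and_tends_to :: "ereal \<Rightarrow> ereal \<Rightarrow> (real \<Rightarrow> real) \<Rightarrow> real \<Rightarrow> bool" where
  "stays_positive_and_tends_to a T f l \<longleftrightarrow>
    T = \<infinity> \<and> (\<forall>\<tau>\<in>einterval a T. f \<tau> > 0) \<and> (f \<longlongrightarrow> l) at_top"

end

(*
  Put D = k - N (k = kappa), B = (1 - W^2)^2 / r^2. The constraint turns the equations into
    N' = D N - 2 U^2 = (1 - N^2 - 2 U^2 - B - 2 alpha^2 W^2) / 2,   k' = B - D^2,
    D' = B + 2 U^2 - k D,
  so D >= 0 is preserved and N cannot become positive again once it has vanished; the boundary
  conditions provide D >= 0. Bounds on N alone bound all other functions on bounded intervals, so by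
  Picard-Lindeloef a maximal solution with N > 0 exists for all times, and after a zero of N the
  solution ends at a finite time with N -> -oo; there r -> 0, since otherwise U would be integrable
  enough to keep N bounded.
  If N > 0 throughout, (k + N)' <= 1 - D^2 bounds D, and a growing |W| > 1 would force N to -oo, so
  W is bounded. If r -> oo, the energy (2 k N - 1 - N^2) / 2 converges, U -> 0 and N -> 1. If r is
  bounded, Barbalat's lemma forces N, U and all derivatives to 0; the limit is a fixed point, and
  the one with W = 0 because the other ones have alpha^4 r^2 = 2 alpha^2 - 1, which a regular
  horizon (or 2 alpha^2 <= 1) excludes for all later values of r. Near that fixed point
  W'' + W' + (1 - alpha^2) W = 0 to leading order, and the direction (W, U) is controlled by angle and
  barrier arguments; in the critically damped case alpha^2 = 3/4 the barrier moves like
  U / W = 1 / (2 tau) - 1 / 2.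
*)
theory Submission
  imports Defs "HOL-Analysis.Analysis"
begin

section \<open>Differential inequalities\<close>

text \<open>Everything is done by comparison, without linearisation theorems. Two features stand in
  the way. The left end is singular (\<open>\<tau> = -\<infinity>\<close>, or
  \<open>\<kappa>\<close> like \<open>1 / \<tau>\<close> at a horizon), so only a few inequalities
  are carried away from it, after which both kinds of boundary data are treated alike. And near the
  fixed point the linear equation for \<open>W\<close> is not decisive at two values of
  \<open>\<alpha>\<close>. For \<open>\<alpha>^2 = 3/4\<close> its characteristic roots coincide at
  -1/2: a constant barrier for \<open>U / W\<close> has no margin, the moving one gains only
  \<open>1 / (4 \<tau>^2)\<close>, so all coefficients must be shown to converge faster than that; a
  quadratic Lyapunov function in \<open>W\<close> and \<open>U\<close> gives exponential rates. For
  \<open>\<alpha>^2 = 1\<close> the restoring coefficient tends to 0, and its sign is read off the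
  constraint at the zeros of \<open>U\<close>. When \<open>r\<close> is unbounded, the mass term
  \<open>\<alpha>^2 r^2\<close> forces \<open>W\<close> to 0 if \<open>\<alpha> > 0\<close>; for
  \<open>\<alpha> = 0\<close> it is absent, and \<open>W\<close> may end at any of the three
  equilibria 0, 1 and -1.\<close>

lemma has_real_derivative_continuous_on:
  assumes "\<And>x. x \<in> S \<Longrightarrow> (f has_real_derivative f' x) (at x)"
  shows "continuous_on S f"
  using assms by (meson DERIV_isCont continuous_at_imp_continuous_on)

lemma nondecreasing_of_deriv:
  assumes "a \<le> b" "\<And>x. a \<le> x \<Longrightarrow> x \<le> b \<Longrightarrow> (f has_real_derivative f' x) (at x)"
    "\<And>x. a \<le> x \<Longrightarrow> x \<le> b \<Longrightarrow> 0 \<le> f' x"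
  shows "f a \<le> (f b :: real)"
  using DERIV_nonneg_imp_nondecreasing[of a b f] assms by blast

lemma nonincreasing_of_deriv:
  assumes "a \<le> b" "\<And>x. a \<le> x \<Longrightarrow> x \<le> b \<Longrightarrow> (f has_real_derivative f' x) (at x)"
    "\<And>x. a \<le> x \<Longrightarrow> x \<le> b \<Longrightarrow> f' x \<le> 0"
  shows "f b \<le> (f a :: real)"
  using DERIV_nonpos_imp_nonincreasing[of a b f] assms by blast

lemma first_zero:
  fixes f :: "real \<Rightarrow> real"
  assumes "a \<le> b" "continuous_on {a..b} f" "f a > 0" "f b \<le> 0"
  obtains c where "a < c" "c \<le> b" "f c = 0" "\<And>x. a \<le> x \<Longrightarrow> x < c \<Longrightarrow> f x > 0"
proof -
  let ?S = "{x\<in>{a..b}. f x \<le> 0}"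
  have cl: "closed ?S"
    by (rule continuous_on_closed_Collect_le) (use assms in auto)
  have "bounded ?S" by (rule bounded_subset[of "{a..b}"]) auto
  then have "compact ?S" using cl by (simp add: compact_eq_bounded_closed)
  moreover have "b \<in> ?S" using assms by auto
  ultimately obtain c where c: "c \<in> ?S" "\<And>x. x \<in> ?S \<Longrightarrow> c \<le> x"
    by (metis (no_types, lifting) compact_attains_inf empty_iff)
  have "a < c" using c(1) assms(3) by (cases "a = c") auto
  have pos: "f x > 0" if "a \<le> x" "x < c" for x
    using c(2)[of x] c(1) that by force
  have "f c = 0"
  proof (rule ccontr)
    assume "f c \<noteq> 0"
    hence "f c < 0" using c(1) by auto
    have "continuous_on {a..c} f" by (rule continuous_on_subset[OF assms(2)]) (use c in auto)
    then obtain x where "a \<le> x" "x \<le> c" "f x = 0"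
      using IVT2'[of f c 0 a] \<open>f c < 0\<close> assms(3) \<open>a < c\<close> by auto
    then show False using pos[of x] \<open>f c < 0\<close> by (cases "x = c") auto
  qed
  with \<open>a < c\<close> c(1) pos that show ?thesis by auto
qed

text \<open>After the last point at which \<open>f\<close> is at most the maximum, \<open>f\<close>
  stays above \<open>K\<close> and hence does not increase up to \<open>b\<close>, so it cannot end
  higher. The sign of the derivative thus matters only above the level \<open>K\<close>.\<close>

lemma barrier:
  fixes f :: "real \<Rightarrow> real"
  assumes "a \<le> b" "\<And>x. a \<le> x \<Longrightarrow> x \<le> b \<Longrightarrow> (f has_real_derivative f' x) (at x)"
    "\<And>x. a \<le> x \<Longrightarrow> x \<le> b \<Longrightarrow> f x > K \<Longrightarrow> f' x \<le> 0"
  shows "f b \<le> max (f a) K"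
proof (rule ccontr)
  let ?m = "max (f a) K"
  assume "\<not> f b \<le> ?m"
  have cont: "continuous_on {a..b} f"
    by (rule has_real_derivative_continuous_on[where f' = f']) (use assms(2) in auto)
  let ?S = "{x\<in>{a..b}. f x \<le> ?m}"
  have cl: "closed ?S"
    by (rule continuous_on_closed_Collect_le) (use cont in auto)
  have "bounded ?S" by (rule bounded_subset[of "{a..b}"]) auto
  then have "compact ?S" using cl by (simp add: compact_eq_bounded_closed)
  moreover have "a \<in> ?S" using assms by auto
  ultimately obtain c where c: "c \<in> ?S" "\<And>x. x \<in> ?S \<Longrightarrow> x \<le> c"
    by (metis (no_types, lifting) compact_attains_sup empty_iff)
  have "c < b" using c(1) \<open>\<not> f b \<le> ?m\<close> by (cases "b = c") auto
  have big: "f x > ?m" if "c < x" "x \<le> b" for x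
    using c(2)[of x] c(1) that by force
  have "f b \<le> f c"
  proof (rule DERIV_nonpos_imp_decreasing_open[where f = f and a = c and b = b])
    show "c \<le> b" using \<open>c < b\<close> by simp
    show "continuous_on {c..b} f" by (rule continuous_on_subset[OF cont]) (use c in auto)
    fix x assume "c < x" "x < b"
    then show "\<exists>y. (f has_real_derivative y) (at x) \<and> y \<le> 0"
      using assms(2,3)[of x] big[of x] c(1) by force
  qed
  with \<open>\<not> f b \<le> ?m\<close> c(1) show False by auto
qed

text \<open>A first zero reached from positive values would have a nonpositive derivative. A start
  at \<open>f a = 0\<close> is reduced to a positive one by moving slightly to the right.\<close>

lemma positive_after_upcrossing:
  fixes f :: "real \<Rightarrow> real"
  assumes "a < b" "\<And>x. a \<le> x \<Longrightarrow> x \<le> b \<Longrightarrow> (f has_real_derivative f' x) (at x)"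
    "\<And>x. a \<le> x \<Longrightarrow> x \<le> b \<Longrightarrow> f x = 0 \<Longrightarrow> f' x > 0" "f a \<ge> 0"
  shows "f b > 0"
proof -
  obtain a' where a': "a \<le> a'" "a' < b" "f a' > 0"
  proof (cases "f a = 0")
    case True
    then obtain d where "d > 0" "\<And>h. 0 < h \<Longrightarrow> h < d \<Longrightarrow> f a < f (a + h)"
      using DERIV_pos_inc_right[of f "f' a" a] assms by auto
    moreover define h where "h = min d (b - a) / 2"
    have "0 < h" "h < d" "a + h < b" using \<open>d > 0\<close> assms(1) by (auto simp: h_def min_def field_simps)
    ultimately show ?thesis using that[of "a + h"] True by auto
  qed (use assms that[of a] in auto)
  show ?thesis
  proof (rule ccontr)
    assume "\<not> f b > 0"
    moreover have "continuous_on {a'..b} f"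
      by (rule has_real_derivative_continuous_on[where f' = f']) (use assms(2) a' in auto)
    ultimately obtain c where c: "a' < c" "c \<le> b" "f c = 0" "\<And>x. a' \<le> x \<Longrightarrow> x < c \<Longrightarrow> f x > 0"
      using first_zero[of a' b f] a' by auto
    obtain d where d: "d > 0" "\<And>h. 0 < h \<Longrightarrow> h < d \<Longrightarrow> f (c - h) < f c"
      using DERIV_pos_inc_left[of f "f' c" c] assms(2,3)[of c] c a' by auto
    define h where "h = min d (c - a') / 2"
    have "0 < h" "h < d" "a' \<le> c - h" using d(1) c(1) by (auto simp: h_def min_def field_simps)
    then show False using d(2)[of h] c(3) c(4)[of "c - h"] by auto
  qed
qed

lemma filterlim_at_top_of_deriv:
  fixes f :: "real \<Rightarrow> real"
  assumes der: "\<And>x. a \<le> x \<Longrightarrow> (f has_real_derivative f' x) (at x)"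
    and "\<And>x. a \<le> x \<Longrightarrow> f' x \<ge> c" "c > 0"
  shows "filterlim f at_top at_top"
proof -
  have "f a + c * (x - a) \<le> f x" if "a \<le> x" for x
  proof -
    have "f a - c * a \<le> f x - c * x"
      by (rule nondecreasing_of_deriv[where f' = "\<lambda>x. f' x - c"])
        (use assms that in \<open>auto intro!: derivative_eq_intros\<close>)
    then show ?thesis by (simp add: algebra_simps)
  qed
  moreover have "filterlim (\<lambda>x. f a + c * (x - a)) at_top at_top"
    using \<open>c > 0\<close>
    by (intro filterlim_tendsto_add_at_top[OF tendsto_const] filterlim_tendsto_pos_mult_at_top[OF tendsto_const]
        filterlim_tendsto_add_at_top[OF tendsto_const[of "-a"], simplified] filterlim_ident) auto
  ultimately show ?thesis
    using filterlim_at_top_mono[of "\<lambda>x. f a + c * (x - a)" at_top f]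
    by (simp add: eventually_at_top_linorder) blast
qed

lemma filterlim_at_bot_of_deriv:
  fixes f :: "real \<Rightarrow> real"
  assumes der: "\<And>x. a \<le> x \<Longrightarrow> (f has_real_derivative f' x) (at x)"
    and "\<And>x. a \<le> x \<Longrightarrow> f' x \<le> - c" "c > 0"
  shows "filterlim f at_bot at_top"
proof -
  have "filterlim (\<lambda>x. - f x) at_top at_top"
  proof (rule filterlim_at_top_of_deriv[where f' = "\<lambda>x. - f' x" and a = a and c = c])
    fix x assume "a \<le> x"
    then show "((\<lambda>x. - f x) has_real_derivative - f' x) (at x)" "c \<le> - f' x"
      using assms(1)[of x] assms(2)[of x] by (auto intro: derivative_intros)
  qed fact
  then show ?thesis by (simp add: filterlim_uminus_at_top)
qed

text \<open>The rate \<open>- d\<close> is uniform, so \<open>f\<close> cannot stay above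
  \<open>K\<close> forever; once it has come down, \<open>barrier\<close> keeps it there.\<close>

lemma eventually_le_of_deriv:
  fixes f :: "real \<Rightarrow> real"
  assumes ev1: "eventually (\<lambda>x. (f has_real_derivative f' x) (at x)) at_top"
    and ev2: "eventually (\<lambda>x. f x > K \<longrightarrow> f' x \<le> - d) at_top" and "d > 0"
  shows "eventually (\<lambda>x. f x \<le> K) at_top"
proof -
  obtain a where a: "\<And>x. x \<ge> a \<Longrightarrow> (f has_real_derivative f' x) (at x)"
    "\<And>x. x \<ge> a \<Longrightarrow> f x > K \<Longrightarrow> f' x \<le> - d"
    using eventually_conj[OF ev1 ev2] unfolding eventually_at_top_linorder by auto
  have "\<exists>b\<ge>a. f b \<le> K"
  proof (rule ccontr)
    assume *: "\<not> (\<exists>b\<ge>a. f b \<le> K)"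
    then have "filterlim f at_bot at_top"
      using filterlim_at_bot_of_deriv[of a f f' d] a \<open>d > 0\<close> by force
    then have "eventually (\<lambda>x. f x \<le> K) at_top" by (simp add: filterlim_at_bot)
    then obtain x0 where "\<And>x. x \<ge> x0 \<Longrightarrow> f x \<le> K" by (auto simp: eventually_at_top_linorder)
    from this[of "max x0 a"] * show False by auto
  qed
  then obtain b where b: "b \<ge> a" "f b \<le> K" by auto
  have "f x \<le> K" if "x \<ge> b" for x
  proof -
    have "f x \<le> max (f b) K"
    proof (rule barrier[where f' = f' and f = f, OF that])
      fix y assume "b \<le> y"
      then show "(f has_real_derivative f' y) (at y)" using a b by simp
      show "f' y \<le> 0" if "f y > K" using a(2)[of y] \<open>b \<le> y\<close> b that \<open>d > 0\<close> by simp
    qed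
    then show ?thesis using b by simp
  qed
  then show ?thesis unfolding eventually_at_top_linorder by blast
qed

lemma eventually_ge_of_deriv:
  fixes f :: "real \<Rightarrow> real"
  assumes ev1: "eventually (\<lambda>x. (f has_real_derivative f' x) (at x)) at_top"
    and ev2: "eventually (\<lambda>x. f x < K \<longrightarrow> f' x \<ge> d) at_top" and "d > 0"
  shows "eventually (\<lambda>x. f x \<ge> K) at_top"
proof -
  have "eventually (\<lambda>x. - f x \<le> - K) at_top"
    by (rule eventually_le_of_deriv[where f' = "\<lambda>x. - f' x" and d = d])
      (use assms in \<open>auto elim!: eventually_mono intro: derivative_intros\<close>)
  then show ?thesis by simp
qed

lemma tendsto_of_nondecreasing:
  fixes f :: "real \<Rightarrow> real"
  assumes "\<And>x y. a \<le> x \<Longrightarrow> x \<le> y \<Longrightarrow> f x \<le> f y" "\<And>x. a \<le> x \<Longrightarrow> f x \<le> K"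
  obtains l where "(f \<longlongrightarrow> l) at_top" "\<And>x. a \<le> x \<Longrightarrow> f x \<le> l"
proof -
  let ?l = "SUP x\<in>{a..}. f x"
  have bdd: "bdd_above (f ` {a..})" by (rule bdd_aboveI2[of _ _ K]) (use assms(2) in auto)
  have le: "f x \<le> ?l" if "a \<le> x" for x using bdd that by (auto intro: cSUP_upper)
  have "(f \<longlongrightarrow> ?l) at_top"
  proof (rule order_tendstoI)
    fix y assume "y < ?l"
    then obtain x where "x \<ge> a" "y < f x" using bdd by (subst (asm) less_cSUP_iff) auto
    then have "\<And>z. z \<ge> x \<Longrightarrow> y < f z" using assms(1) by (meson less_le_trans)
    then show "eventually (\<lambda>x. y < f x) at_top" by (auto simp: eventually_at_top_linorder)
  next
    fix y assume "?l < y"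
    then show "eventually (\<lambda>x. f x < y) at_top"
      using le by (auto simp: eventually_at_top_linorder intro!: exI[of _ a] intro: le_less_trans)
  qed
  with le that show ?thesis by blast
qed

lemma tendsto_of_nonincreasing:
  fixes f :: "real \<Rightarrow> real"
  assumes "\<And>x y. a \<le> x \<Longrightarrow> x \<le> y \<Longrightarrow> f y \<le> f x" "\<And>x. a \<le> x \<Longrightarrow> K \<le> f x"
  obtains l where "(f \<longlongrightarrow> l) at_top" "\<And>x. a \<le> x \<Longrightarrow> l \<le> f x"
proof -
  obtain l where l: "((\<lambda>x. - f x) \<longlongrightarrow> l) at_top" "\<And>x. a \<le> x \<Longrightarrow> - f x \<le> l"
    using tendsto_of_nondecreasing[of a "\<lambda>x. - f x" "- K"] assms by auto
  show ?thesis
  proof (rule that[of "- l"])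
    show "(f \<longlongrightarrow> - l) at_top" using tendsto_minus[OF l(1)] by simp
    show "- l \<le> f x" if "a \<le> x" for x using l(2)[OF that] by simp
  qed
qed

text \<open>Barbalat's lemma: wherever \<open>g\<close> is large, the bound \<open>C\<close> on its
  derivative keeps it large on an interval of fixed length, and \<open>f\<close> would keep moving
  instead of converging.\<close>

lemma deriv_tendsto_0:
  fixes f g h :: "real \<Rightarrow> real"
  assumes lim: "(f \<longlongrightarrow> l) at_top"
    and ev1: "eventually (\<lambda>x. (f has_real_derivative g x) (at x)) at_top"
    and ev2: "eventually (\<lambda>x. (g has_real_derivative h x) (at x)) at_top"
    and ev3: "eventually (\<lambda>x. \<bar>h x\<bar> \<le> C) at_top"
  shows "(g \<longlongrightarrow> 0) at_top"
proof (rule tendstoI)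
  fix e :: real assume "e > 0"
  define C' where "C' = max C 1"
  \<comment> \<open>On an interval of length \<open>s\<close> the function \<open>g\<close> varies
    by at most \<open>e / 2\<close>; \<open>d\<close> is chosen such that an increment of
    \<open>f\<close> below \<open>2 d\<close> over this length means a mean slope below
    \<open>e / 2\<close>.\<close>
  define s where "s = e / (2 * C')"
  have "C' > 0" "C' \<ge> C" "s > 0" using \<open>e > 0\<close> by (auto simp: C'_def s_def)
  define d where "d = s * e / 4"
  have "d > 0" using \<open>s > 0\<close> \<open>e > 0\<close> by (simp add: d_def)
  have "eventually (\<lambda>x. dist (f x) l < d) at_top" using lim \<open>d > 0\<close> by (rule tendstoD)
  from eventually_conj[OF this eventually_conj[OF ev1 eventually_conj[OF ev2 ev3]]]
  obtain a where a: "\<And>x. x \<ge> a \<Longrightarrow> dist (f x) l < d"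
    "\<And>x. x \<ge> a \<Longrightarrow> (f has_real_derivative g x) (at x)"
    "\<And>x. x \<ge> a \<Longrightarrow> (g has_real_derivative h x) (at x)"
    "\<And>x. x \<ge> a \<Longrightarrow> \<bar>h x\<bar> \<le> C" unfolding eventually_at_top_linorder by auto
  have "\<bar>g x\<bar> < e" if xa: "x \<ge> a" for x
  proof -
    obtain y where y: "x < y" "y < x + s" "f (x + s) - f x = s * g y"
    proof -
      have "\<exists>z>x. z < x + s \<and> f (x + s) - f x = (x + s - x) * g z"
        by (rule MVT2) (use a(2) xa \<open>s > 0\<close> in auto)
      then show ?thesis using that by auto
    qed
    obtain z where z: "x < z" "z < y" "g y - g x = (y - x) * h z"
    proof -
      have "\<exists>z>x. z < y \<and> g y - g x = (y - x) * h z"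
        by (rule MVT2) (use a(3) xa y in auto)
      then show ?thesis using that by auto
    qed
    have "\<bar>g y - g x\<bar> \<le> s * C'"
      unfolding z(3) abs_mult using a(4)[of z] z y xa \<open>C \<le> C'\<close> by (intro mult_mono) auto
    also have "\<dots> = e / 2" using \<open>C' > 0\<close> by (simp add: s_def)
    finally have 1: "\<bar>g y - g x\<bar> \<le> e / 2" .
    have "\<bar>s * g y\<bar> < 2 * d" using y(3) a(1)[of x] a(1)[of "x + s"] xa \<open>s > 0\<close>
      by (auto simp: dist_real_def)
    then have "\<bar>g y\<bar> < e / 2" using \<open>s > 0\<close> by (auto simp: d_def abs_mult field_simps)
    with 1 show ?thesis by linarith
  qed
  then show "eventually (\<lambda>x. dist (g x) 0 < e) at_top" by (auto simp: eventually_at_top_linorder)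
qed

section \<open>Gronwall uniqueness and limits at an end point\<close>

lemma gronwall_zero:
  fixes f :: "real \<Rightarrow> real"
  assumes der: "\<And>x. a \<le> x \<Longrightarrow> x \<le> b \<Longrightarrow> (f has_real_derivative f' x) (at x)"
    and bd: "\<And>x. a \<le> x \<Longrightarrow> x \<le> b \<Longrightarrow> \<bar>f' x\<bar> \<le> C * f x"
    and "\<And>x. a \<le> x \<Longrightarrow> x \<le> b \<Longrightarrow> 0 \<le> f x" "f c = 0" "a \<le> c" "c \<le> b" "a \<le> x" "x \<le> b"
  shows "f x = 0"
proof (cases "c \<le> x")
  case True
  have "f x * exp (- C * x) \<le> f c * exp (- C * c)"
  proof (rule nonincreasing_of_deriv[OF True])
    fix y assume "c \<le> y" "y \<le> x"
    then show "((\<lambda>x. f x * exp (- C * x)) has_real_derivative (f' y - C * f y) * exp (- C * y)) (at y)"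
      using assms(5-8) by (auto intro!: derivative_eq_intros der simp: algebra_simps)
    show "(f' y - C * f y) * exp (- C * y) \<le> 0"
      using bd[of y] \<open>c \<le> y\<close> \<open>y \<le> x\<close> assms(5-8) by (intro mult_nonpos_nonneg) auto
  qed
  then have "f x \<le> 0" using assms(4) by (simp add: mult_le_0_iff)
  then show ?thesis using assms(3)[of x] assms(5-8) True by force
next
  case False
  then have "x \<le> c" by simp
  have "f x * exp (C * x) \<le> f c * exp (C * c)"
  proof (rule nondecreasing_of_deriv[OF \<open>x \<le> c\<close>])
    fix y assume "x \<le> y" "y \<le> c"
    then show "((\<lambda>x. f x * exp (C * x)) has_real_derivative (f' y + C * f y) * exp (C * y)) (at y)"
      using assms(5-8) by (auto intro!: derivative_eq_intros der simp: algebra_simps)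
    show "0 \<le> (f' y + C * f y) * exp (C * y)"
      using bd[of y] \<open>x \<le> y\<close> \<open>y \<le> c\<close> assms(5-8) by (intro mult_nonneg_nonneg) auto
  qed
  then have "f x \<le> 0" using assms(4) by (simp add: mult_le_0_iff)
  then show ?thesis using assms(3)[of x] assms(5-8) by force
qed

text \<open>Allows a coefficient that is merely continuous. It serves as the uniqueness argument for
  the system: \<open>f\<close> will be the squared distance to a special solution.\<close>

lemma gronwall_zero_continuous:
  fixes f :: "real \<Rightarrow> real"
  assumes der: "\<And>x. a \<le> x \<Longrightarrow> x \<le> b \<Longrightarrow> (f has_real_derivative f' x) (at x)"
    and bd: "\<And>x. a \<le> x \<Longrightarrow> x \<le> b \<Longrightarrow> \<bar>f' x\<bar> \<le> c x * f x" and cont: "continuous_on {a..b} c"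
    and nonneg: "\<And>x. a \<le> x \<Longrightarrow> x \<le> b \<Longrightarrow> 0 \<le> f x"
    and z: "f z = 0" "a \<le> z" "z \<le> b" and x: "a \<le> x" "x \<le> b"
  shows "f x = 0"
proof -
  obtain C where C: "\<And>y. a \<le> y \<Longrightarrow> y \<le> b \<Longrightarrow> c y \<le> C"
    using continuous_attains_sup[OF compact_Icc _ cont] x by fastforce
  show ?thesis
  proof (rule gronwall_zero[where f = f and f' = f' and C = C, OF der _ nonneg z x])
    fix y assume y: "a \<le> y" "y \<le> b"
    show "\<bar>f' y\<bar> \<le> C * f y"
      using bd[OF y] mult_right_mono[OF C[OF y] nonneg[OF y]] by linarith
  qed
qed

text \<open>A bounded derivative makes \<open>f\<close> Lipschitz, hence uniformly continuous, and
  such a function extends continuously to the closed interval.\<close>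

lemma left_limit_of_bounded_deriv:
  fixes f :: "real \<Rightarrow> real"
  assumes "a < b" "\<And>x. a < x \<Longrightarrow> x < b \<Longrightarrow> (f has_real_derivative f' x) (at x)"
    "\<And>x. a < x \<Longrightarrow> x < b \<Longrightarrow> \<bar>f' x\<bar> \<le> C"
  obtains l where "(f \<longlongrightarrow> l) (at_left b)"
proof -
  have "C \<ge> 0" using assms(3)[of "(a + b) / 2"] assms(1) by (simp add: field_simps)
  have "C-lipschitz_on {a<..<b} f"
  proof (rule lipschitz_onI)
    show "C \<ge> 0" by fact
    fix x y assume xy: "x \<in> {a<..<b}" "y \<in> {a<..<b}"
    have "norm (f x - f y) \<le> C * norm (x - y)"
    proof (rule field_differentiable_bound[of "{a<..<b}" f f' C x y])
      fix z assume "z \<in> {a<..<b}"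
      then show "(f has_field_derivative f' z) (at z within {a<..<b})" "norm (f' z) \<le> C"
        using assms(2,3)[of z] by (auto intro: has_field_derivative_at_within)
    qed (use xy in auto)
    then show "dist (f x) (f y) \<le> C * dist x y" by (simp add: dist_norm)
  qed
  then have "uniformly_continuous_on {a<..<b} f" by (rule lipschitz_on_uniformly_continuous)
  then obtain g where g: "uniformly_continuous_on (closure {a<..<b}) g"
    "\<And>x. x \<in> {a<..<b} \<Longrightarrow> f x = g x"
    by (rule uniformly_continuous_on_extension_on_closure) blast
  have "continuous_on {a..b} g" using uniformly_continuous_imp_continuous[OF g(1)] assms(1) by simp
  then have "(g \<longlongrightarrow> g b) (at b within {a..b})" using assms(1) by (simp add: continuous_on_def)
  then have "(g \<longlongrightarrow> g b) (at_left b)"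
    using assms(1) by (simp add: at_within_Icc_at_left)
  moreover have "eventually (\<lambda>x. g x = f x) (at_left b)"
    using eventually_at_left_real[OF assms(1)] by eventually_elim (use g(2) in auto)
  ultimately have "(f \<longlongrightarrow> g b) (at_left b)" by (rule Lim_transform_eventually)
  then show ?thesis using that by blast
qed

section \<open>Local existence\<close>

text \<open>\<open>f\<close> is composed with the nearest-point projection onto the ball. The
  composite is Lipschitz and bounded everywhere, so the Banach fixed point theorem applies on the
  space of all bounded continuous functions; the fixed point stays in the ball, where the projection
  does nothing, and so solves the original equation.\<close>

lemma picard_local_solution:
  fixes f :: "'a::euclidean_space \<Rightarrow> 'a"
  assumes e: "e > 0" and L: "L-lipschitz_on (cball x0 e) f"
  obtains d \<phi> where "d > 0" "\<phi> t0 = x0"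
    "\<And>t. t \<in> {t0..t0 + d} \<Longrightarrow> \<phi> t \<in> cball x0 e"
    "\<And>t. t \<in> {t0..t0 + d} \<Longrightarrow> (\<phi> has_vector_derivative f (\<phi> t)) (at t within {t0..t0 + d})"
proof -
  have L0: "L \<ge> 0" using L by (rule lipschitz_on_nonneg)
  define pr where "pr = closest_point (cball x0 e)"
  have pr_in: "pr x \<in> cball x0 e" for x
    unfolding pr_def by (rule closest_point_in_set) (use e in auto)
  have pr_id: "pr x = x" if "x \<in> cball x0 e" for x
    unfolding pr_def by (rule closest_point_self) (use that in auto)
  define g where "g = (\<lambda>x. f (pr x))"
  have gL: "norm (g x - g y) \<le> L * norm (x - y)" for x y
  proof -
    have "dist (g x) (g y) \<le> L * dist (pr x) (pr y)"
      unfolding g_def using lipschitz_onD[OF L pr_in pr_in] .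
    also have "\<dots> \<le> L * dist x y"
      unfolding pr_def
      by (intro mult_left_mono closest_point_lipschitz L0) (use e in auto)
    finally show ?thesis by (simp add: dist_norm)
  qed
  have g_cont: "continuous_on UNIV g"
  proof -
    have "L-lipschitz_on UNIV g"
      using gL L0 by (intro lipschitz_onI) (auto simp: dist_norm)
    then show ?thesis by (rule lipschitz_on_continuous_on)
  qed
  define M where "M = norm (f x0) + L * e"
  have M0: "M \<ge> 0" using L0 e by (simp add: M_def)
  have gM: "norm (g x) \<le> M" for x
  proof -
    have "norm (g x - g x0) \<le> L * norm (pr x - x0)"
      using lipschitz_onD[OF L pr_in[of x], of x0] pr_id[of x0] e
      by (auto simp: g_def dist_norm)
    also have "\<dots> \<le> L * e"
      using pr_in[of x] by (intro mult_left_mono L0) (simp add: dist_norm norm_minus_commute)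
    finally have "norm (g x - f x0) \<le> L * e" using pr_id[of x0] e by (simp add: g_def)
    then show ?thesis using norm_triangle_sub[of "g x" "f x0"] by (simp add: M_def)
  qed
  \<comment> \<open>The first term keeps the solution within distance \<open>e\<close> of
    \<open>x0\<close>, since the norm of \<open>g\<close> is at most \<open>M\<close>; the second
    makes the integral operator a contraction with factor 1/2.\<close>
  define d where "d = min (e / (M + 1)) (1 / (2 * (L + 1)))"
  have d0: "d > 0" using e M0 L0 by (simp add: d_def)
  have dM: "d * M \<le> e"
  proof -
    have "d * M \<le> e / (M + 1) * M" using M0 by (intro mult_right_mono) (auto simp: d_def)
    also have "\<dots> \<le> e" using M0 e by (simp add: field_simps)
    finally show ?thesis .
  qed
  have dL: "d * L \<le> 1 / 2"
  proof -
    have "d * L \<le> 1 / (2 * (L + 1)) * L" using L0 by (intro mult_right_mono) (auto simp: d_def)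
    also have "\<dots> \<le> 1 / 2" using L0 by (simp add: field_simps)
    finally show ?thesis .
  qed
  \<comment> \<open>Time is clamped to the interval, because the elements of the function space are
    defined on the whole line.\<close>
  define cl where "cl = (\<lambda>t. max t0 (min t (t0 + d)))"
  have cl_in: "cl t \<in> {t0..t0 + d}" for t using d0 by (auto simp: cl_def)
  have cl_id: "cl t = t" if "t \<in> {t0..t0 + d}" for t using that by (auto simp: cl_def)
  define J where "J = (\<lambda>\<phi>::real \<Rightarrow>\<^sub>C 'a. \<lambda>t. integral {t0..t} (\<lambda>s. g (\<phi> s)))"
  have cont: "continuous_on A (\<lambda>s. g (apply_bcontfun \<phi> s))" for A :: "real set" and \<phi>
    using continuous_on_compose2[OF g_cont, of A "apply_bcontfun \<phi>"] by auto
  have J_deriv: "(J \<phi> has_vector_derivative g (\<phi> t)) (at t within {t0..t0 + d})"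
    if "t \<in> {t0..t0 + d}" for \<phi> t
    unfolding J_def by (rule integral_has_vector_derivative[OF cont that])
  have J_le: "norm (J \<phi> t) \<le> e" if "t \<in> {t0..t0 + d}" for \<phi> t
  proof -
    have "norm (J \<phi> t) \<le> integral {t0..t} (\<lambda>s. M)"
      unfolding J_def by (rule integral_norm_bound_integral)
        (auto intro!: integrable_continuous_real cont gM)
    also have "\<dots> \<le> d * M" using that M0 by (simp add: mult_right_mono)
    finally show ?thesis using dM by simp
  qed
  define P where "P = (\<lambda>\<phi>. Bcontfun (\<lambda>t. x0 + J \<phi> (cl t)))"
  have P_apply: "apply_bcontfun (P \<phi>) t = x0 + J \<phi> (cl t)" for \<phi> t
  proof -
    have "continuous_on {t0..t0 + d} (J \<phi>)"
      unfolding continuous_on_eq_continuous_within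
      using J_deriv has_vector_derivative_continuous by blast
    then have "continuous_on UNIV (\<lambda>t. J \<phi> (cl t))"
      using cl_in by (intro continuous_on_compose2[of "{t0..t0 + d}" "J \<phi>" UNIV cl])
        (auto simp: cl_def intro!: continuous_intros)
    moreover have "bounded (range (\<lambda>t. x0 + J \<phi> (cl t)))"
    proof (rule boundedI)
      fix y assume "y \<in> range (\<lambda>t. x0 + J \<phi> (cl t))"
      then show "norm y \<le> norm x0 + e"
        using J_le[OF cl_in, of \<phi>] norm_triangle_le[of x0] by (auto intro!: norm_triangle_le)
    qed
    ultimately have "(\<lambda>t. x0 + J \<phi> (cl t)) \<in> bcontfun"
      by (auto simp: bcontfun_def intro!: continuous_intros)
    then show ?thesis by (simp add: P_def Bcontfun_inverse)
  qed
  have "dist (P \<phi>) (P \<psi>) \<le> 1 / 2 * dist \<phi> \<psi>" for \<phi> \<psi>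
  proof (rule dist_bound)
    fix t
    let ?t = "cl t"
    have "dist (P \<phi> t) (P \<psi> t) = norm (integral {t0..?t} (\<lambda>s. g (\<phi> s) - g (\<psi> s)))"
      unfolding P_apply dist_norm J_def
      by (subst integral_diff) (auto intro!: integrable_continuous_real cont)
    also have "\<dots> \<le> integral {t0..?t} (\<lambda>s. L * dist \<phi> \<psi>)"
    proof (rule integral_norm_bound_integral)
      show "(\<lambda>s. g (\<phi> s) - g (\<psi> s)) integrable_on {t0..?t}"
        by (intro integrable_diff integrable_continuous_real cont)
      fix s
      have "norm (g (\<phi> s) - g (\<psi> s)) \<le> L * norm (\<phi> s - \<psi> s)" by (rule gL)
      also have "\<dots> \<le> L * dist \<phi> \<psi>"
        using dist_bounded[of \<phi> s \<psi>] L0 by (intro mult_left_mono) (auto simp: dist_norm)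
      finally show "norm (g (\<phi> s) - g (\<psi> s)) \<le> L * dist \<phi> \<psi>" .
    qed auto
    also have "\<dots> = (?t - t0) * (L * dist \<phi> \<psi>)" using cl_in[of t] by simp
    also have "\<dots> \<le> d * (L * dist \<phi> \<psi>)"
      using cl_in[of t] L0 by (intro mult_right_mono) auto
    also have "\<dots> \<le> 1 / 2 * dist \<phi> \<psi>"
      using mult_right_mono[OF dL zero_le_dist[of \<phi> \<psi>]] by (simp add: algebra_simps)
    finally show "dist (P \<phi> t) (P \<psi> t) \<le> 1 / 2 * dist \<phi> \<psi>" .
  qed
  then have "\<exists>!\<phi>. P \<phi> = \<phi>" by (intro banach_fix_type[of "1/2"]) auto
  then obtain \<phi> where \<phi>: "P \<phi> = \<phi>" by blast
  have val: "apply_bcontfun \<phi> t = x0 + J \<phi> t" if "t \<in> {t0..t0 + d}" for t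
    using P_apply[of \<phi> t] cl_id[OF that] by (simp add: \<phi>)
  have in_ball: "\<phi> t \<in> cball x0 e" if "t \<in> {t0..t0 + d}" for t
    using J_le[OF that, of \<phi>] by (simp add: val[OF that] dist_norm)
  show ?thesis
  proof (rule that[of d "apply_bcontfun \<phi>"])
    show "\<phi> t0 = x0" using val[of t0] d0 by (simp add: J_def)
    fix t assume t: "t \<in> {t0..t0 + d}"
    have "((\<lambda>t. x0 + J \<phi> t) has_vector_derivative g (\<phi> t)) (at t within {t0..t0 + d})"
      using has_vector_derivative_add[OF has_vector_derivative_const[of x0] J_deriv[OF t, of \<phi>]] by simp
    then have "(\<phi> has_vector_derivative g (\<phi> t)) (at t within {t0..t0 + d})"
      by (rule has_vector_derivative_transform[OF t, rotated]) (simp add: val)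
    then show "(\<phi> has_vector_derivative f (\<phi> t)) (at t within {t0..t0 + d})"
      using pr_id[OF in_ball[OF t]] by (simp add: g_def)
  qed (use d0 in_ball in auto)
qed

text \<open>The left derivative is the limit of \<open>f'\<close> by l'Hospital's rule, the right
  one comes from \<open>g\<close>; both equal \<open>D\<close>.\<close>

lemma glued_has_real_derivative:
  fixes f g :: "real \<Rightarrow> real"
  assumes "a < T" "T < b"
    and f: "\<And>x. a < x \<Longrightarrow> x < T \<Longrightarrow> (f has_real_derivative f' x) (at x)"
    and lim: "(f \<longlongrightarrow> g T) (at_left T)" and lim': "(f' \<longlongrightarrow> D) (at_left T)"
    and g: "(g has_vector_derivative D) (at T within {T..b})"
  shows "((\<lambda>x. if x < T then f x else g x) has_real_derivative D) (at T)"
proof -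
  let ?h = "\<lambda>x. if x < T then f x else g x"
  have ev: "eventually (\<lambda>x. a < x \<and> x < T) (at_left T)"
    using eventually_at_left_real[OF assms(1)] by eventually_elim auto
  have "((\<lambda>x. (f x - g T) / (x - T)) \<longlongrightarrow> D) (at_left T)"
  proof (rule lhopital_left[where f' = f' and g' = "\<lambda>_. 1"])
    show "((\<lambda>x. f x - g T) \<longlongrightarrow> 0) (at_left T)" using lim by (simp add: LIM_zero)
    show "((\<lambda>x. x - T) \<longlongrightarrow> 0) (at_left T)" by (intro LIM_zero tendsto_ident_at)
    show "eventually (\<lambda>x. ((\<lambda>x. f x - g T) has_real_derivative f' x) (at x)) (at_left T)"
      using ev by eventually_elim (auto intro!: derivative_eq_intros f)
    show "eventually (\<lambda>x. ((\<lambda>x. x - T) has_real_derivative 1) (at x)) (at_left T)"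
      by (intro always_eventually allI) (auto intro!: derivative_eq_intros)
    show "((\<lambda>x. f' x / 1) \<longlongrightarrow> D) (at_left T)" using lim' by simp
  qed (use ev in \<open>auto elim!: eventually_mono\<close>)
  then have "((\<lambda>x. (?h x - ?h T) / (x - T)) \<longlongrightarrow> D) (at_left T)"
    by (rule Lim_transform_eventually) (use ev in \<open>auto elim!: eventually_mono\<close>)
  moreover have "((\<lambda>x. (?h x - ?h T) / (x - T)) \<longlongrightarrow> D) (at_right T)"
  proof -
    have "((\<lambda>x. (g x - g T) / (x - T)) \<longlongrightarrow> D) (at T within {T..b})"
      using g by (simp add: has_real_derivative_iff_has_vector_derivative[symmetric] has_field_derivative_iff)
    then have "((\<lambda>x. (g x - g T) / (x - T)) \<longlongrightarrow> D) (at_right T)"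
      using assms(2) by (simp add: at_within_Icc_at_right)
    then show ?thesis
      by (rule Lim_transform_eventually)
        (use eventually_at_right_real[OF assms(2)] in \<open>auto elim!: eventually_mono\<close>)
  qed
  ultimately have "((\<lambda>x. (?h x - ?h T) / (x - T)) \<longlongrightarrow> D) (at T)"
    by (rule filterlim_split_at)
  then show ?thesis by (simp add: has_field_derivative_iff)
qed

section \<open>The field equations\<close>

lemma abs_mult_le_mean_squares: "\<bar>2 * (x * y)\<bar> \<le> x\<^sup>2 + (y::real)\<^sup>2"
  using sum_squares_bound[of x y] sum_squares_bound[of x "-y"] by (simp add: abs_if)

lemma quotient_rule_identity:
  fixes R :: real
  assumes "R > 0"
  shows "(- 4 * w * (1 - w\<^sup>2) * (R * u) * R\<^sup>2 - (1 - w\<^sup>2)\<^sup>2 * (2 * R\<^sup>2 * n)) / (R\<^sup>2 * R\<^sup>2)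
    = 4 * w * (w\<^sup>2 - 1) * u / R - 2 * n * ((1 - w\<^sup>2)\<^sup>2 / R\<^sup>2)"
proof -
  define c where "c = 1 - w\<^sup>2"
  have "(- 4 * w * c * (R * u) * R\<^sup>2 - c\<^sup>2 * (2 * R\<^sup>2 * n)) / (R\<^sup>2 * R\<^sup>2) = - (4 * w * c * u / R) - 2 * n * (c\<^sup>2 / R\<^sup>2)"
    using assms by (simp add: field_simps eval_nat_numeral)
  also have "- (4 * w * c * u / R) = 4 * w * (w\<^sup>2 - 1) * u / R"
    unfolding c_def minus_divide_left by (simp add: algebra_simps)
  finally show ?thesis unfolding c_def .
qed

locale eymh =
  fixes \<alpha> :: real and a T :: ereal and r N \<kappa> W U :: "real \<Rightarrow> real"
  assumes a_less_T: "a < T" and solution: "eymh_solution \<alpha> (einterval a T) r N \<kappa> W U"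
begin

abbreviation I :: "real set" where "I \<equiv> einterval a T"

definition D :: "real \<Rightarrow> real" where "D \<tau> = \<kappa> \<tau> - N \<tau>"

definition B :: "real \<Rightarrow> real" where "B \<tau> = (1 - (W \<tau>)\<^sup>2)\<^sup>2 / (r \<tau>)\<^sup>2"

text \<open>The force in the equation for \<open>U\<close>, which takes the form of a damped motion
  with friction coefficient \<open>D\<close>.\<close>

definition F :: "real \<Rightarrow> real" where "F \<tau> = W \<tau> * ((W \<tau>)\<^sup>2 - 1) / r \<tau> + \<alpha>\<^sup>2 * r \<tau> * W \<tau>"

lemma between_mem: "s \<in> I \<Longrightarrow> t \<in> I \<Longrightarrow> s \<le> x \<Longrightarrow> x \<le> t \<Longrightarrow> x \<in> I"
  by (auto simp: einterval_def) (meson ereal_less_eq(3) le_less_trans less_le_trans)+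

lemma right_mem: "T = \<infinity> \<Longrightarrow> s \<in> I \<Longrightarrow> s \<le> x \<Longrightarrow> x \<in> I"
  by (auto simp: einterval_def) (meson ereal_less_eq(3) less_le_trans)

lemma open_I: "open I" by (rule open_einterval)

lemma r_pos: "\<tau> \<in> I \<Longrightarrow> r \<tau> > 0"
  using solution by (auto simp: eymh_solution_def)

lemma r_deriv: "\<tau> \<in> I \<Longrightarrow> (r has_real_derivative r \<tau> * N \<tau>) (at \<tau>)"
  using solution by (auto simp: eymh_solution_def)

lemma N_deriv: "\<tau> \<in> I \<Longrightarrow> (N has_real_derivative D \<tau> * N \<tau> - 2 * (U \<tau>)\<^sup>2) (at \<tau>)"
  using solution by (auto simp: eymh_solution_def D_def)

lemma W_deriv: "\<tau> \<in> I \<Longrightarrow> (W has_real_derivative r \<tau> * U \<tau>) (at \<tau>)"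
  using solution by (auto simp: eymh_solution_def)

lemma U_deriv: "\<tau> \<in> I \<Longrightarrow> (U has_real_derivative F \<tau> - D \<tau> * U \<tau>) (at \<tau>)"
  using solution by (auto simp: eymh_solution_def D_def F_def)

lemma constraint: "\<tau> \<in> I \<Longrightarrow>
    2 * \<kappa> \<tau> * N \<tau> = 1 + (N \<tau>)\<^sup>2 + 2 * (U \<tau>)\<^sup>2 - B \<tau> - 2 * \<alpha>\<^sup>2 * (W \<tau>)\<^sup>2"
  using solution by (auto simp: eymh_solution_def B_def)

lemma kappa_deriv: "\<tau> \<in> I \<Longrightarrow> (\<kappa> has_real_derivative B \<tau> - (D \<tau>)\<^sup>2) (at \<tau>)"
proof -
  assume t: "\<tau> \<in> I"
  have "(\<kappa> has_real_derivative 1 - (\<kappa> \<tau>)\<^sup>2 + 2 * (U \<tau>)\<^sup>2 - 2 * \<alpha>\<^sup>2 * (W \<tau>)\<^sup>2) (at \<tau>)"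
    using solution t by (auto simp: eymh_solution_def)
  also have "1 - (\<kappa> \<tau>)\<^sup>2 + 2 * (U \<tau>)\<^sup>2 - 2 * \<alpha>\<^sup>2 * (W \<tau>)\<^sup>2 = B \<tau> - (D \<tau>)\<^sup>2"
    using constraint[OF t] by (simp add: D_def power2_diff)
  finally show ?thesis .
qed

lemma N_rate: "\<tau> \<in> I \<Longrightarrow>
    2 * (D \<tau> * N \<tau> - 2 * (U \<tau>)\<^sup>2) = 1 - (N \<tau>)\<^sup>2 - 2 * (U \<tau>)\<^sup>2 - B \<tau> - 2 * \<alpha>\<^sup>2 * (W \<tau>)\<^sup>2"
  using constraint[of \<tau>] by (simp add: D_def algebra_simps power2_eq_square)

lemma D_deriv: "\<tau> \<in> I \<Longrightarrow> (D has_real_derivative B \<tau> + 2 * (U \<tau>)\<^sup>2 - D \<tau> * \<kappa> \<tau>) (at \<tau>)"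
proof -
  assume t: "\<tau> \<in> I"
  have "((\<lambda>t. \<kappa> t - N t) has_real_derivative (B \<tau> - (D \<tau>)\<^sup>2) - (D \<tau> * N \<tau> - 2 * (U \<tau>)\<^sup>2)) (at \<tau>)"
    by (intro DERIV_diff kappa_deriv N_deriv t)
  then show ?thesis
    unfolding D_def[abs_def] by (simp add: algebra_simps power2_eq_square)
qed

lemma B_deriv: "\<tau> \<in> I \<Longrightarrow>
    (B has_real_derivative 4 * W \<tau> * ((W \<tau>)\<^sup>2 - 1) * U \<tau> / r \<tau> - 2 * N \<tau> * B \<tau>) (at \<tau>)"
proof -
  assume t: "\<tau> \<in> I"
  have W2: "((\<lambda>t. (1 - (W t)\<^sup>2)\<^sup>2) has_real_derivative - 4 * W \<tau> * (1 - (W \<tau>)\<^sup>2) * (r \<tau> * U \<tau>)) (at \<tau>)"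
    by (rule derivative_eq_intros W_deriv[OF t] refl)+ (simp add: algebra_simps)
  have r2: "((\<lambda>t. (r t)\<^sup>2) has_real_derivative 2 * (r \<tau>)\<^sup>2 * N \<tau>) (at \<tau>)"
    by (rule derivative_eq_intros r_deriv[OF t] refl)+ (simp add: power2_eq_square)
  have "r \<tau> > 0" using r_pos t by simp
  then have "(- 4 * W \<tau> * (1 - (W \<tau>)\<^sup>2) * (r \<tau> * U \<tau>) * (r \<tau>)\<^sup>2 - (1 - (W \<tau>)\<^sup>2)\<^sup>2 * (2 * (r \<tau>)\<^sup>2 * N \<tau>)) / ((r \<tau>)\<^sup>2 * (r \<tau>)\<^sup>2)
      = 4 * W \<tau> * ((W \<tau>)\<^sup>2 - 1) * U \<tau> / r \<tau> - 2 * N \<tau> * ((1 - (W \<tau>)\<^sup>2)\<^sup>2 / (r \<tau>)\<^sup>2)"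
    by (rule quotient_rule_identity)
  moreover have "(r \<tau>)\<^sup>2 \<noteq> 0" using \<open>r \<tau> > 0\<close> by simp
  ultimately show ?thesis
    unfolding B_def[abs_def] using DERIV_divide[OF W2 r2] by (metis (no_types, lifting) DERIV_cong)
qed

lemma B_nonneg: "B \<tau> \<ge> 0" by (simp add: B_def)

lemmas sol_derivs = r_deriv N_deriv W_deriv U_deriv kappa_deriv D_deriv B_deriv

lemma cont: "continuous_on I r" "continuous_on I N" "continuous_on I W" "continuous_on I U"
    "continuous_on I \<kappa>" "continuous_on I D"
  by (rule has_real_derivative_continuous_on, erule sol_derivs)+

lemma cont_on: assumes "S \<subseteq> I"
  shows "continuous_on S r" "continuous_on S N" "continuous_on S W" "continuous_on S U"
    "continuous_on S \<kappa>" "continuous_on S D"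
  using cont continuous_on_subset[OF _ assms] by blast+

lemma antiderivative:
  assumes "continuous_on I f"
  obtains P where "\<And>x. x \<in> I \<Longrightarrow> (P has_real_derivative f x) (at x)"
proof -
  have "\<And>x. a < ereal x \<Longrightarrow> ereal x < T \<Longrightarrow> isCont f x"
    using assms open_I by (auto simp: continuous_on_eq_continuous_at einterval_def)
  from einterval_antiderivative[OF a_less_T this] that show ?thesis
    by (auto simp: has_real_derivative_iff_has_vector_derivative einterval_def)
qed

text \<open>Since \<open>\<kappa>\<close> is the logarithmic derivative of \<open>e\<^sup>\<nu> r\<close> and \<open>D\<close> that of \<open>e\<^sup>\<nu>\<close>, this says that
  \<open>r\<close> times the derivative of \<open>e\<^sup>\<nu>\<close> is nondecreasing.\<close>

lemma D_integrating_factor: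
  obtains P where "\<And>x. x \<in> I \<Longrightarrow>
      ((\<lambda>x. D x * exp (P x)) has_real_derivative (B x + 2 * (U x)\<^sup>2) * exp (P x)) (at x)"
    "\<And>s t. s \<in> I \<Longrightarrow> t \<in> I \<Longrightarrow> s \<le> t \<Longrightarrow> D s * exp (P s) \<le> D t * exp (P t)"
proof -
  obtain P where P: "\<And>x. x \<in> I \<Longrightarrow> (P has_real_derivative \<kappa> x) (at x)"
    using antiderivative cont(5) by blast
  have der: "((\<lambda>x. D x * exp (P x)) has_real_derivative (B x + 2 * (U x)\<^sup>2) * exp (P x)) (at x)"
    if "x \<in> I" for x
    using that by (auto intro!: derivative_eq_intros D_deriv P simp: algebra_simps)
  moreover have "D s * exp (P s) \<le> D t * exp (P t)" if "s \<in> I" "t \<in> I" "s \<le> t" for s t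
    by (rule nondecreasing_of_deriv[where f = "\<lambda>x. D x * exp (P x)", OF that(3) der])
      (use between_mem[OF that(1,2)] B_nonneg in auto)
  ultimately show ?thesis using that by blast
qed

lemma D_nonneg_forward:
  assumes "s \<in> I" "t \<in> I" "s \<le> t" "D s \<ge> 0" shows "D t \<ge> 0"
proof -
  obtain P where "D s * exp (P s) \<le> D t * exp (P t)" using D_integrating_factor assms by metis
  then have "0 \<le> D t * exp (P t)" using assms(4) by (meson exp_ge_zero mult_nonneg_nonneg order_trans)
  then show ?thesis by (simp add: zero_le_mult_iff)
qed

lemma D_neg_backward:
  assumes "s \<in> I" "t \<in> I" "s \<le> t" "D t < 0" shows "D s < 0"
  using D_nonneg_forward[OF assms(1-3)] assms(4) by force

text \<open>With \<open>Q' = - D\<close> the product \<open>N exp Q\<close> has the derivative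
  \<open>- 2 U^2 exp Q\<close>, which is never positive; so a value \<open>N \<le> 0\<close> is
  never followed by a positive one, whatever the sign of \<open>D\<close>.\<close>

lemma N_integrating_factor:
  obtains Q where "\<And>s t. s \<in> I \<Longrightarrow> t \<in> I \<Longrightarrow> s \<le> t \<Longrightarrow> N t * exp (Q t) \<le> N s * exp (Q s)"
proof -
  obtain P where P: "\<And>x. x \<in> I \<Longrightarrow> (P has_real_derivative D x) (at x)"
    using antiderivative cont(6) by blast
  have der: "((\<lambda>x. N x * exp (- P x)) has_real_derivative - 2 * (U x)\<^sup>2 * exp (- P x)) (at x)"
    if "x \<in> I" for x
    using that by (auto intro!: derivative_eq_intros N_deriv P simp: algebra_simps)
  have "N t * exp (- P t) \<le> N s * exp (- P s)" if "s \<in> I" "t \<in> I" "s \<le> t" for s t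
    by (rule nonincreasing_of_deriv[where f = "\<lambda>x. N x * exp (- P x)", OF that(3) der])
      (use between_mem[OF that(1,2)] in auto)
  then show ?thesis using that[of "\<lambda>x. - P x"] by blast
qed

text \<open>The constants \<open>r0\<close>, 0, \<open>W0\<close>, 0 solve the equations for
  \<open>r\<close>, \<open>N\<close>, \<open>W\<close>, \<open>U\<close> for any function
  \<open>D\<close>. With \<open>D\<close> treated as a given coefficient, the squared distance to
  them obeys a Gronwall inequality in which \<open>\<kappa>\<close> is not compared at all.\<close>

lemma equilibrium_unique:
  assumes t: "t \<in> I" "N t = 0" "U t = 0" "F t = 0" and x: "x \<in> I"
  shows "N x = 0"
proof -
  define r0 W0 where "r0 = r t" "W0 = W t"
  have r0: "r0 > 0" using t r_pos by (simp add: r0_W0_def)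
  have F0: "(W0 ^ 3 - W0) / r0 + \<alpha>\<^sup>2 * r0 * W0 = 0"
    using t(4) by (simp add: F_def r0_W0_def power2_eq_square eval_nat_numeral algebra_simps)
  \<comment> \<open>Divided differences of the force with respect to \<open>r\<close> and
    \<open>W\<close>: since \<open>F t = 0\<close>, they make \<open>F\<close> an exact linear
    combination of the two deviations.\<close>
  define p q where "p y = - (W0 ^ 3 - W0) / (r y * r0) + \<alpha>\<^sup>2 * W0"
    "q y = ((W y)\<^sup>2 + W y * W0 + W0\<^sup>2 - 1) / r y + \<alpha>\<^sup>2 * r y" for y
  have F_eq: "F y = p y * (r y - r0) + q y * (W y - W0)" if "y \<in> I" for y
  proof -
    have "r y > 0" using that r_pos by simp
    have "F y = F y - ((W0 ^ 3 - W0) / r0 + \<alpha>\<^sup>2 * r0 * W0)" using F0 by simp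
    also have "\<dots> = p y * (r y - r0) + q y * (W y - W0)"
      using \<open>r y > 0\<close> r0 by (simp add: F_def p_q_def field_simps) algebra
    finally show ?thesis .
  qed
  define \<Phi> where "\<Phi> y = (r y - r0)\<^sup>2 + (N y)\<^sup>2 + (W y - W0)\<^sup>2 + (U y)\<^sup>2" for y
  define \<Phi>' where "\<Phi>' y = 2 * (r y - r0) * (r y * N y) + 2 * N y * (D y * N y - 2 * (U y)\<^sup>2)
    + 2 * (W y - W0) * (r y * U y) + 2 * U y * (F y - D y * U y)" for y
  define c where "c y = 2 * \<bar>r y\<bar> + 4 * \<bar>D y\<bar> + 4 * \<bar>N y\<bar> + \<bar>p y\<bar> + \<bar>q y\<bar>" for y
  define lo hi where "lo = min t x" "hi = max t x"
  have sub: "{lo..hi} \<subseteq> I" using between_mem[OF t(1) x] between_mem[OF x t(1)] by (auto simp: lo_hi_def min_def max_def split: if_splits)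
  have "\<Phi> x = 0"
  proof (rule gronwall_zero_continuous[where f = \<Phi> and f' = \<Phi>' and a = lo and b = hi and c = c and z = t])
    fix y assume "lo \<le> y" "y \<le> hi"
    then have y: "y \<in> I" using sub by auto
    show "(\<Phi> has_real_derivative \<Phi>' y) (at y)"
      unfolding \<Phi>_def \<Phi>'_def using y by (auto intro!: derivative_eq_intros sol_derivs simp: algebra_simps)
    define u w where "u = r y - r0" "w = W y - W0"
    have \<Phi>: "\<Phi> y = u\<^sup>2 + (N y)\<^sup>2 + w\<^sup>2 + (U y)\<^sup>2" by (simp add: \<Phi>_def u_w_def)
    have le: "\<bar>k * (2 * (f * g))\<bar> \<le> \<bar>k\<bar> * \<Phi> y" if "f\<^sup>2 + g\<^sup>2 \<le> \<Phi> y" for k f g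
      unfolding abs_mult[of k] using abs_mult_le_mean_squares[of f g] that by (intro mult_left_mono) auto
    have le1: "\<bar>k * f\<^sup>2\<bar> \<le> \<bar>k\<bar> * \<Phi> y" if "f\<^sup>2 \<le> \<Phi> y" for k f
      unfolding abs_mult[of k] using that by (intro mult_left_mono) auto
    have \<Phi>': "\<Phi>' y = r y * (2 * (u * N y)) + (2 * D y) * (N y)\<^sup>2 + (- 4 * N y) * (U y)\<^sup>2 + r y * (2 * (w * U y))
        + p y * (2 * (u * U y)) + q y * (2 * (w * U y)) + (- 2 * D y) * (U y)\<^sup>2"
      unfolding \<Phi>'_def F_eq[OF y] u_w_def by (simp add: algebra_simps power2_eq_square)
    have "\<bar>\<Phi>' y\<bar> \<le> \<bar>r y\<bar> * \<Phi> y + \<bar>2 * D y\<bar> * \<Phi> y + \<bar>- 4 * N y\<bar> * \<Phi> y + \<bar>r y\<bar> * \<Phi> y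
        + \<bar>p y\<bar> * \<Phi> y + \<bar>q y\<bar> * \<Phi> y + \<bar>- 2 * D y\<bar> * \<Phi> y"
      unfolding \<Phi>'
      by (intro order_trans[OF abs_triangle_ineq add_mono] le le1) (simp_all add: \<Phi>)
    also have "\<dots> = c y * \<Phi> y" by (simp add: c_def abs_mult algebra_simps)
    finally show "\<bar>\<Phi>' y\<bar> \<le> c y * \<Phi> y" .
  next
    show "continuous_on {lo..hi} c"
      unfolding c_def p_q_def using cont_on[OF sub] r_pos sub r0
      by (auto intro!: continuous_intros) (metis atLeastAtMost_iff less_irrefl subsetD)+
    show "\<Phi> t = 0" using t by (simp add: \<Phi>_def r0_W0_def)
  qed (auto simp: lo_hi_def \<Phi>_def)
  then show ?thesis unfolding \<Phi>_def
    by (smt (verit) zero_le_power2 power2_eq_iff power_zero_numeral)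
qed

text \<open>Since \<open>F = q W\<close>, the pair of \<open>W\<close> and \<open>U\<close> solves a
  homogeneous linear system with continuous coefficients \<open>r\<close>, \<open>q\<close>,
  \<open>D\<close>; a common zero therefore spreads over the whole interval.\<close>

lemma W_zero_unique:
  assumes t: "t \<in> I" "W t = 0" "U t = 0" and x: "x \<in> I"
  shows "W x = 0 \<and> U x = 0"
proof -
  define q where "q y = ((W y)\<^sup>2 - 1) / r y + \<alpha>\<^sup>2 * r y" for y
  define \<Phi> where "\<Phi> y = (W y)\<^sup>2 + (U y)\<^sup>2" for y
  define \<Phi>' where "\<Phi>' y = 2 * W y * (r y * U y) + 2 * U y * (F y - D y * U y)" for y
  define c where "c y = \<bar>r y\<bar> + \<bar>q y\<bar> + 2 * \<bar>D y\<bar>" for y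
  define lo hi where "lo = min t x" "hi = max t x"
  have sub: "{lo..hi} \<subseteq> I" using between_mem[OF t(1) x] between_mem[OF x t(1)] by (auto simp: lo_hi_def min_def max_def split: if_splits)
  have "\<Phi> x = 0"
  proof (rule gronwall_zero_continuous[where f = \<Phi> and f' = \<Phi>' and a = lo and b = hi and c = c and z = t])
    fix y assume "lo \<le> y" "y \<le> hi"
    then have y: "y \<in> I" using sub by auto
    show "(\<Phi> has_real_derivative \<Phi>' y) (at y)"
      unfolding \<Phi>_def \<Phi>'_def using y by (auto intro!: derivative_eq_intros sol_derivs simp: algebra_simps)
    have le: "\<bar>k * (2 * (W y * U y))\<bar> \<le> \<bar>k\<bar> * \<Phi> y" for k
      unfolding abs_mult[of k] \<Phi>_def using abs_mult_le_mean_squares[of "W y" "U y"] by (intro mult_left_mono) auto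
    have le1: "\<bar>k * (U y)\<^sup>2\<bar> \<le> \<bar>k\<bar> * \<Phi> y" for k
      unfolding abs_mult[of k] by (intro mult_left_mono) (auto simp: \<Phi>_def)
    have \<Phi>': "\<Phi>' y = r y * (2 * (W y * U y)) + q y * (2 * (W y * U y)) + (- 2 * D y) * (U y)\<^sup>2"
      using r_pos[OF y] unfolding \<Phi>'_def F_def q_def by (simp add: field_simps power2_eq_square)
    have "\<bar>\<Phi>' y\<bar> \<le> \<bar>r y\<bar> * \<Phi> y + \<bar>q y\<bar> * \<Phi> y + \<bar>- 2 * D y\<bar> * \<Phi> y"
      unfolding \<Phi>' by (intro order_trans[OF abs_triangle_ineq add_mono] le le1)
    also have "\<dots> = c y * \<Phi> y" by (simp add: c_def abs_mult algebra_simps)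
    finally show "\<bar>\<Phi>' y\<bar> \<le> c y * \<Phi> y" .
  next
    show "continuous_on {lo..hi} c"
      unfolding c_def q_def using cont_on[OF sub] r_pos sub
      by (auto intro!: continuous_intros) (metis atLeastAtMost_iff less_irrefl subsetD)+
    show "\<Phi> t = 0" using t by (simp add: \<Phi>_def)
  qed (auto simp: lo_hi_def \<Phi>_def)
  then show ?thesis unfolding \<Phi>_def by (simp add: sum_power2_eq_zero_iff)
qed

end

section \<open>Continuation of bounded solutions\<close>

text \<open>Products of Lipschitz functions are Lipschitz when the factors are bounded; carrying
  both properties together lets the right-hand side of the system be checked term by term.\<close>

definition bounded_lipschitz :: "'a::metric_space set \<Rightarrow> ('a \<Rightarrow> real) \<Rightarrow> bool" where
  "bounded_lipschitz S f \<longleftrightarrow> (\<exists>L K. 0 \<le> L \<and> 0 \<le> K \<and>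
    (\<forall>x\<in>S. \<forall>y\<in>S. \<bar>f x - f y\<bar> \<le> L * dist x y) \<and> (\<forall>x\<in>S. \<bar>f x\<bar> \<le> K))"

lemma bounded_lipschitz_const: "bounded_lipschitz S (\<lambda>x. c)"
  unfolding bounded_lipschitz_def by (rule exI[of _ 0], rule exI[of _ "\<bar>c\<bar>"]) auto

lemma bounded_lipschitz_add:
  assumes "bounded_lipschitz S f" "bounded_lipschitz S g"
  shows "bounded_lipschitz S (\<lambda>x. f x + g x)"
proof -
  from assms obtain L K L' K' where *: "0 \<le> L" "0 \<le> K" "0 \<le> L'" "0 \<le> K'"
    "\<And>x y. x \<in> S \<Longrightarrow> y \<in> S \<Longrightarrow> \<bar>f x - f y\<bar> \<le> L * dist x y" "\<And>x. x \<in> S \<Longrightarrow> \<bar>f x\<bar> \<le> K"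
    "\<And>x y. x \<in> S \<Longrightarrow> y \<in> S \<Longrightarrow> \<bar>g x - g y\<bar> \<le> L' * dist x y" "\<And>x. x \<in> S \<Longrightarrow> \<bar>g x\<bar> \<le> K'"
    unfolding bounded_lipschitz_def by metis
  show ?thesis unfolding bounded_lipschitz_def
  proof (intro exI conjI ballI)
    fix x y assume xy: "x \<in> S" "y \<in> S"
    show "\<bar>f x + g x - (f y + g y)\<bar> \<le> (L + L') * dist x y"
      using *(5)[OF xy] *(7)[OF xy] by (simp add: algebra_simps)
    show "\<bar>f x + g x\<bar> \<le> K + K'" using *(6)[OF xy(1)] *(8)[OF xy(1)] by linarith
  qed (use * in auto)
qed

lemma bounded_lipschitz_mult:
  assumes "bounded_lipschitz S f" "bounded_lipschitz S g"
  shows "bounded_lipschitz S (\<lambda>x. f x * g x)"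
proof -
  from assms obtain L K L' K' where *: "0 \<le> L" "0 \<le> K" "0 \<le> L'" "0 \<le> K'"
    "\<And>x y. x \<in> S \<Longrightarrow> y \<in> S \<Longrightarrow> \<bar>f x - f y\<bar> \<le> L * dist x y" "\<And>x. x \<in> S \<Longrightarrow> \<bar>f x\<bar> \<le> K"
    "\<And>x y. x \<in> S \<Longrightarrow> y \<in> S \<Longrightarrow> \<bar>g x - g y\<bar> \<le> L' * dist x y" "\<And>x. x \<in> S \<Longrightarrow> \<bar>g x\<bar> \<le> K'"
    unfolding bounded_lipschitz_def by metis
  show ?thesis unfolding bounded_lipschitz_def
  proof (intro exI conjI ballI)
    fix x y assume xy: "x \<in> S" "y \<in> S"
    have "\<bar>f x * g x - f y * g y\<bar> = \<bar>f x * (g x - g y) + (f x - f y) * g y\<bar>"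
      by (simp add: algebra_simps)
    also have "\<dots> \<le> \<bar>f x\<bar> * \<bar>g x - g y\<bar> + \<bar>f x - f y\<bar> * \<bar>g y\<bar>"
      by (metis abs_mult abs_triangle_ineq)
    also have "\<dots> \<le> K * (L' * dist x y) + (L * dist x y) * K'"
      using * xy by (intro add_mono mult_mono) auto
    finally show "\<bar>f x * g x - f y * g y\<bar> \<le> (K * L' + L * K') * dist x y" by (simp add: algebra_simps)
    show "\<bar>f x * g x\<bar> \<le> K * K'" unfolding abs_mult using * xy by (intro mult_mono) auto
  qed (use * in auto)
qed

lemma bounded_lipschitz_minus: "bounded_lipschitz S f \<Longrightarrow> bounded_lipschitz S (\<lambda>x. - f x)"
  unfolding bounded_lipschitz_def by (simp add: abs_minus_commute)

lemma bounded_lipschitz_diff: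
  "bounded_lipschitz S f \<Longrightarrow> bounded_lipschitz S g \<Longrightarrow> bounded_lipschitz S (\<lambda>x. f x - g x)"
  using bounded_lipschitz_add[of S f "\<lambda>x. - g x"] bounded_lipschitz_minus by auto

lemma bounded_lipschitz_power: "bounded_lipschitz S f \<Longrightarrow> bounded_lipschitz S (\<lambda>x. f x ^ n)"
  by (induction n) (auto intro: bounded_lipschitz_const bounded_lipschitz_mult)

lemma bounded_lipschitz_inverse:
  assumes "bounded_lipschitz S f" "m > 0" "\<And>x. x \<in> S \<Longrightarrow> m \<le> f x"
  shows "bounded_lipschitz S (\<lambda>x. inverse (f x))"
proof -
  from assms(1) obtain L where *: "0 \<le> L"
    "\<And>x y. x \<in> S \<Longrightarrow> y \<in> S \<Longrightarrow> \<bar>f x - f y\<bar> \<le> L * dist x y"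
    unfolding bounded_lipschitz_def by metis
  show ?thesis unfolding bounded_lipschitz_def
  proof (intro exI conjI ballI)
    fix x y assume xy: "x \<in> S" "y \<in> S"
    have pos: "f x > 0" "f y > 0" using assms(2) assms(3)[OF xy(1)] assms(3)[OF xy(2)] by auto
    have inv: "0 < inverse (f x)" "inverse (f x) \<le> inverse m" "0 < inverse (f y)" "inverse (f y) \<le> inverse m"
      using pos assms(2) assms(3) xy by auto
    have "\<bar>inverse (f x) - inverse (f y)\<bar> = inverse (f x) * \<bar>f x - f y\<bar> * inverse (f y)"
      using pos by (subst inverse_diff_inverse) (auto simp: abs_mult)
    also have "\<dots> \<le> inverse m * (L * dist x y) * inverse m"
      using inv assms(2) * xy by (intro mult_mono) auto
    finally show "\<bar>inverse (f x) - inverse (f y)\<bar> \<le> (inverse m * L * inverse m) * dist x y"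
      by (simp add: algebra_simps)
    show "\<bar>inverse (f x)\<bar> \<le> inverse m" using inv by simp
  qed (use * assms(2) in auto)
qed

lemma bounded_lipschitz_divide:
  assumes "bounded_lipschitz S f" "bounded_lipschitz S g" "m > 0" "\<And>x. x \<in> S \<Longrightarrow> m \<le> g x"
  shows "bounded_lipschitz S (\<lambda>x. f x / g x)"
  unfolding divide_inverse
  by (intro bounded_lipschitz_mult bounded_lipschitz_inverse[of S g m] assms)

lemma bounded_lipschitz_Pair:
  assumes "bounded_lipschitz S f" "\<exists>L. L-lipschitz_on S g"
  shows "\<exists>L. L-lipschitz_on S (\<lambda>x. (f x, g x))"
proof -
  from assms(1) obtain L where "L-lipschitz_on S f"
    unfolding bounded_lipschitz_def lipschitz_on_def dist_real_def by metis
  with assms(2) show ?thesis using lipschitz_on_Pair by blast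
qed

lemma bounded_lipschitz_imp_lipschitz: "bounded_lipschitz S f \<Longrightarrow> \<exists>L. L-lipschitz_on S f"
  unfolding bounded_lipschitz_def lipschitz_on_def dist_real_def by metis

lemma bounded_lipschitz_proj:
  assumes "bounded S" "\<And>x y. \<bar>p x - p y\<bar> \<le> dist x y"
  shows "bounded_lipschitz S p"
proof (cases "S = {}")
  case False
  then obtain z where "z \<in> S" by blast
  obtain K where K: "\<And>x. x \<in> S \<Longrightarrow> dist z x \<le> K" using assms(1) bounded_any_center[of S z] by auto
  have "K \<ge> 0" using K[OF \<open>z \<in> S\<close>] by simp
  show ?thesis unfolding bounded_lipschitz_def
  proof (intro exI conjI ballI)
    fix x y assume xy: "x \<in> S" "y \<in> S"
    show "\<bar>p x - p y\<bar> \<le> 1 * dist x y" using assms(2) by simp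
    show "\<bar>p x\<bar> \<le> \<bar>p z\<bar> + K" using assms(2)[of z x] K[OF xy(1)] by linarith
  qed (use \<open>K \<ge> 0\<close> in auto)
qed (auto simp: bounded_lipschitz_def)

lemma glued_has_real_derivative_interval:
  fixes f g f' g' :: "real \<Rightarrow> real" and a :: ereal
  assumes "a < ereal T" "d > 0"
    and f: "\<And>x. a < ereal x \<Longrightarrow> x < T \<Longrightarrow> (f has_real_derivative f' x) (at x)"
    and lim: "(f \<longlongrightarrow> g T) (at_left T)" and lim': "(f' \<longlongrightarrow> g' T) (at_left T)"
    and g: "\<And>x. x \<in> {T..T + d} \<Longrightarrow> (g has_vector_derivative g' x) (at x within {T..T + d})"
    and x: "a < ereal x" "x < T + d"
  shows "((\<lambda>x. if x < T then f x else g x) has_real_derivative (if x < T then f' x else g' x)) (at x)"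
proof -
  consider "x < T" | "x = T" | "T < x" by linarith
  then show ?thesis
  proof cases
    case 1
    then show ?thesis
      by (simp, intro has_field_derivative_transform_within_open[OF f[OF x(1) 1], of "{..<T}"]) auto
  next
    case 2
    obtain b where b: "a < ereal b" "b < T" using ereal_dense2[OF assms(1)] by auto
    have "a < ereal y" if "b < y" for y using b(1) that by (meson ereal_less_eq(3) less_imp_le less_le_trans)
    then have "((\<lambda>x. if x < T then f x else g x) has_real_derivative g' T) (at T)"
      by (intro glued_has_real_derivative[where a = b and b = "T + d" and f' = f'])
        (use assms b f in auto)
    then show ?thesis using 2 by simp
  next
    case 3
    then have "(g has_vector_derivative g' x) (at x within {T..T + d})" using g x(2) by auto
    moreover have "at x within {T..T + d} = at x"
      by (rule at_within_interior) (use 3 x(2) in simp)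
    ultimately have "(g has_real_derivative g' x) (at x)"
      by (simp only: has_real_derivative_iff_has_vector_derivative)
    then have "((\<lambda>x. if x < T then f x else g x) has_real_derivative g' x) (at x)"
      by (rule has_field_derivative_transform_within_open[of _ _ _ "{T<..}"]) (use 3 in auto)
    then show ?thesis using 3 by simp
  qed
qed

text \<open>The system without its constraint: local existence yields only the differential
  equations, and the constraint is recovered afterwards from its validity at one point.\<close>

definition eymh_ode ::
  "real \<Rightarrow> real set \<Rightarrow> (real \<Rightarrow> real) \<Rightarrow> (real \<Rightarrow> real) \<Rightarrow> (real \<Rightarrow> real) \<Rightarrow> (real \<Rightarrow> real) \<Rightarrow> (real \<Rightarrow> real) \<Rightarrow> bool"
where
  "eymh_ode \<alpha> S r N \<kappa> W U \<longleftrightarrow>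
    (\<forall>\<tau>\<in>S.
      r \<tau> > 0 \<and>
      (r has_real_derivative r \<tau> * N \<tau>) (at \<tau>) \<and>
      (N has_real_derivative (\<kappa> \<tau> - N \<tau>) * N \<tau> - 2 * (U \<tau>)\<^sup>2) (at \<tau>) \<and>
      (\<kappa> has_real_derivative 1 - (\<kappa> \<tau>)\<^sup>2 + 2 * (U \<tau>)\<^sup>2 - 2 * \<alpha>\<^sup>2 * (W \<tau>)\<^sup>2) (at \<tau>) \<and>
      (W has_real_derivative r \<tau> * U \<tau>) (at \<tau>) \<and>
      (U has_real_derivative
         W \<tau> * ((W \<tau>)\<^sup>2 - 1) / r \<tau> + \<alpha>\<^sup>2 * r \<tau> * W \<tau> - (\<kappa> \<tau> - N \<tau>) * U \<tau>) (at \<tau>))"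

text \<open>The defect of the constraint, multiplied by \<open>r\<^sup>2\<close>, is a first integral.\<close>

lemma constraint_propagates:
  assumes ode: "eymh_ode \<alpha> (einterval a b) r N \<kappa> W U"
    and s: "s \<in> einterval a b"
      "2 * \<kappa> s * N s = 1 + (N s)\<^sup>2 + 2 * (U s)\<^sup>2 - (1 - (W s)\<^sup>2)\<^sup>2 / (r s)\<^sup>2 - 2 * \<alpha>\<^sup>2 * (W s)\<^sup>2"
  shows "eymh_solution \<alpha> (einterval a b) r N \<kappa> W U"
proof -
  define G where "G t = (2 * \<kappa> t * N t - 1 - (N t)\<^sup>2 - 2 * (U t)\<^sup>2 + 2 * \<alpha>\<^sup>2 * (W t)\<^sup>2) * (r t)\<^sup>2
    + (1 - (W t)\<^sup>2)\<^sup>2" for t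
  have G_iff: "G t = 0 \<longleftrightarrow> 2 * \<kappa> t * N t = 1 + (N t)\<^sup>2 + 2 * (U t)\<^sup>2 - (1 - (W t)\<^sup>2)\<^sup>2 / (r t)\<^sup>2 - 2 * \<alpha>\<^sup>2 * (W t)\<^sup>2"
    if "t \<in> einterval a b" for t
  proof -
    have "r t \<noteq> 0" using ode that by (force simp: eymh_ode_def)
    then have "G t / (r t)\<^sup>2 = 2 * \<kappa> t * N t - 1 - (N t)\<^sup>2 - 2 * (U t)\<^sup>2 + 2 * \<alpha>\<^sup>2 * (W t)\<^sup>2 + (1 - (W t)\<^sup>2)\<^sup>2 / (r t)\<^sup>2"
      by (simp add: G_def add_divide_distrib)
    moreover have "G t = 0 \<longleftrightarrow> G t / (r t)\<^sup>2 = 0" using \<open>r t \<noteq> 0\<close> by simp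
    ultimately show ?thesis by linarith
  qed
  have G': "(G has_real_derivative 0) (at t)" if t: "t \<in> einterval a b" for t
  proof -
    have r0: "r t > 0" and d: "(r has_real_derivative r t * N t) (at t)"
      "(N has_real_derivative (\<kappa> t - N t) * N t - 2 * (U t)\<^sup>2) (at t)"
      "(\<kappa> has_real_derivative 1 - (\<kappa> t)\<^sup>2 + 2 * (U t)\<^sup>2 - 2 * \<alpha>\<^sup>2 * (W t)\<^sup>2) (at t)"
      "(W has_real_derivative r t * U t) (at t)"
      "(U has_real_derivative
         W t * ((W t)\<^sup>2 - 1) / r t + \<alpha>\<^sup>2 * r t * W t - (\<kappa> t - N t) * U t) (at t)"
      using ode t by (auto simp: eymh_ode_def)
    define u' where "u' = W t * ((W t)\<^sup>2 - 1) / r t + \<alpha>\<^sup>2 * r t * W t - (\<kappa> t - N t) * U t"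
    \<comment> \<open>Multiplied by \<open>r\<close>, the equation for \<open>U\<close> becomes
      polynomial, and the vanishing of the derivative of \<open>G\<close> becomes a ring
      identity.\<close>
    have ru: "r t * u' = W t * ((W t)\<^sup>2 - 1) + \<alpha>\<^sup>2 * (r t)\<^sup>2 * W t - r t * (\<kappa> t - N t) * U t"
    proof -
      define q where "q = W t * ((W t)\<^sup>2 - 1) / r t"
      have "r t * q = W t * ((W t)\<^sup>2 - 1)" using r0 by (simp add: q_def)
      moreover have "u' = q + \<alpha>\<^sup>2 * r t * W t - (\<kappa> t - N t) * U t" by (simp add: u'_def q_def)
      ultimately show ?thesis by algebra
    qed
    note d' = d(1-4) d(5)[folded u'_def]
    show ?thesis unfolding G_def[abs_def]
      by (rule derivative_eq_intros d' refl)+ (simp, use ru in algebra)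
  qed
  have "G t = 0" if t: "t \<in> einterval a b" for t
  proof -
    have const: "G y = G x" if "x \<in> einterval a b" "y \<in> einterval a b" "x \<le> y" for x y
    proof -
      have "z \<in> einterval a b" if "x \<le> z" "z \<le> y" for z
        using \<open>x \<in> einterval a b\<close> \<open>y \<in> einterval a b\<close> that
        by (auto simp: einterval_def) (meson ereal_less_eq(3) le_less_trans less_le_trans)+
      then show ?thesis
        using nondecreasing_of_deriv[of x y G "\<lambda>_. 0"] nonincreasing_of_deriv[of x y G "\<lambda>_. 0"] G' that(3)
        by force
    qed
    have "G t = G s" using const[of s t] const[of t s] s(1) t by linarith
    then show ?thesis using G_iff[OF s(1)] s(2) by simp
  qed
  with ode G_iff show ?thesis by (auto simp: eymh_ode_def eymh_solution_def)
qed

context eymh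
begin

text \<open>Bounds on the functions together with a positive lower bound on \<open>r\<close> bound
  all derivatives, so the functions have limits at the end point. The local solution started from
  these limits is glued on.\<close>

lemma bounded_solution_extends:
  assumes T: "T = ereal T'" and t1: "t1 \<in> I"
    and bd: "\<And>\<tau>. t1 \<le> \<tau> \<Longrightarrow> \<tau> < T' \<Longrightarrow> \<bar>N \<tau>\<bar> \<le> K \<and> \<bar>\<kappa> \<tau>\<bar> \<le> K \<and> \<bar>W \<tau>\<bar> \<le> K \<and> \<bar>U \<tau>\<bar> \<le> K \<and> r \<tau> \<le> K"
    and m: "m > 0" "\<And>\<tau>. t1 \<le> \<tau> \<Longrightarrow> \<tau> < T' \<Longrightarrow> m \<le> r \<tau>"
  shows "\<exists>T' r' N' \<kappa>' W' U'. T < T' \<and> eymh_solution \<alpha> (einterval a T') r' N' \<kappa>' W' U' \<and>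
    (\<forall>\<tau>\<in>I. r' \<tau> = r \<tau> \<and> N' \<tau> = N \<tau> \<and> \<kappa>' \<tau> = \<kappa> \<tau> \<and> W' \<tau> = W \<tau> \<and> U' \<tau> = U \<tau>)"
proof -
  have inI: "\<tau> \<in> I" if "t1 \<le> \<tau>" "\<tau> < T'" for \<tau>
    using t1 that T by (auto simp: einterval_def) (meson ereal_less_eq(3) less_le_trans)
  have t1T: "t1 < T'" using t1 T by (auto simp: einterval_def)
  define C where "C = K * K + 2 * (K * K) + (K * (K * K + 1) / m + \<alpha>\<^sup>2 * (K * K) + (K + K) * K)
     + 1 + K * K + (K + K) * K + 2 * \<alpha>\<^sup>2 * (K * K)"
  have deriv_bd: "\<bar>r \<tau> * N \<tau>\<bar> \<le> C \<and> \<bar>(\<kappa> \<tau> - N \<tau>) * N \<tau> - 2 * (U \<tau>)\<^sup>2\<bar> \<le> C \<and>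
      \<bar>1 - (\<kappa> \<tau>)\<^sup>2 + 2 * (U \<tau>)\<^sup>2 - 2 * \<alpha>\<^sup>2 * (W \<tau>)\<^sup>2\<bar> \<le> C \<and> \<bar>r \<tau> * U \<tau>\<bar> \<le> C \<and>
      \<bar>W \<tau> * ((W \<tau>)\<^sup>2 - 1) / r \<tau> + \<alpha>\<^sup>2 * r \<tau> * W \<tau> - (\<kappa> \<tau> - N \<tau>) * U \<tau>\<bar> \<le> C"
    if "t1 < \<tau>" "\<tau> < T'" for \<tau>
  proof -
    have b: "\<bar>N \<tau>\<bar> \<le> K" "\<bar>\<kappa> \<tau>\<bar> \<le> K" "\<bar>W \<tau>\<bar> \<le> K" "\<bar>U \<tau>\<bar> \<le> K" "\<bar>r \<tau>\<bar> \<le> K" "0 < r \<tau>" "m \<le> r \<tau>"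
      using bd[of \<tau>] m that r_pos[OF inI[of \<tau>]] by auto
    have K: "K \<ge> 0" using b(1) by linarith
    have D: "\<bar>\<kappa> \<tau> - N \<tau>\<bar> \<le> K + K" using b by linarith
    have p: "\<bar>x * y\<bar> \<le> X * Y" if "\<bar>x\<bar> \<le> X" "\<bar>y\<bar> \<le> Y" for x y X Y :: real
      unfolding abs_mult using that by (intro mult_mono) auto
    have W2: "\<bar>(W \<tau>)\<^sup>2\<bar> \<le> K * K" "\<bar>(U \<tau>)\<^sup>2\<bar> \<le> K * K" "\<bar>(\<kappa> \<tau>)\<^sup>2\<bar> \<le> K * K"
      unfolding power2_eq_square by (intro p b)+
    have W3: "\<bar>W \<tau> * ((W \<tau>)\<^sup>2 - 1)\<bar> \<le> K * (K * K + 1)"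
      by (intro p b) (use W2 in linarith)
    have "\<bar>W \<tau> * ((W \<tau>)\<^sup>2 - 1) / r \<tau>\<bar> \<le> K * (K * K + 1) / m"
      unfolding abs_divide using W3 b m(1) K by (intro frac_le) auto
    moreover have "\<bar>\<alpha>\<^sup>2 * (r \<tau> * W \<tau>)\<bar> \<le> \<alpha>\<^sup>2 * (K * K)" "\<bar>\<alpha>\<^sup>2 * (W \<tau>)\<^sup>2\<bar> \<le> \<alpha>\<^sup>2 * (K * K)"
      by (intro p b W2; simp)+
    moreover have "\<bar>(\<kappa> \<tau> - N \<tau>) * U \<tau>\<bar> \<le> (K + K) * K" "\<bar>(\<kappa> \<tau> - N \<tau>) * N \<tau>\<bar> \<le> (K + K) * K"
      "\<bar>r \<tau> * N \<tau>\<bar> \<le> K * K" "\<bar>r \<tau> * U \<tau>\<bar> \<le> K * K"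
      by (intro p b D)+
    moreover have "0 \<le> K * K" "0 \<le> K * (K * K + 1) / m" "0 \<le> \<alpha>\<^sup>2 * (K * K)" "0 \<le> (K + K) * K"
      using K m(1) by auto
    ultimately show ?thesis using W2 unfolding C_def abs_le_iff mult.assoc by linarith
  qed
  have raw: "(r has_real_derivative r \<tau> * N \<tau>) (at \<tau>)"
      "(N has_real_derivative (\<kappa> \<tau> - N \<tau>) * N \<tau> - 2 * (U \<tau>)\<^sup>2) (at \<tau>)"
      "(\<kappa> has_real_derivative 1 - (\<kappa> \<tau>)\<^sup>2 + 2 * (U \<tau>)\<^sup>2 - 2 * \<alpha>\<^sup>2 * (W \<tau>)\<^sup>2) (at \<tau>)"
      "(W has_real_derivative r \<tau> * U \<tau>) (at \<tau>)"
      "(U has_real_derivative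
         W \<tau> * ((W \<tau>)\<^sup>2 - 1) / r \<tau> + \<alpha>\<^sup>2 * r \<tau> * W \<tau> - (\<kappa> \<tau> - N \<tau>) * U \<tau>) (at \<tau>)"
    if "\<tau> \<in> I" for \<tau>
    using solution that by (auto simp: eymh_solution_def)
  obtain rl where rl: "(r \<longlongrightarrow> rl) (at_left T')"
    by (rule left_limit_of_bounded_deriv[of t1 T' r _ C, OF t1T raw(1)]) (use inI deriv_bd in auto)
  obtain Nl where Nl: "(N \<longlongrightarrow> Nl) (at_left T')"
    by (rule left_limit_of_bounded_deriv[of t1 T' N _ C, OF t1T raw(2)]) (use inI deriv_bd in auto)
  obtain \<kappa>l where \<kappa>l: "(\<kappa> \<longlongrightarrow> \<kappa>l) (at_left T')"
    by (rule left_limit_of_bounded_deriv[of t1 T' \<kappa> _ C, OF t1T raw(3)]) (use inI deriv_bd in auto)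
  obtain Wl where Wl: "(W \<longlongrightarrow> Wl) (at_left T')"
    by (rule left_limit_of_bounded_deriv[of t1 T' W _ C, OF t1T raw(4)]) (use inI deriv_bd in auto)
  obtain Ul where Ul: "(U \<longlongrightarrow> Ul) (at_left T')"
    by (rule left_limit_of_bounded_deriv[of t1 T' U _ C, OF t1T raw(5)]) (use inI deriv_bd in auto)
  have "m \<le> rl"
  proof (rule tendsto_lowerbound[OF rl])
    show "eventually (\<lambda>\<tau>. m \<le> r \<tau>) (at_left T')"
      using eventually_at_left_real[OF t1T] by eventually_elim (use m(2) in auto)
  qed simp
  then have rl0: "rl > 0" using m(1) by simp
  define x0 where "x0 = (rl, Nl, \<kappa>l, Wl, Ul)"
  \<comment> \<open>In this ball the first coordinate stays at least \<open>rl / 2\<close>, so the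
    division by \<open>r\<close> keeps the vector field Lipschitz.\<close>
  define S where "S = cball x0 (rl / 2)"
  define R where "R = (\<lambda>x::real\<times>real\<times>real\<times>real\<times>real. fst x)"
  define n where "n = (\<lambda>x::real\<times>real\<times>real\<times>real\<times>real. fst (snd x))"
  define k where "k = (\<lambda>x::real\<times>real\<times>real\<times>real\<times>real. fst (snd (snd x)))"
  define w where "w = (\<lambda>x::real\<times>real\<times>real\<times>real\<times>real. fst (snd (snd (snd x))))"
  define u where "u = (\<lambda>x::real\<times>real\<times>real\<times>real\<times>real. snd (snd (snd (snd x))))"
  note proj_defs = R_def n_def k_def w_def u_def
  define f where "f = (\<lambda>x. (R x * n x, (k x - n x) * n x - 2 * (u x)\<^sup>2,
     1 - (k x)\<^sup>2 + 2 * (u x)\<^sup>2 - 2 * \<alpha>\<^sup>2 * (w x)\<^sup>2, R x * u x,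
     w x * ((w x)\<^sup>2 - 1) / R x + \<alpha>\<^sup>2 * R x * w x - (k x - n x) * u x))"
  have R_S: "rl / 2 \<le> R x" if "x \<in> S" for x
  proof -
    have "dist (fst x0) (fst x) \<le> rl / 2" using that dist_fst_le[of x0 x] by (simp add: S_def)
    then show ?thesis by (simp add: R_def x0_def dist_real_def abs_if split: if_splits)
  qed
  have bS: "bounded S" by (simp add: S_def)
  have "\<bar>R x - R y\<bar> \<le> dist x y \<and> \<bar>n x - n y\<bar> \<le> dist x y \<and> \<bar>k x - k y\<bar> \<le> dist x y \<and>
      \<bar>w x - w y\<bar> \<le> dist x y \<and> \<bar>u x - u y\<bar> \<le> dist x y" for x y
    unfolding proj_defs
    using dist_fst_le[of x y] dist_snd_le[of x y] dist_fst_le[of "snd x" "snd y"] dist_snd_le[of "snd x" "snd y"]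
      dist_fst_le[of "snd (snd x)" "snd (snd y)"] dist_snd_le[of "snd (snd x)" "snd (snd y)"]
      dist_fst_le[of "snd (snd (snd x))" "snd (snd (snd y))"] dist_snd_le[of "snd (snd (snd x))" "snd (snd (snd y))"]
    by (simp add: dist_real_def)
  then have "bounded_lipschitz S R" "bounded_lipschitz S n" "bounded_lipschitz S k"
    "bounded_lipschitz S w" "bounded_lipschitz S u"
    by (intro bounded_lipschitz_proj bS; simp)+
  then have "\<exists>L. L-lipschitz_on S f"
    unfolding f_def
    by (intro bounded_lipschitz_Pair bounded_lipschitz_imp_lipschitz bounded_lipschitz_add
        bounded_lipschitz_diff bounded_lipschitz_mult bounded_lipschitz_power bounded_lipschitz_const
        bounded_lipschitz_divide[where m = "rl / 2"] R_S) (use rl0 in auto)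
  then obtain L where L: "L-lipschitz_on (cball x0 (rl / 2)) f" by (auto simp: S_def)
  obtain d \<phi> where d: "d > 0" "\<phi> T' = x0"
    and \<phi>: "\<And>t. t \<in> {T'..T' + d} \<Longrightarrow> \<phi> t \<in> cball x0 (rl / 2)"
      "\<And>t. t \<in> {T'..T' + d} \<Longrightarrow> (\<phi> has_vector_derivative f (\<phi> t)) (at t within {T'..T' + d})"
    using picard_local_solution[of "rl / 2" L x0 f T', OF _ L] rl0 by auto
  define r' N' \<kappa>' W' U' where "r' t = (if t < T' then r t else R (\<phi> t))"
    "N' t = (if t < T' then N t else n (\<phi> t))" "\<kappa>' t = (if t < T' then \<kappa> t else k (\<phi> t))"
    "W' t = (if t < T' then W t else w (\<phi> t))" "U' t = (if t < T' then U t else u (\<phi> t))" for t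
  note prime_defs = r'_N'_\<kappa>'_W'_U'_def
  note proj_deriv = bounded_linear.has_vector_derivative[OF bounded_linear_fst]
    bounded_linear.has_vector_derivative[OF bounded_linear_snd]
  have comp: "((\<lambda>t. R (\<phi> t)) has_vector_derivative R (f (\<phi> t))) (at t within {T'..T' + d})"
    "((\<lambda>t. n (\<phi> t)) has_vector_derivative n (f (\<phi> t))) (at t within {T'..T' + d})"
    "((\<lambda>t. k (\<phi> t)) has_vector_derivative k (f (\<phi> t))) (at t within {T'..T' + d})"
    "((\<lambda>t. w (\<phi> t)) has_vector_derivative w (f (\<phi> t))) (at t within {T'..T' + d})"
    "((\<lambda>t. u (\<phi> t)) has_vector_derivative u (f (\<phi> t))) (at t within {T'..T' + d})"
    if "t \<in> {T'..T' + d}" for t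
    unfolding proj_defs by (intro proj_deriv \<phi>(2) that)+
  have aT: "a < ereal T'" using a_less_T T by simp
  have inI': "x \<in> I" if "a < ereal x" "x < T'" for x using that T by (simp add: einterval_def)
  have at_T: "R (\<phi> T') = rl" "n (\<phi> T') = Nl" "k (\<phi> T') = \<kappa>l" "w (\<phi> T') = Wl" "u (\<phi> T') = Ul"
    by (simp_all add: d(2) x0_def proj_defs)
  have f_at_T: "R (f (\<phi> T')) = rl * Nl" "n (f (\<phi> T')) = (\<kappa>l - Nl) * Nl - 2 * Ul\<^sup>2"
    "k (f (\<phi> T')) = 1 - \<kappa>l\<^sup>2 + 2 * Ul\<^sup>2 - 2 * \<alpha>\<^sup>2 * Wl\<^sup>2" "w (f (\<phi> T')) = rl * Ul"
    "u (f (\<phi> T')) = Wl * (Wl\<^sup>2 - 1) / rl + \<alpha>\<^sup>2 * rl * Wl - (\<kappa>l - Nl) * Ul"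
    by (simp_all add: d(2) x0_def proj_defs f_def)
  have ode: "eymh_ode \<alpha> (einterval a (ereal (T' + d))) r' N' \<kappa>' W' U'"
    unfolding eymh_ode_def
  proof (intro ballI conjI)
    fix x assume "x \<in> einterval a (ereal (T' + d))"
    then have x: "a < ereal x" "x < T' + d" by (auto simp: einterval_def)
    show "r' x > 0"
    proof (cases "x < T'")
      case False
      then have "\<phi> x \<in> S" using \<phi>(1)[of x] x by (simp add: S_def)
      then show ?thesis using R_S[of "\<phi> x"] rl0 False by (simp add: prime_defs)
    qed (use r_pos inI' x in \<open>simp add: prime_defs\<close>)
    note glue = glued_has_real_derivative_interval[OF aT d(1) _ _ _ _ x]
    note lims = rl Nl \<kappa>l Wl Ul
    have "((\<lambda>\<tau>. r \<tau> * N \<tau>) \<longlongrightarrow> R (f (\<phi> T'))) (at_left T')"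
      unfolding f_at_T by (intro tendsto_intros lims)
    then show "(r' has_real_derivative r' x * N' x) (at x)"
      using glue[of r "\<lambda>\<tau>. r \<tau> * N \<tau>" "\<lambda>t. R (\<phi> t)" "\<lambda>t. R (f (\<phi> t))", OF raw(1)[OF inI'] _ _ comp(1)] rl
      unfolding prime_defs at_T
      by (auto simp: f_def proj_defs split: if_splits)
    have "((\<lambda>\<tau>. (\<kappa> \<tau> - N \<tau>) * N \<tau> - 2 * (U \<tau>)\<^sup>2) \<longlongrightarrow> n (f (\<phi> T'))) (at_left T')"
      unfolding f_at_T by (intro tendsto_intros lims)
    then show "(N' has_real_derivative (\<kappa>' x - N' x) * N' x - 2 * (U' x)\<^sup>2) (at x)"
      using glue[of N "\<lambda>\<tau>. (\<kappa> \<tau> - N \<tau>) * N \<tau> - 2 * (U \<tau>)\<^sup>2" "\<lambda>t. n (\<phi> t)" "\<lambda>t. n (f (\<phi> t))", OF raw(2)[OF inI'] _ _ comp(2)] Nl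
      unfolding prime_defs at_T
      by (auto simp: f_def proj_defs split: if_splits)
    have "((\<lambda>\<tau>. 1 - (\<kappa> \<tau>)\<^sup>2 + 2 * (U \<tau>)\<^sup>2 - 2 * \<alpha>\<^sup>2 * (W \<tau>)\<^sup>2) \<longlongrightarrow> k (f (\<phi> T'))) (at_left T')"
      unfolding f_at_T by (intro tendsto_intros lims)
    then show "(\<kappa>' has_real_derivative 1 - (\<kappa>' x)\<^sup>2 + 2 * (U' x)\<^sup>2 - 2 * \<alpha>\<^sup>2 * (W' x)\<^sup>2) (at x)"
      using glue[of \<kappa> "\<lambda>\<tau>. 1 - (\<kappa> \<tau>)\<^sup>2 + 2 * (U \<tau>)\<^sup>2 - 2 * \<alpha>\<^sup>2 * (W \<tau>)\<^sup>2" "\<lambda>t. k (\<phi> t)" "\<lambda>t. k (f (\<phi> t))", OF raw(3)[OF inI'] _ _ comp(3)] \<kappa>l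
      unfolding prime_defs at_T
      by (auto simp: f_def proj_defs split: if_splits)
    have "((\<lambda>\<tau>. r \<tau> * U \<tau>) \<longlongrightarrow> w (f (\<phi> T'))) (at_left T')"
      unfolding f_at_T by (intro tendsto_intros lims)
    then show "(W' has_real_derivative r' x * U' x) (at x)"
      using glue[of W "\<lambda>\<tau>. r \<tau> * U \<tau>" "\<lambda>t. w (\<phi> t)" "\<lambda>t. w (f (\<phi> t))", OF raw(4)[OF inI'] _ _ comp(4)] Wl
      unfolding prime_defs at_T
      by (auto simp: f_def proj_defs split: if_splits)
    have "((\<lambda>\<tau>. W \<tau> * ((W \<tau>)\<^sup>2 - 1) / r \<tau> + \<alpha>\<^sup>2 * r \<tau> * W \<tau> - (\<kappa> \<tau> - N \<tau>) * U \<tau>) \<longlongrightarrow>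
        u (f (\<phi> T'))) (at_left T')"
      unfolding f_at_T by (intro tendsto_intros lims) (use rl0 in auto)
    then show "(U' has_real_derivative W' x * ((W' x)\<^sup>2 - 1) / r' x + \<alpha>\<^sup>2 * r' x * W' x - (\<kappa>' x - N' x) * U' x) (at x)"
      using glue[of U "\<lambda>\<tau>. W \<tau> * ((W \<tau>)\<^sup>2 - 1) / r \<tau> + \<alpha>\<^sup>2 * r \<tau> * W \<tau> - (\<kappa> \<tau> - N \<tau>) * U \<tau>" "\<lambda>t. u (\<phi> t)" "\<lambda>t. u (f (\<phi> t))", OF raw(5)[OF inI'] _ _ comp(5)] Ul
      unfolding prime_defs at_T
      by (auto simp: f_def proj_defs split: if_splits)
  qed
  have agree: "r' \<tau> = r \<tau> \<and> N' \<tau> = N \<tau> \<and> \<kappa>' \<tau> = \<kappa> \<tau> \<and> W' \<tau> = W \<tau> \<and> U' \<tau> = U \<tau>" if "\<tau> \<in> I" for \<tau>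
    using that T by (simp add: prime_defs einterval_def)
  have "t1 \<in> einterval a (ereal (T' + d))"
    using t1 t1T d(1) by (simp add: einterval_def)
  then have "eymh_solution \<alpha> (einterval a (ereal (T' + d))) r' N' \<kappa>' W' U'"
    by (rule constraint_propagates[OF ode]) (use constraint[OF t1] agree[OF t1] in \<open>simp add: B_def\<close>)
  then show ?thesis using agree d(1) T
    by (intro exI[of _ "ereal (T' + d)"] exI[of _ r'] exI[of _ N'] exI[of _ \<kappa>'] exI[of _ W'] exI[of _ U'] conjI)
      auto
qed

end

section \<open>The sign of \<open>N\<close>\<close>

text \<open>What the global analysis takes from the boundary conditions. \<open>r_large\<close>
  rules out the fixed points with \<open>W \<noteq> 0\<close>. \<open>W_nontrivial\<close> says that
  a solution with \<open>W\<close> identically 0 reaches a radius above 1; as \<open>r\<close>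
  increases while \<open>N > 0\<close>, such a solution cannot approach the fixed point at
  \<open>r = 1\<close>.\<close>

locale eymh_flow = eymh +
  assumes maximal: "\<not> (\<exists>T' r' N' \<kappa>' W' U'. T < T' \<and> eymh_solution \<alpha> (einterval a T') r' N' \<kappa>' W' U' \<and>
         (\<forall>\<tau>\<in>einterval a T. r' \<tau> = r \<tau> \<and> N' \<tau> = N \<tau> \<and> \<kappa>' \<tau> = \<kappa> \<tau> \<and> W' \<tau> = W \<tau> \<and> U' \<tau> = U \<tau>))"
    and D_nonneg: "\<tau> \<in> einterval a T \<Longrightarrow> N \<tau> \<le> \<kappa> \<tau>"
    and N_pos_start: "\<exists>s\<in>einterval a T. \<forall>\<tau>\<in>einterval a T. \<tau> \<le> s \<longrightarrow> N \<tau> > 0"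
    and r_large: "\<exists>s\<in>einterval a T. 2 * \<alpha>\<^sup>2 - 1 < \<alpha> ^ 4 * (r s)\<^sup>2"
    and W_nontrivial: "(\<forall>\<tau>\<in>einterval a T. W \<tau> = 0) \<Longrightarrow> \<exists>s\<in>einterval a T. r s > 1"
begin

lemma D0: "\<tau> \<in> I \<Longrightarrow> D \<tau> \<ge> 0"
  using D_nonneg by (simp add: D_def)

lemma mass_nonneg: "0 \<le> 2 * \<alpha>\<^sup>2 * (W \<tau>)\<^sup>2"
  by simp

text \<open>Read as \<open>2 U^2 \<le> 1 - 2 N'\<close>, it turns bounds on \<open>N\<close> into a
  bound on the integral of \<open>U^2\<close>.\<close>

lemma U_square_le:
  assumes "\<tau> \<in> I" shows "2 * (U \<tau>)\<^sup>2 \<le> 1 - 2 * (D \<tau> * N \<tau> - 2 * (U \<tau>)\<^sup>2)"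
  using N_rate[OF assms] B_nonneg[of \<tau>] zero_le_power2[of "N \<tau>"] mass_nonneg[of \<tau>] by linarith

lemma N_rate_le:
  assumes "\<tau> \<in> I" shows "2 * (D \<tau> * N \<tau> - 2 * (U \<tau>)\<^sup>2) \<le> 1 - (N \<tau>)\<^sup>2"
  using N_rate[OF assms] B_nonneg[of \<tau>] zero_le_power2[of "U \<tau>"] mass_nonneg[of \<tau>] by linarith

text \<open>The bounds come in a definite order: \<open>N\<close> controls \<open>ln r\<close>, the
  integral of \<open>U^2\<close> then controls \<open>W\<close>, these control the force
  \<open>F\<close>, hence \<open>U\<close> because friction only damps, and then \<open>B\<close>
  and \<open>\<kappa>\<close>. A solution bounded in this way would have a continuation.\<close>

lemma no_bounded_end:
  assumes T: "T = ereal T'" and t1: "t1 \<in> I"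
    and N: "\<And>\<tau>. t1 \<le> \<tau> \<Longrightarrow> \<tau> < T' \<Longrightarrow> \<bar>N \<tau>\<bar> \<le> K"
  shows False
proof -
  have inI: "\<tau> \<in> I" if "t1 \<le> \<tau>" "\<tau> < T'" for \<tau>
    using t1 that T by (auto simp: einterval_def) (meson ereal_less_eq(3) less_le_trans)
  have t1T: "t1 < T'" using t1 T by (auto simp: einterval_def)
  have K0: "K \<ge> 0" using N[of t1] t1T by simp
  define R where "R = r t1 * exp (K * (T' - t1))"
  define m where "m = r t1 * exp (- K * (T' - t1))"
  have pos1: "r t1 > 0" using r_pos t1 by simp
  have m0: "m > 0" "R > 0" using pos1 by (auto simp: m_def R_def)
  have r_le: "r t \<le> R" if "t1 \<le> t" "t < T'" for t
  proof -
    have "r t * exp (- K * t) \<le> r t1 * exp (- K * t1)"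
    proof (rule nonincreasing_of_deriv[OF that(1)])
      fix x assume x: "t1 \<le> x" "x \<le> t"
      then have xI: "x \<in> I" using inI that by simp
      show "((\<lambda>t. r t * exp (- K * t)) has_real_derivative r x * exp (- K * x) * (N x - K)) (at x)"
        by (rule derivative_eq_intros r_deriv[OF xI] refl)+ (simp add: algebra_simps)
      show "r x * exp (- K * x) * (N x - K) \<le> 0"
        using r_pos[OF xI] N[of x] x that by (intro mult_nonneg_nonpos) auto
    qed
    then have "r t \<le> r t1 * exp (- K * t1) * exp (K * t)"
      by (simp add: exp_minus field_simps)
    also have "\<dots> = r t1 * exp (K * (t - t1))" by (simp add: mult.assoc exp_add[symmetric] right_diff_distrib)
    also have "\<dots> \<le> R" unfolding R_def using pos1 K0 that by (simp add: mult_left_mono)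
    finally show ?thesis .
  qed
  have r_ge: "m \<le> r t" if "t1 \<le> t" "t < T'" for t
  proof -
    have "r t1 * exp (K * t1) \<le> r t * exp (K * t)"
    proof (rule nondecreasing_of_deriv[OF that(1)])
      fix x assume x: "t1 \<le> x" "x \<le> t"
      then have xI: "x \<in> I" using inI that by simp
      show "((\<lambda>t. r t * exp (K * t)) has_real_derivative r x * exp (K * x) * (N x + K)) (at x)"
        by (rule derivative_eq_intros r_deriv[OF xI] refl)+ (simp add: algebra_simps)
      show "0 \<le> r x * exp (K * x) * (N x + K)"
        using r_pos[OF xI] N[of x] x that by (intro mult_nonneg_nonneg) auto
    qed
    then have "r t1 * exp (K * t1) * exp (- K * t) \<le> r t"
      by (simp add: exp_minus field_simps)
    moreover have "r t1 * exp (K * t1) * exp (- K * t) = r t1 * exp (- K * (t - t1))"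
      by (simp add: mult.assoc exp_add[symmetric] right_diff_distrib)
    moreover have "m \<le> r t1 * exp (- K * (t - t1))"
      unfolding m_def using pos1 K0 that by (simp add: mult_left_mono)
    ultimately show ?thesis by linarith
  qed
  define Wb where "Wb = \<bar>W t1\<bar> + R * (T' - t1 + 2 * K)"
  have W_le: "\<bar>W t\<bar> \<le> Wb" if t: "t1 \<le> t" "t < T'" for t
  proof -
    \<comment> \<open>The function \<open>t - N t\<close> has slope at least
      \<open>\<bar>U\<bar>\<close>, so \<open>R\<close> times it dominates the variation of
      \<open>W\<close>; the values 1 and -1 of \<open>s\<close> give the two directions.\<close>
    have step: "s * W t - R * (t - N t) \<le> s * W t1 - R * (t1 - N t1)" if s: "\<bar>s\<bar> = 1" for s
    proof (rule nonincreasing_of_deriv[OF t(1)])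
      fix x assume x: "t1 \<le> x" "x \<le> t"
      then have xI: "x \<in> I" and xT: "x < T'" using inI t by auto
      show "((\<lambda>t. s * W t - R * (t - N t)) has_real_derivative
          s * (r x * U x) - R * (1 - (D x * N x - 2 * (U x)\<^sup>2))) (at x)"
        by (rule derivative_eq_intros W_deriv[OF xI] N_deriv[OF xI] refl)+ simp
      have "0 \<le> (2 * \<bar>U x\<bar> - 1)\<^sup>2" by simp
      then have "\<bar>U x\<bar> \<le> 1 / 2 + (U x)\<^sup>2" by (simp add: power2_eq_square algebra_simps)
      also have "\<dots> \<le> 1 - (D x * N x - 2 * (U x)\<^sup>2)" using U_square_le[OF xI] by simp
      finally have "r x * \<bar>U x\<bar> \<le> R * (1 - (D x * N x - 2 * (U x)\<^sup>2))"
        using r_le[OF x(1) xT] r_pos[OF xI] by (intro mult_mono) auto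
      moreover have "s * (r x * U x) \<le> r x * \<bar>U x\<bar>"
        using s r_pos[OF xI] by (metis abs_ge_self abs_mult abs_of_pos mult_1)
      ultimately show "s * (r x * U x) - R * (1 - (D x * N x - 2 * (U x)\<^sup>2)) \<le> 0" by linarith
    qed
    have "R * (t - t1 - N t + N t1) \<le> R * (T' - t1 + 2 * K)"
      using N[OF t] N[of t1] t1T t m0 by (intro mult_left_mono) auto
    then show ?thesis using step[of 1] step[of "-1"] unfolding Wb_def by (simp add: algebra_simps)
  qed
  have Wb0: "Wb \<ge> 0" using W_le[of t1] t1T by simp
  define C where "C = Wb * (Wb * Wb + 1) / m + \<alpha>\<^sup>2 * (R * Wb)"
  have F_le: "\<bar>F t\<bar> \<le> C" if t: "t1 \<le> t" "t < T'" for t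
  proof -
    have 1: "\<bar>W t * ((W t)\<^sup>2 - 1)\<bar> \<le> Wb * (Wb * Wb + 1)"
    proof -
      have "(W t)\<^sup>2 \<le> Wb * Wb" using W_le[OF t] Wb0
        by (metis abs_of_nonneg abs_le_square_iff power2_eq_square)
      then have "\<bar>(W t)\<^sup>2 - 1\<bar> \<le> Wb * Wb + 1" by (smt (verit) zero_le_power2)
      then show ?thesis unfolding abs_mult using W_le[OF t] Wb0 by (intro mult_mono) auto
    qed
    have "\<bar>W t * ((W t)\<^sup>2 - 1) / r t\<bar> \<le> Wb * (Wb * Wb + 1) / m"
      unfolding abs_divide using 1 Wb0 m0 r_ge[OF t] by (intro frac_le) auto
    moreover have "\<bar>\<alpha>\<^sup>2 * r t * W t\<bar> \<le> \<alpha>\<^sup>2 * (R * Wb)"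
      unfolding abs_mult mult.assoc using W_le[OF t] r_le[OF t] r_pos[OF inI[OF t]] m0
      by (intro mult_mono) auto
    ultimately show ?thesis unfolding F_def C_def by linarith
  qed
  \<comment> \<open>The summand 1 allows the passage from \<open>U^2\<close> to
    \<open>\<bar>U\<bar>\<close> by \<open>2 \<bar>U\<bar> \<le> U^2 + 1\<close>.\<close>
  define Ub where "Ub = 1 + (exp (T' - t1) * ((U t1)\<^sup>2 + C\<^sup>2))"
  have U_le: "\<bar>U t\<bar> \<le> Ub" if t: "t1 \<le> t" "t < T'" for t
  proof -
    have "((U t)\<^sup>2 + C\<^sup>2) * exp (- t) \<le> ((U t1)\<^sup>2 + C\<^sup>2) * exp (- t1)"
    proof (rule nonincreasing_of_deriv[OF t(1)])
      fix x assume x: "t1 \<le> x" "x \<le> t"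
      then have xI: "x \<in> I" and xT: "x < T'" using inI t by auto
      show "((\<lambda>t. ((U t)\<^sup>2 + C\<^sup>2) * exp (- t)) has_real_derivative
          (2 * U x * (F x - D x * U x) - (U x)\<^sup>2 - C\<^sup>2) * exp (- x)) (at x)"
        by (rule derivative_eq_intros U_deriv[OF xI] refl)+ (simp add: algebra_simps)
      have "2 * U x * F x \<le> (U x)\<^sup>2 + (F x)\<^sup>2" using sum_squares_bound[of "U x" "F x"] by simp
      moreover have "(F x)\<^sup>2 \<le> C\<^sup>2" using F_le[OF x(1) xT] by (metis abs_le_square_iff abs_of_nonneg abs_ge_zero order_trans)
      moreover have "0 \<le> D x * (U x)\<^sup>2" using D0[OF xI] by simp
      ultimately have "2 * U x * (F x - D x * U x) - (U x)\<^sup>2 - C\<^sup>2 \<le> 0"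
        by (simp add: algebra_simps power2_eq_square)
      then show "(2 * U x * (F x - D x * U x) - (U x)\<^sup>2 - C\<^sup>2) * exp (- x) \<le> 0"
        by (simp add: mult_nonpos_nonneg)
    qed
    then have "(U t)\<^sup>2 + C\<^sup>2 \<le> ((U t1)\<^sup>2 + C\<^sup>2) * exp (- t1) * exp t"
      by (simp add: exp_minus field_simps)
    also have "\<dots> = ((U t1)\<^sup>2 + C\<^sup>2) * exp (t - t1)" by (simp add: mult.assoc exp_add[symmetric])
    also have "\<dots> \<le> ((U t1)\<^sup>2 + C\<^sup>2) * exp (T' - t1)" using t by (intro mult_left_mono) auto
    finally have "(U t)\<^sup>2 \<le> Ub - 1" unfolding Ub_def by (simp add: mult.commute) (smt (verit) zero_le_power2)
    moreover have "0 \<le> (\<bar>U t\<bar> - 1)\<^sup>2" by simp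
    then have "2 * \<bar>U t\<bar> \<le> (U t)\<^sup>2 + 1" by (simp add: power2_eq_square algebra_simps)
    ultimately show ?thesis by (smt (verit) zero_le_power2)
  qed
  define Cb where "Cb = (1 + Wb\<^sup>2)\<^sup>2 / m\<^sup>2"
  have B_le: "B t \<le> Cb" if t: "t1 \<le> t" "t < T'" for t
  proof -
    have "(W t)\<^sup>2 \<le> Wb\<^sup>2" using W_le[OF t] Wb0 by (metis abs_of_nonneg abs_le_square_iff)
    then have "\<bar>1 - (W t)\<^sup>2\<bar> \<le> 1 + Wb\<^sup>2" by (smt (verit) zero_le_power2)
    then have "(1 - (W t)\<^sup>2)\<^sup>2 \<le> (1 + Wb\<^sup>2)\<^sup>2" by (metis abs_ge_zero abs_le_square_iff abs_of_nonneg order_trans)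
    moreover have "m\<^sup>2 \<le> (r t)\<^sup>2" using r_ge[OF t] m0 by (simp add: power_mono)
    ultimately show ?thesis unfolding B_def Cb_def using m0 by (intro frac_le) auto
  qed
  have Cb0: "Cb \<ge> 0" by (simp add: Cb_def)
  \<comment> \<open>Upwards \<open>\<kappa>\<close> grows at most at the rate
    \<open>B \<le> Cb\<close>; from below it is bounded by \<open>N\<close>, as
    \<open>D \<ge> 0\<close>.\<close>
  define kb where "kb = \<bar>\<kappa> t1\<bar> + Cb * (T' - t1) + K"
  have k_le: "\<bar>\<kappa> t\<bar> \<le> kb" if t: "t1 \<le> t" "t < T'" for t
  proof -
    have "\<kappa> t - Cb * t \<le> \<kappa> t1 - Cb * t1"
    proof (rule nonincreasing_of_deriv[OF t(1)])
      fix x assume x: "t1 \<le> x" "x \<le> t"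
      then have xI: "x \<in> I" and xT: "x < T'" using inI t by auto
      show "((\<lambda>t. \<kappa> t - Cb * t) has_real_derivative (B x - (D x)\<^sup>2) - Cb) (at x)"
        by (rule derivative_eq_intros kappa_deriv[OF xI] refl)+ simp
      show "(B x - (D x)\<^sup>2) - Cb \<le> 0" using B_le[OF x(1) xT] by (smt (verit) zero_le_power2)
    qed
    moreover have "Cb * t \<le> Cb * T'" using Cb0 t by (intro mult_left_mono) auto
    moreover have "0 \<le> Cb * (T' - t1)" using Cb0 t1T by simp
    moreover have "- K \<le> \<kappa> t" using N[OF t] D_nonneg[OF inI[OF t]] by linarith
    ultimately show ?thesis unfolding kb_def using K0 by (simp add: algebra_simps)
  qed
  define K' where "K' = Max {K, kb, Wb, Ub, R}"
  have "K \<le> K'" "kb \<le> K'" "Wb \<le> K'" "Ub \<le> K'" "R \<le> K'" by (auto simp: K'_def)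
  note bounds = this
  have "\<bar>N t\<bar> \<le> K' \<and> \<bar>\<kappa> t\<bar> \<le> K' \<and> \<bar>W t\<bar> \<le> K' \<and> \<bar>U t\<bar> \<le> K' \<and> r t \<le> K'" if "t1 \<le> t" "t < T'" for t
    using bounds N[OF that] k_le[OF that] W_le[OF that] U_le[OF that] r_le[OF that] by linarith
  from bounded_solution_extends[OF T t1 this m0(1) r_ge] maximal show False by blast
qed

text \<open>Between two zeros the integrating factor forces \<open>N = 0\<close>. Then
  \<open>N' = 0\<close> gives \<open>U = 0\<close>, and \<open>U' = 0\<close> gives
  \<open>F = 0\<close>, so the solution sits at an equilibrium and \<open>N\<close> would vanish
  also at the start, where it is positive.\<close>

lemma N_zero_iff_one:
  assumes st: "s \<in> I" "t \<in> I" "N s = 0" "N t = 0" shows "s = t"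
proof -
  have False if st: "s \<in> I" "t \<in> I" "N s = 0" "N t = 0" "s < t" for s t
  proof -
    obtain Q where Q: "\<And>s t. s \<in> I \<Longrightarrow> t \<in> I \<Longrightarrow> s \<le> t \<Longrightarrow> N t * exp (Q t) \<le> N s * exp (Q s)"
      using N_integrating_factor by blast
    have mem: "x \<in> I" if "s \<le> x" "x \<le> t" for x using between_mem[OF st(1,2) that] .
    have N0: "N x = 0" if "s \<le> x" "x \<le> t" for x
      using Q[OF st(1) mem[OF that] that(1)] Q[OF mem[OF that] st(2) that(2)] st(3,4)
      by (simp add: mult_le_0_iff zero_le_mult_iff)
    have U0: "U x = 0" if "s < x" "x < t" for x
    proof -
      have "(N has_real_derivative 0) (at x)"
        by (rule has_field_derivative_transform_within_open[where f = "\<lambda>_. 0" and S = "{s<..<t}"])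
          (use that N0 in auto)
      then have "D x * N x - 2 * (U x)\<^sup>2 = 0" using N_deriv mem that DERIV_unique by (metis less_imp_le)
      then show ?thesis using N0[of x] that by simp
    qed
    define y where "y = (s + t) / 2"
    have y: "s < y" "y < t" using st(5) by (auto simp: y_def)
    have "(U has_real_derivative 0) (at y)"
      by (rule has_field_derivative_transform_within_open[where f = "\<lambda>_. 0" and S = "{s<..<t}"])
        (use y U0 in auto)
    then have "F y - D y * U y = 0" using U_deriv[of y] mem[of y] y DERIV_unique by (metis less_imp_le)
    then have "F y = 0" using U0[OF y] by simp
    then have "\<And>x. x \<in> I \<Longrightarrow> N x = 0"
      using equilibrium_unique[of y] mem[of y] N0[of y] U0[OF y] y by simp
    then show False using N_pos_start by force
  qed
  from this[of s t] this[of t s] st show ?thesis by (meson less_linear)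
qed

lemma N_sign:
  assumes t0: "t0 \<in> I" "N t0 = 0" and x: "x \<in> I"
  shows "x < t0 \<Longrightarrow> N x > 0" "x > t0 \<Longrightarrow> N x < 0"
proof -
  obtain Q where Q: "\<And>s t. s \<in> I \<Longrightarrow> t \<in> I \<Longrightarrow> s \<le> t \<Longrightarrow> N t * exp (Q t) \<le> N s * exp (Q s)"
    using N_integrating_factor by blast
  have ne: "N x \<noteq> 0" if "x \<noteq> t0" using N_zero_iff_one[OF t0(1) x t0(2)] that by auto
  show "N x > 0" if "x < t0"
    using Q[OF x t0(1)] that t0(2) ne by (auto simp: zero_le_mult_iff less_le)
  show "N x < 0" if "x > t0"
    using Q[OF t0(1) x] that t0(2) ne by (auto simp: mult_le_0_iff less_le)
qed

lemma N_zero_or_pos: "(\<exists>t0\<in>I. N t0 = 0) \<or> (\<forall>x\<in>I. N x > 0)"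
proof (rule ccontr)
  assume *: "\<not> ?thesis"
  then obtain x where x: "x \<in> I" "N x < 0" by force
  obtain s where s: "s \<in> I" "\<And>\<tau>. \<tau> \<in> I \<Longrightarrow> \<tau> \<le> s \<Longrightarrow> N \<tau> > 0" using N_pos_start by blast
  have "s < x" using s(2)[of x] x by force
  have sub: "{s..x} \<subseteq> I" using between_mem[OF s(1) x(1)] by auto
  obtain c where "s < c" "c \<le> x" "N c = 0"
    using first_zero[of s x N] \<open>s < x\<close> cont_on(2)[OF sub] s(2)[OF s(1)] x(2) by auto
  moreover have "c \<in> I" using sub calculation by auto
  ultimately show False using * by blast
qed

lemma N_zero_changes_sign:
  assumes "t0 \<in> I"
  shows "changes_sign_at N t0 \<longleftrightarrow> N t0 = 0"
proof
  assume N0: "N t0 = 0"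
  obtain e where e: "e > 0" "ball t0 e \<subseteq> I" using open_I assms open_contains_ball by blast
  then have sub: "{t0 - e<..<t0 + e} \<subseteq> I" by (simp add: ball_eq_greaterThanLessThan)
  have "eventually (\<lambda>\<tau>. \<tau> \<in> {t0 - e<..<t0}) (at_left t0)" "eventually (\<lambda>\<tau>. \<tau> \<in> {t0<..<t0 + e}) (at_right t0)"
    using e(1) by (intro eventually_at_left_real eventually_at_right_real; simp)+
  moreover have "N \<tau> > 0" if "\<tau> \<in> {t0 - e<..<t0}" for \<tau>
    using N_sign(1)[OF assms N0, of \<tau>] sub that e(1) by (auto simp: subset_eq)
  moreover have "N \<tau> < 0" if "\<tau> \<in> {t0<..<t0 + e}" for \<tau>
    using N_sign(2)[OF assms N0, of \<tau>] sub that e(1) by (auto simp: subset_eq)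
  ultimately have "eventually (\<lambda>\<tau>. N \<tau> > 0) (at_left t0)" "eventually (\<lambda>\<tau>. N \<tau> < 0) (at_right t0)"
    by (metis (mono_tags, lifting) eventually_mono)+
  with N0 show "changes_sign_at N t0" by (simp add: changes_sign_at_def)
qed (simp add: changes_sign_at_def)

lemma r_le_turning:
  assumes t0: "t0 \<in> I" "N t0 = 0" and x: "x \<in> I"
  shows "r x \<le> r t0"
proof (cases "x \<le> t0")
  case True
  have "y \<in> I" "0 \<le> r y * N y" if "x \<le> y" "y \<le> t0" for y
    using between_mem[OF x t0(1) that] N_sign(1)[OF t0, of y] r_pos[of y] that t0(2)
    by (cases "y = t0"; auto)+
  then show ?thesis using nondecreasing_of_deriv[OF True r_deriv] by blast
next
  case False
  have "y \<in> I" "r y * N y \<le> 0" if "t0 \<le> y" "y \<le> x" for y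
    using between_mem[OF t0(1) x that] N_sign(2)[OF t0, of y] r_pos[of y] that t0(2)
    by (cases "y = t0"; auto simp: mult_le_0_iff)+
  then show ?thesis using nonincreasing_of_deriv[of t0 x r, OF _ r_deriv] False by force
qed

text \<open>Above 1 the inequality \<open>2 N' \<le> 1 - N^2\<close> makes \<open>N\<close>
  decrease, so positivity already confines \<open>N\<close> to a bounded range and a finite end is
  impossible.\<close>

lemma N_pos_imp_T_infinite:
  assumes pos: "\<And>x. x \<in> I \<Longrightarrow> N x > 0"
  shows "T = \<infinity>"
proof (rule ccontr)
  assume "T \<noteq> \<infinity>"
  then obtain T' where T': "T = ereal T'" using a_less_T by (cases T) auto
  obtain t1 where t1: "t1 \<in> I" using N_pos_start by blast
  have inI: "\<tau> \<in> I" if "t1 \<le> \<tau>" "\<tau> < T'" for \<tau>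
    using t1 that T' by (auto simp: einterval_def) (meson ereal_less_eq(3) less_le_trans)
  have "\<bar>N t\<bar> \<le> max (N t1) 1" if t: "t1 \<le> t" "t < T'" for t
  proof -
    have "N t \<le> max (N t1) 1"
    proof (rule barrier[OF t(1)])
      fix x assume x: "t1 \<le> x" "x \<le> t"
      then show "(N has_real_derivative D x * N x - 2 * (U x)\<^sup>2) (at x)" using N_deriv inI t by auto
      assume "N x > 1"
      then have "(N x)\<^sup>2 \<ge> 1" by simp
      then show "D x * N x - 2 * (U x)\<^sup>2 \<le> 0" using N_rate_le[of x] inI[of x] x t by force
    qed
    then show ?thesis using pos[OF inI[OF t]] by simp
  qed
  then show False using no_bounded_end[OF T' t1] by blast
qed

end

section \<open>The bag of gold\<close>

context eymh_flow
begin

text \<open>If \<open>D\<close> vanished at \<open>t\<close>, monotonicity of \<open>D\<close> times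
  its integrating factor would make it vanish on a whole stretch beginning before the turning point.
  Then \<open>D' = 0\<close> forces \<open>B = U = 0\<close>, so \<open>N\<close> would be constant
  there, although it drops from a positive value to 0.\<close>

lemma D_pos_after_turning:
  assumes t0: "t0 \<in> I" "N t0 = 0" and t: "t \<in> I" "t0 < t"
  shows "D t > 0"
proof (rule ccontr)
  assume "\<not> D t > 0"
  then have Dt: "D t = 0" using D0[OF t(1)] by simp
  obtain s where s: "s \<in> I" "\<And>\<tau>. \<tau> \<in> I \<Longrightarrow> \<tau> \<le> s \<Longrightarrow> N \<tau> > 0" using N_pos_start by blast
  have "s < t0" using s(2)[OF t0(1)] t0(2) by force
  obtain P where P: "\<And>s t. s \<in> I \<Longrightarrow> t \<in> I \<Longrightarrow> s \<le> t \<Longrightarrow> D s * exp (P s) \<le> D t * exp (P t)"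
    using D_integrating_factor by metis
  have mem: "x \<in> I" if "s \<le> x" "x \<le> t" for x using between_mem[OF s(1) t(1) that] .
  have D_zero: "D x = 0" if "s \<le> x" "x \<le> t" for x
    using P[OF mem[OF that] t(1) that(2)] Dt D0[OF mem[OF that]]
    by (simp add: mult_le_0_iff)
  have N_rate0: "D x * N x - 2 * (U x)\<^sup>2 = 0" if "s < x" "x < t" for x
  proof -
    have "(D has_real_derivative 0) (at x)"
      by (rule has_field_derivative_transform_within_open[where f = "\<lambda>_. 0" and S = "{s<..<t}"])
        (use that D_zero in auto)
    then have "B x + 2 * (U x)\<^sup>2 - D x * \<kappa> x = 0"
      using D_deriv mem that DERIV_unique by (metis less_imp_le)
    then have "B x + 2 * (U x)\<^sup>2 = 0" using D_zero[of x] that by simp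
    then have "(U x)\<^sup>2 = 0" using B_nonneg[of x] by (smt (verit) zero_le_power2)
    then show ?thesis using D_zero[of x] that by simp
  qed
  have "N s \<le> N t0"
  proof (rule DERIV_nonneg_imp_increasing_open[where f = N and a = s and b = t0])
    show "s \<le> t0" using \<open>s < t0\<close> by simp
    show "continuous_on {s..t0} N" using cont_on(2) mem t(2) by (force simp: subset_eq)
    fix x assume "s < x" "x < t0"
    then show "\<exists>y. (N has_real_derivative y) (at x) \<and> 0 \<le> y"
      using N_deriv[OF mem, of x] N_rate0[of x] t(2) by force
  qed
  then show False using s(2)[OF s(1)] t0(2) by simp
qed

lemma N_nonincreasing_after_turning:
  assumes t0: "t0 \<in> I" "N t0 = 0" and t: "x \<in> I" "y \<in> I" "t0 < x" "x \<le> y"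
  shows "N y \<le> N x"
proof (rule nonincreasing_of_deriv[OF t(4) N_deriv])
  fix z assume "x \<le> z" "z \<le> y"
  then show zI: "z \<in> I" using between_mem[OF t(1,2)] by blast
  have "N z < 0" using N_sign(2)[OF t0 zI] \<open>x \<le> z\<close> t(3) by simp
  then show "D z * N z - 2 * (U z)\<^sup>2 \<le> 0"
    using D0[OF zI] by (smt (verit) mult_nonneg_nonpos zero_le_power2)
qed

text \<open>Suppose \<open>T = \<infinity>\<close>. Below -1 the inequality
  \<open>2 N' \<le> 1 - N^2\<close> drives \<open>N\<close> to minus infinity in finite time, so
  \<open>N\<close> stays between -1 and some \<open>- \<delta> < 0\<close>. In that range
  \<open>D\<close> is forced above 1, and then \<open>N' \<le> D N \<le> - \<delta>\<close>
  contradicts the lower bound.\<close>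

lemma turning_imp_T_finite:
  assumes t0: "t0 \<in> I" "N t0 = 0"
  shows "T \<noteq> \<infinity>"
proof
  assume T: "T = \<infinity>"
  define t1 where "t1 = t0 + 1"
  have inI: "t \<in> I" if "t1 \<le> t" for t
    using right_mem[OF T t0(1)] that by (simp add: t1_def)
  define \<delta> where "\<delta> = - N t1"
  have d0: "\<delta> > 0" using N_sign(2)[OF t0 inI[of t1]] by (simp add: \<delta>_def t1_def)
  have N_mono: "N y \<le> N x" if "t1 \<le> x" "x \<le> y" for x y
    using N_nonincreasing_after_turning[OF t0 inI inI] that by (simp add: t1_def)
  have N_le: "N t \<le> - \<delta>" if "t1 \<le> t" for t using N_mono[OF _ that] by (simp add: \<delta>_def)
  have N_ge: "N t \<ge> - 1" if t: "t1 \<le> t" for t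
  proof (rule ccontr)
    assume "\<not> N t \<ge> - 1"
    then have Nt: "N t < - 1" by simp
    \<comment> \<open>A lower bound for the slope of \<open>1 / N\<close> below the level
      \<open>N t\<close>: the slope is at least \<open>(1 - 1 / N^2) / 2\<close>, which increases
      with \<open>N^2\<close>. But \<open>1 / N\<close> has to stay negative.\<close>
    define c where "c = (1 - 1 / (N t)\<^sup>2) / 2"
    have Nt2: "(N t)\<^sup>2 > 1" using power_strict_mono[of 1 "- N t" 2] Nt by simp
    then have c0: "c > 0" using Nt by (simp add: c_def field_simps)
    have "filterlim (\<lambda>x. inverse (N x)) at_top at_top"
    proof (rule filterlim_at_top_of_deriv)
      fix x assume x: "t \<le> x"
      then have xI: "x \<in> I" using inI t by simp
      have Nx: "N x \<le> N t" using N_mono t x by simp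
      then have "N x \<noteq> 0" using Nt by simp
      then show "((\<lambda>x. inverse (N x)) has_real_derivative - (D x * N x - 2 * (U x)\<^sup>2) / (N x)\<^sup>2) (at x)"
        by (auto intro!: derivative_eq_intros N_deriv[OF xI] simp: power2_eq_square field_simps)
      have sq: "(N t)\<^sup>2 \<le> (N x)\<^sup>2" using power_mono[of "- N t" "- N x" 2] Nx Nt by simp
      then have "1 / (N x)\<^sup>2 \<le> 1 / (N t)\<^sup>2" using sq Nt Nx by (intro divide_left_mono) (auto intro!: mult_pos_pos)
      then have "c \<le> ((N x)\<^sup>2 - 1) / 2 / (N x)\<^sup>2"
        using \<open>N x \<noteq> 0\<close> by (simp add: c_def diff_divide_distrib)
      also have "\<dots> \<le> - (D x * N x - 2 * (U x)\<^sup>2) / (N x)\<^sup>2"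
        using N_rate_le[OF xI] by (intro divide_right_mono) (auto simp: field_simps)
      finally show "c \<le> - (D x * N x - 2 * (U x)\<^sup>2) / (N x)\<^sup>2" .
    qed fact
    then have "eventually (\<lambda>x. inverse (N x) \<ge> 1) at_top" by (simp add: filterlim_at_top)
    then obtain x0 where "\<And>x. x \<ge> x0 \<Longrightarrow> inverse (N x) \<ge> 1" by (auto simp: eventually_at_top_linorder)
    from this[of "max x0 t"] N_mono[OF t, of "max x0 t"] Nt show False
      by (smt (verit) inverse_nonpositive_iff_nonpositive max.cobounded1 max.cobounded2)
  qed
  have Dpos: "D t > 0" if "t1 \<le> t" for t
    using D_pos_after_turning[OF t0 inI[OF that]] that by (simp add: t1_def)
  \<comment> \<open>The derivative of \<open>ln D\<close> is at least
    \<open>- \<kappa> = - D - N\<close>, and the loss \<open>- D\<close> is compensated by the slope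
    of \<open>- N / \<delta>\<close>, which is at least \<open>D\<close>. What remains is
    \<open>- N \<ge> \<delta>\<close>, hence the linear term.\<close>
  define g where "g t = ln (D t) - N t / \<delta> - \<delta> * t" for t
  have g_mono: "g t1 \<le> g t" if t: "t1 \<le> t" for t
  proof (rule nondecreasing_of_deriv[OF t])
    fix x assume x: "t1 \<le> x" "x \<le> t"
    then have xI: "x \<in> I" using inI by simp
    note D_x = Dpos[OF x(1)]
    show "(g has_real_derivative (B x + 2 * (U x)\<^sup>2 - D x * \<kappa> x) / D x - (D x * N x - 2 * (U x)\<^sup>2) / \<delta> - \<delta>) (at x)"
      unfolding g_def using D_x d0
      by (auto intro!: derivative_eq_intros D_deriv[OF xI] N_deriv[OF xI])
    have 1: "(B x + 2 * (U x)\<^sup>2 - D x * \<kappa> x) / D x \<ge> - D x - N x"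
    proof -
      have "(B x + 2 * (U x)\<^sup>2 - D x * \<kappa> x) / D x = (B x + 2 * (U x)\<^sup>2) / D x - \<kappa> x"
        using D_x by (simp add: diff_divide_distrib)
      moreover have "(B x + 2 * (U x)\<^sup>2) / D x \<ge> 0" using D_x B_nonneg[of x] by simp
      ultimately show ?thesis by (simp add: D_def)
    qed
    have "D x * \<delta> \<le> - (D x * N x - 2 * (U x)\<^sup>2)"
      using mult_left_mono[OF N_le[OF x(1)], of "D x"] D_x by (smt (verit) mult_minus_right zero_le_power2)
    then have 2: "D x \<le> - ((D x * N x - 2 * (U x)\<^sup>2) / \<delta>)" using d0 by (simp add: field_simps)
    show "0 \<le> (B x + 2 * (U x)\<^sup>2 - D x * \<kappa> x) / D x - (D x * N x - 2 * (U x)\<^sup>2) / \<delta> - \<delta>"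
      using 1 2 N_le[OF x(1)] by linarith
  qed
  define t2 where "t2 = max t1 ((1 / \<delta> - g t1) / \<delta>)"
  have D_ge1: "D t \<ge> 1" if t: "t2 \<le> t" for t
  proof -
    have tt: "t1 \<le> t" "(1 / \<delta> - g t1) / \<delta> \<le> t" using t by (auto simp: t2_def)
    then have "1 / \<delta> - g t1 \<le> \<delta> * t" using d0 by (simp add: field_simps)
    moreover have "N t / \<delta> \<ge> - 1 / \<delta>" using N_ge[OF tt(1)] d0 by (simp add: field_simps)
    ultimately have "ln (D t) \<ge> 0" using g_mono[OF tt(1)] unfolding g_def by simp
    then show ?thesis using Dpos[OF tt(1)] by simp
  qed
  have "filterlim N at_bot at_top"
  proof (rule filterlim_at_bot_of_deriv[where c = \<delta>, OF N_deriv])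
    fix x assume x: "t2 \<le> x"
    then have x1: "t1 \<le> x" by (simp add: t2_def)
    then show "x \<in> I" using inI by simp
    have "D x * N x \<le> 1 * N x"
      by (rule mult_right_mono_neg) (use D_ge1[OF x] N_le[OF x1] d0 in auto)
    then show "D x * N x - 2 * (U x)\<^sup>2 \<le> - \<delta>" using N_le[OF x1] by (smt (verit) zero_le_power2)
  qed (rule d0)
  then have "eventually (\<lambda>x. N x \<le> - 2) at_top" by (simp add: filterlim_at_bot)
  then obtain x0 where "\<And>x. x \<ge> x0 \<Longrightarrow> N x \<le> - 2" by (auto simp: eventually_at_top_linorder)
  from this[of "max x0 t1"] N_ge[of "max x0 t1"] show False by simp
qed

text \<open>After the turning point \<open>N\<close> does not increase; with a lower bound it would
  be bounded up to the finite end.\<close>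

lemma N_tendsto_minus_infinity:
  assumes t0: "t0 \<in> I" "N t0 = 0" and T: "T = ereal T'"
  shows "filterlim N at_bot (at_left T')"
proof -
  have t0T: "t0 < T'" using t0 T by (simp add: einterval_def)
  have inI: "t \<in> I" if "t0 \<le> t" "t < T'" for t
    using t0(1) that T by (auto simp: einterval_def) (meson ereal_less_eq(3) less_le_trans)
  have "eventually (\<lambda>t. N t \<le> Z) (at_left T')" for Z
  proof -
    have "\<exists>t. t0 < t \<and> t < T' \<and> N t \<le> Z"
    proof (rule ccontr)
      assume *: "\<not> (\<exists>t. t0 < t \<and> t < T' \<and> N t \<le> Z)"
      have "\<bar>N t\<bar> \<le> \<bar>Z\<bar>" if "t0 \<le> t" "t < T'" for t
        using * N_sign(2)[OF t0 inI[OF that]] that t0(2) by (cases "t = t0") force+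
      then show False using no_bounded_end[OF T t0(1)] by blast
    qed
    then obtain t where t: "t0 < t" "t < T'" "N t \<le> Z" by blast
    have "N x \<le> Z" if "x \<in> {t<..<T'}" for x
      using N_nonincreasing_after_turning[OF t0 inI inI, of t x] t that by force
    then show ?thesis using eventually_at_left_real[OF t(2)] by (auto elim: eventually_mono)
  qed
  then show ?thesis by (simp add: filterlim_at_bot)
qed

text \<open>Suppose \<open>r\<close> stays away from \<open>0\<close> and put \<open>h = T - \<tau>\<close>. From \<open>2 N' \<le> 1 - N\<^sup>2\<close> one gets
  \<open>\<bar>N\<bar> = O(1 / h)\<close>, and since \<open>-N' \<ge> 2 U\<^sup>2\<close> this controls \<open>U\<close> well enough to give
  \<open>W\<^sup>6 = O(1 / h)\<close>. Then \<open>F = O(1 / sqrt h)\<close> is integrable, so \<open>U\<close>, hence \<open>W\<close>, \<open>D\<close> and finally \<open>N\<close>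
  are bounded, contradicting \<open>N \<rightarrow> -\<infinity>\<close>.\<close>

lemma r_not_bounded_below:
  assumes t0: "t0 \<in> I" "N t0 = 0" and T: "T = ereal T'" and m: "m > 0"
  shows "\<exists>t\<in>I. t0 < t \<and> r t < m"
proof (rule ccontr)
  assume *: "\<not> ?thesis"
  have t0T: "t0 < T'" using t0 T by (simp add: einterval_def)
  have inI: "t \<in> I" if "t0 \<le> t" "t < T'" for t
    using t0(1) that T by (auto simp: einterval_def) (meson ereal_less_eq(3) less_le_trans)
  have r_ge: "m \<le> r t" if "t0 < t" "t < T'" for t using * inI[of t] that by force
  have lim: "filterlim N at_bot (at_left T')" by (rule N_tendsto_minus_infinity[OF t0 T])
  then have "eventually (\<lambda>t. N t \<le> - 2) (at_left T')" by (simp add: filterlim_at_bot)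
  from eventually_conj[OF this eventually_at_left_real[OF t0T]]
  obtain t1 where t1: "N t1 \<le> - 2" "t0 < t1" "t1 < T'"
    using eventually_happens[of _ "at_left T'"] by fastforce
  have mem: "t \<in> I" if "t1 \<le> t" "t < T'" for t using inI that t1 by simp
  have N_le: "N t \<le> - 2" if "t1 \<le> t" "t < T'" for t
    using N_nonincreasing_after_turning[OF t0 mem[of t1] mem[OF that] t1(2) that(1)] t1 by simp
  define R where "R = r t1"
  have m_le: "m \<le> r t" if "t1 \<le> t" "t < T'" for t using r_ge that t1 by simp
  have R0: "R > 0" using r_pos[OF mem[of t1]] t1 by (simp add: R_def)
  have r_le: "r t \<le> R" if t: "t1 \<le> t" "t < T'" for t
    unfolding R_def
  proof (rule nonincreasing_of_deriv[OF t(1) r_deriv])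
    fix x assume x: "t1 \<le> x" "x \<le> t"
    then show "x \<in> I" using mem t by simp
    then show "r x * N x \<le> 0" using r_pos[of x] N_le[of x] x t by (simp add: mult_le_0_iff)
  qed
  have hN: "- ((T' - t) * N t) \<le> 8 / 3" if t: "t1 \<le> t" "t < T'" for t
  proof -
    \<comment> \<open>For \<open>N \<le> - 2\<close> one has
      \<open>- N' \<ge> (N^2 - 1) / 2 \<ge> 3 / 8 * N^2\<close>, so \<open>1 / N\<close> rises at
      least at the rate 3/8, and its limit at \<open>T'\<close> is 0.\<close>
    define g where "g x = inverse (N x) - 3 / 8 * x" for x
    have mono: "g t \<le> g y" if y: "t \<le> y" "y < T'" for y
    proof (rule nondecreasing_of_deriv[OF y(1)])
      fix x assume x: "t \<le> x" "x \<le> y"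
      then have xI: "x \<in> I" and x': "t1 \<le> x" "x < T'" using mem t y by auto
      have Nx: "N x \<le> - 2" using N_le[OF x'] .
      then show "(g has_real_derivative - (D x * N x - 2 * (U x)\<^sup>2) / (N x)\<^sup>2 - 3 / 8) (at x)"
        unfolding g_def
        by (auto intro!: derivative_eq_intros N_deriv[OF xI] simp: power2_eq_square field_simps)
      have "2\<^sup>2 \<le> (- N x)\<^sup>2" using Nx by (intro power_mono) auto
      then have "3 / 8 * (N x)\<^sup>2 \<le> - (D x * N x - 2 * (U x)\<^sup>2)"
        using N_rate_le[OF xI] by simp
      then show "0 \<le> - (D x * N x - 2 * (U x)\<^sup>2) / (N x)\<^sup>2 - 3 / 8"
        using Nx by (simp add: field_simps)
    qed
    have "(g \<longlongrightarrow> 0 - 3 / 8 * T') (at_left T')"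
      unfolding g_def
      by (intro tendsto_intros filterlim_compose[OF tendsto_inverse_0]
          filterlim_at_bot_imp_at_infinity lim)
    moreover have "eventually (\<lambda>y. g t \<le> g y) (at_left T')"
      using eventually_at_left_real[OF t(2)] by eventually_elim (use mono in auto)
    ultimately have "g t \<le> 0 - 3 / 8 * T'"
      by (rule tendsto_lowerbound) simp
    then have "3 / 8 * (T' - t) \<le> - inverse (N t)" by (simp add: g_def algebra_simps)
    then show ?thesis using N_le[OF t] by (simp add: field_simps)
  qed
  define c where "c = 3 / 8 * R\<^sup>2"
  have c0: "c > 0" using R0 by (simp add: c_def)
  \<comment> \<open>With \<open>h = T' - t\<close> the last bracket has derivative
    \<open>h N' \<le> - 2 h U^2\<close>, and the inequality of the means gives
    \<open>R \<bar>U\<bar> \<le> 1 / (3 h) + 3 / 4 * R^2 h U^2\<close>, which fixes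
    \<open>c\<close>. The weight 1/3 of the logarithm of \<open>h\<close> is what makes
    \<open>W^6\<close>, and with it \<open>F^2\<close>, of order \<open>1 / h\<close>.\<close>
  define L where "L t = ln (1 + (W t)\<^sup>2) + 1 / 3 * ln (T' - t) + c * ((T' - t) * N t + ln (r t))" for t
  have L_mono: "L t \<le> L t1" if t: "t1 \<le> t" "t < T'" for t
  proof (rule nonincreasing_of_deriv[OF t(1)])
    fix x assume x: "t1 \<le> x" "x \<le> t"
    then have xI: "x \<in> I" and x': "t1 \<le> x" "x < T'" using mem t by auto
    define h where "h = T' - x"
    have h: "h > 0" using x' by (simp add: h_def)
    have rx: "r x > 0" using r_pos[OF xI] .
    have W1: "1 + (W x)\<^sup>2 > 0" by (smt (verit) zero_le_power2)
    show "(L has_real_derivative 2 * W x * (r x * U x) / (1 + (W x)\<^sup>2) - 1 / 3 / h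
        + c * (h * (D x * N x - 2 * (U x)\<^sup>2))) (at x)"
      unfolding L_def h_def using rx W1 h
      by (auto intro!: derivative_eq_intros W_deriv[OF xI] r_deriv[OF xI] N_deriv[OF xI] simp: h_def divide_simps)
        (simp add: algebra_simps)?
    have "2 * \<bar>W x\<bar> \<le> 1 + (W x)\<^sup>2"
      using zero_le_power2[of "\<bar>W x\<bar> - 1"] by (simp add: power2_eq_square algebra_simps)
    then have "2 * W x * (r x * U x) \<le> (1 + (W x)\<^sup>2) * (R * \<bar>U x\<bar>)"
    proof -
      have "2 * W x * (r x * U x) \<le> \<bar>2 * W x * (r x * U x)\<bar>" by simp
      also have "\<dots> = (2 * \<bar>W x\<bar>) * (r x * \<bar>U x\<bar>)" using rx by (simp add: abs_mult)
      also have "\<dots> \<le> (1 + (W x)\<^sup>2) * (R * \<bar>U x\<bar>)"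
        using \<open>2 * \<bar>W x\<bar> \<le> 1 + (W x)\<^sup>2\<close> r_le[OF x'] rx R0 by (intro mult_mono) auto
      finally show ?thesis .
    qed
    then have 1: "2 * W x * (r x * U x) / (1 + (W x)\<^sup>2) \<le> R * \<bar>U x\<bar>"
      using W1 by (simp add: divide_le_eq mult.commute)
    have 2: "R * \<bar>U x\<bar> \<le> 1 / 3 / h + 2 * c * h * (U x)\<^sup>2"
    proof -
      have "0 \<le> (2 - 3 * R * h * \<bar>U x\<bar>)\<^sup>2" by simp
      then have "12 * (R * \<bar>U x\<bar>) * h \<le> 4 + 9 * R\<^sup>2 * h\<^sup>2 * (U x)\<^sup>2"
        by (simp add: power2_eq_square algebra_simps)
      then show ?thesis using h by (simp add: c_def field_simps power2_eq_square)
    qed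
    have "D x * N x \<le> 0" using D0[OF xI] N_le[OF x'] by (simp add: mult_nonneg_nonpos)
    then have "c * (h * (D x * N x - 2 * (U x)\<^sup>2)) \<le> c * (h * (- 2 * (U x)\<^sup>2))"
      using c0 h by (intro mult_left_mono) auto
    with 1 2 show "2 * W x * (r x * U x) / (1 + (W x)\<^sup>2) - 1 / 3 / h
        + c * (h * (D x * N x - 2 * (U x)\<^sup>2)) \<le> 0"
      by (simp add: algebra_simps)
  qed
  define A where "A = sqrt (exp (3 * (L t1 + c * (8 / 3) - c * ln m)))"
  have A0: "A > 0" by (simp add: A_def)
  have W6: "(1 + (W t)\<^sup>2) ^ 3 \<le> A\<^sup>2 / (T' - t)" if t: "t1 \<le> t" "t < T'" for t
  proof -
    have W1: "1 + (W t)\<^sup>2 > 0" by (smt (verit) zero_le_power2)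
    have "c * (- ((T' - t) * N t)) \<le> c * (8 / 3)" using c0 hN[OF t] by (intro mult_left_mono) auto
    moreover have "c * ln m \<le> c * ln (r t)"
      using c0 m m_le[OF t] by (intro mult_left_mono) auto
    ultimately have "ln (1 + (W t)\<^sup>2) + 1 / 3 * ln (T' - t) \<le> L t1 + c * (8 / 3) - c * ln m"
      using L_mono[OF t] unfolding L_def[of t] by (simp add: algebra_simps)
    then have "3 * ln (1 + (W t)\<^sup>2) + ln (T' - t) \<le> 3 * (L t1 + c * (8 / 3) - c * ln m)" by simp
    moreover have "3 * ln (1 + (W t)\<^sup>2) + ln (T' - t) = ln ((1 + (W t)\<^sup>2) ^ 3 * (T' - t))"
      using W1 t by (simp add: ln_mult ln_realpow)
    moreover have pos: "(1 + (W t)\<^sup>2) ^ 3 * (T' - t) > 0" using W1 t by simp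
    ultimately have "(1 + (W t)\<^sup>2) ^ 3 * (T' - t) \<le> exp (3 * (L t1 + c * (8 / 3) - c * ln m))"
      by (metis exp_le_cancel_iff exp_ln)
    also have "\<dots> = A\<^sup>2" by (simp add: A_def)
    finally show ?thesis using t by (simp add: field_simps)
  qed
  define q where "q = 1 / m + \<alpha>\<^sup>2 * R"
  have q0: "q > 0" using m R0 by (simp add: q_def add_pos_nonneg)
  have F_le: "\<bar>F t\<bar> \<le> q * A / sqrt (T' - t)" if t: "t1 \<le> t" "t < T'" for t
  proof -
    have W1: "1 + (W t)\<^sup>2 > 0" by (smt (verit) zero_le_power2)
    have rt: "m \<le> r t" "r t \<le> R" "0 < r t" using m_le[OF t] r_le[OF t] m by auto
    have "\<bar>F t\<bar> \<le> \<bar>W t\<bar> * ((1 + (W t)\<^sup>2) * q)"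
    proof -
      have "F t = W t * (((W t)\<^sup>2 - 1) / r t + \<alpha>\<^sup>2 * r t)" by (simp add: F_def algebra_simps)
      moreover have "\<bar>((W t)\<^sup>2 - 1) / r t\<bar> \<le> (1 + (W t)\<^sup>2) / m"
        unfolding abs_divide using rt m by (intro frac_le) (auto simp: abs_le_iff)
      moreover have "\<alpha>\<^sup>2 * r t \<le> (1 + (W t)\<^sup>2) * (\<alpha>\<^sup>2 * R)"
      proof -
        have "\<alpha>\<^sup>2 * r t \<le> 1 * (\<alpha>\<^sup>2 * R)" using rt by (simp add: mult_left_mono)
        also have "\<dots> \<le> (1 + (W t)\<^sup>2) * (\<alpha>\<^sup>2 * R)" using R0 by (intro mult_right_mono) auto
        finally show ?thesis .
      qed
      moreover have "0 \<le> \<alpha>\<^sup>2 * r t" using rt by simp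
      moreover have "(1 + (W t)\<^sup>2) * q = (1 + (W t)\<^sup>2) / m + (1 + (W t)\<^sup>2) * (\<alpha>\<^sup>2 * R)"
        by (simp add: q_def distrib_left)
      ultimately have "\<bar>((W t)\<^sup>2 - 1) / r t + \<alpha>\<^sup>2 * r t\<bar> \<le> (1 + (W t)\<^sup>2) * q"
        by linarith
      then show ?thesis unfolding \<open>F t = _\<close> abs_mult by (intro mult_left_mono) auto
    qed
    then have "(F t)\<^sup>2 \<le> (\<bar>W t\<bar> * ((1 + (W t)\<^sup>2) * q))\<^sup>2"
      by (metis abs_ge_zero power2_abs power_mono)
    also have "\<dots> = (W t)\<^sup>2 * (1 + (W t)\<^sup>2)\<^sup>2 * q\<^sup>2" by (simp add: power_mult_distrib)
    also have "\<dots> \<le> (1 + (W t)\<^sup>2) * (1 + (W t)\<^sup>2)\<^sup>2 * q\<^sup>2" by (intro mult_right_mono) auto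
    also have "\<dots> = (1 + (W t)\<^sup>2) ^ 3 * q\<^sup>2" by (simp add: power3_eq_cube power2_eq_square)
    also have "\<dots> \<le> A\<^sup>2 / (T' - t) * q\<^sup>2" using W6[OF t] by (intro mult_right_mono) auto
    also have "\<dots> = (q * A / sqrt (T' - t))\<^sup>2" using t by (simp add: power_divide power_mult_distrib)
    finally have "\<bar>F t\<bar> \<le> \<bar>q * A / sqrt (T' - t)\<bar>" by (simp only: abs_le_square_iff)
    then show ?thesis using q0 A0 t by simp
  qed
  \<comment> \<open>\<open>sqrt (1 + U^2)\<close> is a smooth substitute for
    \<open>\<bar>U\<bar>\<close>, and the square root of the remaining time comes from integrating
    the bound on \<open>F\<close>.\<close>
  define Ub where "Ub = sqrt (1 + (U t1)\<^sup>2) + 2 * (q * A) * sqrt (T' - t1)"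
  have U_le: "\<bar>U t\<bar> \<le> Ub" if t: "t1 \<le> t" "t < T'" for t
  proof -
    have "sqrt (1 + (U t)\<^sup>2) - 2 * (q * A) * (- sqrt (T' - t)) \<le> sqrt (1 + (U t1)\<^sup>2) - 2 * (q * A) * (- sqrt (T' - t1))"
    proof (rule nonincreasing_of_deriv[OF t(1)])
      fix x assume x: "t1 \<le> x" "x \<le> t"
      then have xI: "x \<in> I" and x': "t1 \<le> x" "x < T'" using mem t by auto
      have V1: "1 + (U x)\<^sup>2 > 0" by (smt (verit) zero_le_power2)
      show "((\<lambda>t. sqrt (1 + (U t)\<^sup>2) - 2 * (q * A) * (- sqrt (T' - t))) has_real_derivative
          U x * (F x - D x * U x) / sqrt (1 + (U x)\<^sup>2) - q * A / sqrt (T' - x)) (at x)"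
        using V1 x' by (auto intro!: derivative_eq_intros U_deriv[OF xI] simp: field_simps)
      have ge: "\<bar>U x\<bar> \<le> sqrt (1 + (U x)\<^sup>2)" by (rule real_le_rsqrt) simp
      have "U x * (F x - D x * U x) \<le> \<bar>U x\<bar> * \<bar>F x\<bar>"
      proof -
        have "U x * F x \<le> \<bar>U x\<bar> * \<bar>F x\<bar>" by (metis abs_ge_self abs_mult)
        moreover have "0 \<le> D x * (U x)\<^sup>2" using D0[OF xI] by simp
        ultimately show ?thesis by (simp add: algebra_simps power2_eq_square)
      qed
      also have "\<dots> \<le> sqrt (1 + (U x)\<^sup>2) * \<bar>F x\<bar>" using ge by (intro mult_right_mono) auto
      finally have "U x * (F x - D x * U x) / sqrt (1 + (U x)\<^sup>2) \<le> \<bar>F x\<bar>"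
        using V1 by (simp add: divide_le_eq mult.commute)
      with F_le[OF x'] show "U x * (F x - D x * U x) / sqrt (1 + (U x)\<^sup>2) - q * A / sqrt (T' - x) \<le> 0" by simp
    qed
    moreover have "\<bar>U t\<bar> \<le> sqrt (1 + (U t)\<^sup>2)" by (rule real_le_rsqrt) simp
    moreover have "0 \<le> 2 * (q * A) * sqrt (T' - t)" using q0 A0 t by simp
    ultimately show ?thesis unfolding Ub_def by linarith
  qed
  have Ub0: "Ub \<ge> 0" using U_le[of t1] t1 by simp
  define Wb where "Wb = \<bar>W t1\<bar> + R * Ub * (T' - t1)"
  have W_le: "\<bar>W t\<bar> \<le> Wb" if t: "t1 \<le> t" "t < T'" for t
  proof -
    have step: "s * W t - R * Ub * t \<le> s * W t1 - R * Ub * t1" if s: "\<bar>s\<bar> = 1" for s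
    proof (rule nonincreasing_of_deriv[OF t(1)])
      fix x assume x: "t1 \<le> x" "x \<le> t"
      then have xI: "x \<in> I" and x': "t1 \<le> x" "x < T'" using mem t by auto
      show "((\<lambda>t. s * W t - R * Ub * t) has_real_derivative s * (r x * U x) - R * Ub) (at x)"
        by (rule derivative_eq_intros W_deriv[OF xI] refl)+ simp
      have "s * (r x * U x) \<le> r x * \<bar>U x\<bar>"
        using s r_pos[OF xI] by (metis abs_ge_self abs_mult abs_of_pos mult_1)
      also have "\<dots> \<le> R * Ub" using r_le[OF x'] r_pos[OF xI] U_le[OF x'] R0 by (intro mult_mono) auto
      finally show "s * (r x * U x) - R * Ub \<le> 0" by simp
    qed
    have "R * Ub * t \<le> R * Ub * T'" using R0 Ub0 t by (intro mult_left_mono) auto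
    then show ?thesis using step[of 1] step[of "-1"] unfolding Wb_def by (simp add: algebra_simps)
  qed
  define Bb where "Bb = (1 + Wb\<^sup>2)\<^sup>2 / m\<^sup>2"
  have B_le: "B t \<le> Bb" if t: "t1 \<le> t" "t < T'" for t
  proof -
    have "(W t)\<^sup>2 \<le> Wb\<^sup>2" using W_le[OF t] by (metis abs_ge_zero power2_abs power_mono)
    then have "\<bar>1 - (W t)\<^sup>2\<bar> \<le> 1 + Wb\<^sup>2" by (smt (verit) zero_le_power2)
    then have "(1 - (W t)\<^sup>2)\<^sup>2 \<le> (1 + Wb\<^sup>2)\<^sup>2" by (metis abs_ge_zero power2_abs power_mono)
    moreover have "m\<^sup>2 \<le> (r t)\<^sup>2" using m_le[OF t] m by (simp add: power_mono)
    ultimately show ?thesis unfolding B_def Bb_def using m by (intro frac_le) auto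
  qed
  \<comment> \<open>In the derivative of \<open>D r\<close> the terms with \<open>N\<close> cancel,
    leaving \<open>r (B + 2 U^2 - D^2)\<close>, which is at most \<open>E\<close>.\<close>
  define E where "E = R * (Bb + 2 * Ub\<^sup>2)"
  have E0: "E \<ge> 0" using R0 by (simp add: E_def Bb_def)
  define Db where "Db = (D t1 * r t1 + E * (T' - t1)) / m"
  have D_le: "D t \<le> Db" if t: "t1 \<le> t" "t < T'" for t
  proof -
    have "D t * r t - E * t \<le> D t1 * r t1 - E * t1"
    proof (rule nonincreasing_of_deriv[OF t(1)])
      fix x assume x: "t1 \<le> x" "x \<le> t"
      then have xI: "x \<in> I" and x': "t1 \<le> x" "x < T'" using mem t by auto
      show "((\<lambda>t. D t * r t - E * t) has_real_derivative r x * (B x + 2 * (U x)\<^sup>2 - (D x)\<^sup>2) - E) (at x)"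
        by (rule derivative_eq_intros D_deriv[OF xI] r_deriv[OF xI] refl)+
          (simp add: D_def algebra_simps power2_eq_square)
      have "(U x)\<^sup>2 \<le> Ub\<^sup>2" using U_le[OF x'] by (metis abs_ge_zero power2_abs power_mono)
      then have "r x * (B x + 2 * (U x)\<^sup>2 - (D x)\<^sup>2) \<le> r x * (Bb + 2 * Ub\<^sup>2)"
        using B_le[OF x'] r_pos[OF xI] zero_le_power2[of "D x"] by (intro mult_left_mono) linarith+
      also have "\<dots> \<le> E" unfolding E_def using r_le[OF x'] by (intro mult_right_mono) (auto simp: Bb_def)
      finally show "r x * (B x + 2 * (U x)\<^sup>2 - (D x)\<^sup>2) - E \<le> 0" by simp
    qed
    moreover have "E * t \<le> E * T'" using E0 t by (intro mult_left_mono) auto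
    moreover have "D t * m \<le> D t * r t" using m_le[OF t] D0[OF mem[OF t]] by (intro mult_left_mono) auto
    ultimately have "D t * m \<le> D t1 * r t1 + E * (T' - t1)" by (simp add: algebra_simps)
    then show ?thesis using m by (simp add: Db_def field_simps)
  qed
  \<comment> \<open>Because \<open>N \<le> - 2\<close>, the source \<open>- 2 U^2\<close> is also at
    least \<open>Ub^2 N\<close>; hence \<open>N' \<ge> K N\<close>, and \<open>N\<close> goes down
    at most exponentially.\<close>
  define K where "K = Db + Ub\<^sup>2"
  have K0: "K \<ge> 0" using D_le[of t1] D0[OF mem[of t1]] t1 by (simp add: K_def)
  have N_ge: "N t1 * exp (K * (T' - t1)) \<le> N t" if t: "t1 \<le> t" "t < T'" for t
  proof -
    have "N t1 * exp (- K * t1) \<le> N t * exp (- K * t)"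
    proof (rule nondecreasing_of_deriv[OF t(1)])
      fix x assume x: "t1 \<le> x" "x \<le> t"
      then have xI: "x \<in> I" and x': "t1 \<le> x" "x < T'" using mem t by auto
      show "((\<lambda>t. N t * exp (- K * t)) has_real_derivative (D x * N x - 2 * (U x)\<^sup>2 - K * N x) * exp (- K * x)) (at x)"
        by (rule derivative_eq_intros N_deriv[OF xI] refl)+ (simp add: algebra_simps)
      have "(U x)\<^sup>2 \<le> Ub\<^sup>2" using U_le[OF x'] by (metis abs_ge_zero power2_abs power_mono)
      moreover have "Ub\<^sup>2 * N x \<le> Ub\<^sup>2 * (- 2)" using N_le[OF x'] by (intro mult_left_mono) auto
      moreover have "Db * N x \<le> D x * N x" using D_le[OF x'] N_le[OF x'] by (intro mult_right_mono_neg) auto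
      ultimately have "0 \<le> D x * N x - 2 * (U x)\<^sup>2 - K * N x" by (simp add: K_def algebra_simps)
      then show "0 \<le> (D x * N x - 2 * (U x)\<^sup>2 - K * N x) * exp (- K * x)" by simp
    qed
    then have "N t1 * exp (- K * t1) * exp (K * t) \<le> N t" by (simp add: exp_minus field_simps)
    moreover have "N t1 * exp (- K * t1) * exp (K * t) = N t1 * exp (K * (t - t1))"
      by (simp add: mult.assoc exp_add[symmetric] right_diff_distrib)
    moreover have "N t1 * exp (K * (T' - t1)) \<le> N t1 * exp (K * (t - t1))"
      using t K0 t1(1) by (intro mult_left_mono_neg) (auto simp: mult_left_mono)
    ultimately show ?thesis by linarith
  qed
  have "eventually (\<lambda>t. N t \<le> N t1 * exp (K * (T' - t1)) - 1) (at_left T')"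
    using lim by (simp add: filterlim_at_bot)
  from eventually_conj[OF this eventually_at_left_real[OF t1(3)]]
  obtain t where "N t \<le> N t1 * exp (K * (T' - t1)) - 1" "t1 < t" "t < T'"
    using eventually_happens[of _ "at_left T'"] by fastforce
  with N_ge[of t] show False by simp
qed

lemma r_tendsto_0:
  assumes t0: "t0 \<in> I" "N t0 = 0" and T: "T = ereal T'"
  shows "(r \<longlongrightarrow> 0) (at_left T')"
proof (rule order_tendstoI)
  fix y :: real assume "y < 0"
  have "t0 < T'" using t0 T by (simp add: einterval_def)
  from eventually_at_left_real[OF this] show "eventually (\<lambda>x. y < r x) (at_left T')"
  proof eventually_elim
    fix x assume "x \<in> {t0<..<T'}"
    then have "x \<in> I" using t0(1) T by (auto simp: einterval_def) (meson ereal_less_eq(3) less_imp_le less_le_trans)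
    then show "y < r x" using r_pos[of x] \<open>y < 0\<close> by simp
  qed
next
  fix y :: real assume "0 < y"
  then obtain t where t: "t \<in> I" "t0 < t" "r t < y" using r_not_bounded_below[OF t0 T] by blast
  have "t < T'" using t T by (simp add: einterval_def)
  from eventually_at_left_real[OF this] show "eventually (\<lambda>x. r x < y) (at_left T')"
  proof eventually_elim
    fix x assume x: "x \<in> {t<..<T'}"
    then have xI: "x \<in> I" using t(1) T by (auto simp: einterval_def) (meson ereal_less_eq(3) less_imp_le less_le_trans)
    have "r x \<le> r t"
    proof (rule nonincreasing_of_deriv[OF _ r_deriv])
      show "t \<le> x" using x by simp
      fix z assume z: "t \<le> z" "z \<le> x"
      then show zI: "z \<in> I" using between_mem[OF t(1) xI] by simp
      show "r z * N z \<le> 0" using r_pos[OF zI] N_sign(2)[OF t0 zI] t z by (simp add: mult_le_0_iff)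
    qed
    then show "r x < y" using t(3) by simp
  qed
qed

end

section \<open>Solutions with \<open>N\<close> positive\<close>

locale eymh_global = eymh_flow +
  assumes N_pos: "\<tau> \<in> einterval a T \<Longrightarrow> N \<tau> > 0"
begin

lemma T_infinite: "T = \<infinity>"
  by (rule N_pos_imp_T_infinite) (rule N_pos)

lemma eventually_in_I: "eventually (\<lambda>t. t \<in> I) at_top"
proof -
  obtain s where "s \<in> I" using N_pos_start by blast
  then show ?thesis using right_mem[OF T_infinite] by (auto simp: eventually_at_top_linorder)
qed

lemma eventually_deriv:
  assumes "\<And>t. t \<in> I \<Longrightarrow> (f has_real_derivative f' t) (at t)"
  shows "eventually (\<lambda>t. (f has_real_derivative f' t) (at t)) at_top"
  using eventually_in_I assms by (rule eventually_mono)

lemma r_mono: "s \<in> I \<Longrightarrow> s \<le> t \<Longrightarrow> r s \<le> r t"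
proof (rule nondecreasing_of_deriv[OF _ r_deriv])
  fix x assume "s \<in> I" "s \<le> x"
  then show "x \<in> I" using right_mem[OF T_infinite] by blast
  then show "0 \<le> r x * N x" using r_pos[of x] N_pos[of x] by simp
qed

section \<open>Eventual bounds on \<open>N\<close> and \<open>D\<close>\<close>

lemma eventually_N_le: "eventually (\<lambda>t. N t \<le> 2) at_top"
proof (rule eventually_le_of_deriv[OF eventually_deriv[OF N_deriv]])
  show "eventually (\<lambda>t. 2 < N t \<longrightarrow> D t * N t - 2 * (U t)\<^sup>2 \<le> - 1) at_top"
    using eventually_in_I
  proof eventually_elim
    case (elim t)
    show ?case
    proof
      assume "2 < N t"
      then have "2\<^sup>2 \<le> (N t)\<^sup>2" by (intro power_mono) auto
      then show "D t * N t - 2 * (U t)\<^sup>2 \<le> - 1" using N_rate_le[OF elim] by simp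
    qed
  qed
qed auto

lemma eventually_D_le: "eventually (\<lambda>t. D t \<le> 7) at_top"
proof -
  have "eventually (\<lambda>t. \<kappa> t + N t \<le> 7) at_top"
  proof (rule eventually_le_of_deriv[OF eventually_deriv[OF DERIV_add[OF kappa_deriv N_deriv]]])
    show "eventually (\<lambda>t. 7 < \<kappa> t + N t \<longrightarrow> B t - (D t)\<^sup>2 + (D t * N t - 2 * (U t)\<^sup>2) \<le> - 1) at_top"
      using eventually_in_I eventually_N_le
    proof eventually_elim
      case (elim t)
      show ?case
      proof
        \<comment> \<open>The sum is \<open>D + 2 N\<close>, and \<open>N \<le> 2\<close> leaves at
          least 3 for \<open>D\<close>. By the constraint \<open>B\<close> and \<open>U^2\<close>
          cancel from the derivative of the sum, and the rest is at most
          \<open>1 - D^2\<close>.\<close>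
        assume "7 < \<kappa> t + N t"
        then have "3 \<le> D t" using elim by (simp add: D_def)
        then have "9 \<le> (D t)\<^sup>2" using power_mono[of 3 "D t" 2] by simp
        moreover have "0 \<le> D t * N t" using D0[OF elim(1)] N_pos[OF elim(1)] by simp
        ultimately show "B t - (D t)\<^sup>2 + (D t * N t - 2 * (U t)\<^sup>2) \<le> - 1"
          using N_rate[OF elim(1)] zero_le_power2[of "N t"] mass_nonneg[of t] by argo
      qed
    qed
  qed auto
  then show ?thesis using eventually_in_I
  proof eventually_elim
    case (elim t)
    then show ?case using N_pos[of t] by (simp add: D_def)
  qed
qed

section \<open>Boundedness of \<open>W\<close>\<close>

definition p :: "real \<Rightarrow> real" where "p t = W t * (r t * U t)"

text \<open>\<open>p\<close> is half the derivative of \<open>W^2\<close>, so its sign tells whether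
  \<open>\<bar>W\<bar>\<close> grows. In its derivative the middle term is the force, repulsive
  where \<open>W^2 - 1 + \<alpha>^2 r^2 > 0\<close>, and the last one is friction.\<close>

definition p' :: "real \<Rightarrow> real" where
  "p' t = (r t)\<^sup>2 * (U t)\<^sup>2 + (W t)\<^sup>2 * ((W t)\<^sup>2 - 1 + \<alpha>\<^sup>2 * (r t)\<^sup>2) + (N t - D t) * p t"

lemma rF: "t \<in> I \<Longrightarrow> r t * F t = W t * ((W t)\<^sup>2 - 1 + \<alpha>\<^sup>2 * (r t)\<^sup>2)"
  using r_pos[of t] by (simp add: F_def field_simps power2_eq_square)

lemma p_deriv:
  assumes "t \<in> I" shows "(p has_real_derivative p' t) (at t)"
proof -
  have "(p has_real_derivative r t * U t * (r t * U t) + (r t * N t * U t + (F t - D t * U t) * r t) * W t) (at t)"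
    unfolding p_def by (intro DERIV_mult' DERIV_mult W_deriv[OF assms] r_deriv[OF assms] U_deriv[OF assms])
  moreover have "r t * U t * (r t * U t) + (r t * N t * U t + (F t - D t * U t) * r t) * W t = p' t"
    using rF[OF assms] unfolding p'_def p_def by algebra
  ultimately show ?thesis by simp
qed

lemma W_square_deriv:
  assumes "t \<in> I" shows "((\<lambda>t. (W t)\<^sup>2) has_real_derivative 2 * p t) (at t)"
  by (rule derivative_eq_intros W_deriv[OF assms] refl)+ (simp add: p_def)

text \<open>While \<open>p \<ge> 0\<close>, \<open>W^2\<close> does not fall below its initial
  value, so the force stays repulsive; with \<open>D \<le> 7\<close> this gives
  \<open>p' \<ge> - 7 p\<close>, and \<open>p exp (7 t)\<close> cannot come down to 0.\<close>

lemma p_stays_positive: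
  assumes mem: "\<And>t. t0 \<le> t \<Longrightarrow> t \<in> I" and D_le: "\<And>t. t0 \<le> t \<Longrightarrow> D t \<le> 7" and p0: "p t0 > 0"
    and c: "\<And>t. t0 \<le> t \<Longrightarrow> (W t0)\<^sup>2 \<le> (W t)\<^sup>2 \<Longrightarrow> (W t)\<^sup>2 - 1 + \<alpha>\<^sup>2 * (r t)\<^sup>2 \<ge> 0"
    and t: "t0 \<le> t"
  shows "p t > 0"
proof (rule ccontr)
  assume "\<not> p t > 0"
  moreover have "continuous_on {t0..t} p"
    by (rule has_real_derivative_continuous_on[where f' = p']) (use mem p_deriv in auto)
  ultimately obtain e where e: "t0 < e" "e \<le> t" "p e = 0" "\<And>x. t0 \<le> x \<Longrightarrow> x < e \<Longrightarrow> p x > 0"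
    using first_zero[of t0 t p] p0 t by auto
  have p_nonneg: "p x \<ge> 0" if "t0 \<le> x" "x \<le> e" for x
    using e that by (cases "x = e") (auto intro: less_imp_le)
  have W_mono: "(W t0)\<^sup>2 \<le> (W x)\<^sup>2" if "t0 \<le> x" "x \<le> e" for x
    by (rule nondecreasing_of_deriv[OF that(1) W_square_deriv[OF mem]]) (use p_nonneg that in auto)
  have "p t0 * exp (7 * t0) \<le> p e * exp (7 * e)"
  proof (rule nondecreasing_of_deriv[where f = "\<lambda>x. p x * exp (7 * x)" and a = t0 and b = e])
    fix x assume x: "t0 \<le> x" "x \<le> e"
    show "((\<lambda>x. p x * exp (7 * x)) has_real_derivative (p' x + 7 * p x) * exp (7 * x)) (at x)"
      by (rule derivative_eq_intros p_deriv[OF mem] refl x)+ (simp add: algebra_simps)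
    have "0 \<le> (N x - D x + 7) * p x"
      using D_le[OF x(1)] N_pos[OF mem[OF x(1)]] p_nonneg[OF x] by simp
    moreover have "0 \<le> (W x)\<^sup>2 * ((W x)\<^sup>2 - 1 + \<alpha>\<^sup>2 * (r x)\<^sup>2)" using c[OF x(1) W_mono[OF x]] by simp
    moreover have "0 \<le> (r x)\<^sup>2 * (U x)\<^sup>2" by simp
    ultimately have "0 \<le> p' x + 7 * p x" unfolding p'_def distrib_right by linarith
    then show "0 \<le> (p' x + 7 * p x) * exp (7 * x)" by simp
  qed (use e in simp)
  then show False using e(3) p0 by (simp add: mult_le_0_iff)
qed

text \<open>A field that grows while outside \<open>[-1, 1]\<close> would make \<open>W\<^sup>2 / r\<close>, hence \<open>B\<close>, unbounded and
  drive \<open>N\<close> to \<open>-\<infinity>\<close>.\<close>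

lemma W_not_growing_outside:
  assumes mem: "\<And>t. t0 \<le> t \<Longrightarrow> t \<in> I" and D_le: "\<And>t. t0 \<le> t \<Longrightarrow> D t \<le> 7"
    and N_le: "\<And>t. t0 \<le> t \<Longrightarrow> N t \<le> 2"
    and W0: "(W t0)\<^sup>2 \<ge> 1"
  shows "p t0 \<le> 0"
proof (rule ccontr)
  assume "\<not> p t0 \<le> 0"
  then have p0: "p t0 > 0" by simp
  have pos: "p t > 0" if "t0 \<le> t" for t
    by (rule p_stays_positive[OF mem D_le p0 _ that]) (use W0 in \<open>auto simp: add_nonneg_nonneg\<close>)
  have W_mono: "(W s)\<^sup>2 \<le> (W t)\<^sup>2" if "t0 \<le> s" "s \<le> t" for s t
    by (rule nondecreasing_of_deriv[OF that(2) W_square_deriv[OF mem]]) (use pos that in \<open>auto intro: less_imp_le\<close>)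
  \<comment> \<open>One unit of time later \<open>W^2\<close> is strictly above 1, which gives the
    repulsive force a uniform lower bound \<open>\<eta>\<close> even if \<open>W^2 = 1\<close> at
    the start.\<close>
  define w1 where "w1 = (W (t0 + 1))\<^sup>2"
  have "(W t0)\<^sup>2 < w1" unfolding w1_def
    by (rule DERIV_pos_imp_increasing[where f = "\<lambda>t. (W t)\<^sup>2"]) (use W_square_deriv[OF mem] pos in \<open>auto intro!: exI\<close>)
  then have w1: "w1 > 1" using W0 by simp
  define \<eta> where "\<eta> = w1 * (w1 - 1)"
  have e0: "\<eta> > 0" using w1 by (simp add: \<eta>_def)
  have W_ge: "(W t)\<^sup>2 \<ge> w1" if "t0 + 1 \<le> t" for t unfolding w1_def using W_mono that by simp
  have quad: "W2 * (W2 - 1 + \<alpha>\<^sup>2 * (r t)\<^sup>2) \<ge> \<eta>" if "W2 \<ge> w1" for W2 t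
    unfolding \<eta>_def using w1 that by (intro mult_mono) (auto simp: add_increasing2)
  \<comment> \<open>Below \<open>\<eta> / 14\<close> the friction, at most \<open>7 p\<close>,
    consumes no more than half of the force.\<close>
  have "eventually (\<lambda>t. p t \<ge> \<eta> / 14) at_top"
  proof (rule eventually_ge_of_deriv[OF eventually_deriv[OF p_deriv]])
    show "eventually (\<lambda>t. p t < \<eta> / 14 \<longrightarrow> \<eta> / 2 \<le> p' t) at_top"
      using eventually_ge_at_top[of "t0 + 1"]
    proof eventually_elim
      case (elim t)
      show ?case
      proof
        assume "p t < \<eta> / 14"
        have tt: "t0 \<le> t" using elim by simp
        have "(N t - D t) * p t \<ge> (- 7) * p t"
          using D_le[OF tt] N_pos[OF mem[OF tt]] pos[OF tt] by (intro mult_right_mono) auto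
        moreover have "0 \<le> (r t)\<^sup>2 * (U t)\<^sup>2" by simp
        moreover have "(- 7) * p t \<ge> - \<eta> / 2" using \<open>p t < \<eta> / 14\<close> by simp
        moreover note quad[OF W_ge[OF elim], of t]
        ultimately show "\<eta> / 2 \<le> p' t" unfolding p'_def by linarith
      qed
    qed
  qed (use e0 in auto)
  from eventually_conj[OF this eventually_ge_at_top[of t0]]
  obtain t2 where t2: "\<And>t. t \<ge> t2 \<Longrightarrow> p t \<ge> \<eta> / 14" "\<And>t. t \<ge> t2 \<Longrightarrow> t0 \<le> t"
    unfolding eventually_at_top_linorder by auto
  have "filterlim (\<lambda>t. (W t)\<^sup>2) at_top at_top"
    by (rule filterlim_at_top_of_deriv[OF W_square_deriv, where c = "\<eta> / 7"]) (use t2 mem e0 in force)+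
  then have W_big: "eventually (\<lambda>t. (W t)\<^sup>2 \<ge> 20) at_top" by (simp add: filterlim_at_top)
  \<comment> \<open>\<open>z\<close> is the logarithmic derivative of \<open>\<bar>W\<bar>\<close>
    and satisfies a Riccati equation. For \<open>z < 2\<close> and \<open>W^2 \<ge> 20\<close> its
    right-hand side is at least 19 - 14 - 4 = 1, so \<open>z\<close> ends above 2.\<close>
  define z where "z t = p t / (W t)\<^sup>2" for t
  have Wpos: "(W t)\<^sup>2 > 0" if "t0 \<le> t" for t using W_mono[of t0 t] W0 that by linarith
  have z_deriv: "(z has_real_derivative (p' t * (W t)\<^sup>2 - p t * (2 * p t)) / ((W t)\<^sup>2 * (W t)\<^sup>2)) (at t)"
    if "t0 \<le> t" for t
    unfolding z_def by (rule DERIV_divide[OF p_deriv[OF mem[OF that]] W_square_deriv[OF mem[OF that]]]) (use Wpos[OF that] in simp)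
  have z_eq: "(p' t * (W t)\<^sup>2 - p t * (2 * p t)) / ((W t)\<^sup>2 * (W t)\<^sup>2)
      = (W t)\<^sup>2 - 1 + \<alpha>\<^sup>2 * (r t)\<^sup>2 + (N t - D t) * z t - (z t)\<^sup>2" if "t0 \<le> t" for t
  proof -
    have pp: "p t * p t = (r t)\<^sup>2 * (U t)\<^sup>2 * (W t)\<^sup>2" by (simp add: p_def power2_eq_square)
    have "W t \<noteq> 0" using Wpos[OF that] by auto
    have "p' t * (W t)\<^sup>2 - p t * (2 * p t)
      = ((W t)\<^sup>2 - 1 + \<alpha>\<^sup>2 * (r t)\<^sup>2) * ((W t)\<^sup>2 * (W t)\<^sup>2) + (N t - D t) * (p t * (W t)\<^sup>2) - p t * p t"
      unfolding p'_def using pp by algebra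
    then show ?thesis using \<open>W t \<noteq> 0\<close> by (simp add: z_def diff_divide_distrib add_divide_distrib power2_eq_square)
  qed
  have z_pos: "z t > 0" if "t0 \<le> t" for t using pos[OF that] Wpos[OF that] by (simp add: z_def)
  have "eventually (\<lambda>t. z t \<ge> 2) at_top"
  proof (rule eventually_ge_of_deriv[where d = 1])
    show "eventually (\<lambda>t. (z has_real_derivative (W t)\<^sup>2 - 1 + \<alpha>\<^sup>2 * (r t)\<^sup>2 + (N t - D t) * z t - (z t)\<^sup>2) (at t)) at_top"
      using eventually_ge_at_top[of t0] by eventually_elim (use z_deriv z_eq in simp)
    show "eventually (\<lambda>t. z t < 2 \<longrightarrow> 1 \<le> (W t)\<^sup>2 - 1 + \<alpha>\<^sup>2 * (r t)\<^sup>2 + (N t - D t) * z t - (z t)\<^sup>2) at_top"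
      using W_big eventually_ge_at_top[of t0]
    proof eventually_elim
      case (elim t)
      show ?case
      proof
        assume "z t < 2"
        have "(N t - D t) * z t \<ge> (- 7) * z t"
          using D_le[OF elim(2)] N_pos[OF mem[OF elim(2)]] z_pos[OF elim(2)] by (intro mult_right_mono) auto
        moreover have "(z t)\<^sup>2 \<le> 4" using \<open>z t < 2\<close> z_pos[OF elim(2)] power_mono[of "z t" 2 2] by simp
        moreover have "0 \<le> \<alpha>\<^sup>2 * (r t)\<^sup>2" by simp
        ultimately show "1 \<le> (W t)\<^sup>2 - 1 + \<alpha>\<^sup>2 * (r t)\<^sup>2 + (N t - D t) * z t - (z t)\<^sup>2"
          using elim(1) \<open>z t < 2\<close> by linarith
      qed
    qed
  qed simp
  from eventually_conj[OF this eventually_ge_at_top[of t0]]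
  obtain t3 where t3: "\<And>t. t \<ge> t3 \<Longrightarrow> z t \<ge> 2" "\<And>t. t \<ge> t3 \<Longrightarrow> t0 \<le> t"
    unfolding eventually_at_top_linorder by auto
  \<comment> \<open>\<open>B\<close> equals \<open>(X - 1 / r)^2\<close>, and the logarithmic
    derivative of \<open>X\<close> is \<open>2 z - N\<close>, at least 4 - 2, so \<open>X\<close>
    grows without bound.\<close>
  define X where "X t = (W t)\<^sup>2 / r t" for t
  have X_pos: "X t > 0" if "t3 \<le> t" for t using Wpos[OF t3(2)[OF that]] r_pos[OF mem[OF t3(2)[OF that]]] by (simp add: X_def)
  have X_deriv: "(X has_real_derivative X t * (2 * z t - N t)) (at t)" if "t3 \<le> t" for t
  proof -
    note m = mem[OF t3(2)[OF that]] and w = Wpos[OF t3(2)[OF that]]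
    have "(X has_real_derivative (2 * p t * r t - (W t)\<^sup>2 * (r t * N t)) / (r t * r t)) (at t)"
      unfolding X_def by (rule DERIV_divide[OF W_square_deriv[OF m] r_deriv[OF m]]) (use r_pos[OF m] in simp)
    moreover have "(2 * p t * r t - (W t)\<^sup>2 * (r t * N t)) / (r t * r t) = X t * (2 * z t - N t)"
      using r_pos[OF m] w by (simp add: X_def z_def field_simps)
    ultimately show ?thesis by simp
  qed
  have X_rate: "X t * (2 * z t - N t) \<ge> 2 * X t" if "t3 \<le> t" for t
    using mult_left_mono[of 2 "2 * z t - N t" "X t"] t3(1)[OF that] N_le[OF t3(2)[OF that]] X_pos[OF that] by simp
  have X_mono: "X t3 \<le> X t" if "t3 \<le> t" for t
    by (rule nondecreasing_of_deriv[OF that X_deriv]) (use X_rate X_pos in force)+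
  have "filterlim X at_top at_top"
  proof (rule filterlim_at_top_of_deriv[OF X_deriv, where c = "2 * X t3"])
    show "2 * X t3 \<le> X x * (2 * z x - N x)" if "t3 \<le> x" for x
      using X_rate[OF that] X_mono[OF that] by linarith
    show "0 < 2 * X t3" using X_pos[of t3] by simp
  qed
  then have "eventually (\<lambda>t. X t \<ge> 1 / r t0 + 2) at_top" by (simp add: filterlim_at_top)
  from eventually_conj[OF this eventually_ge_at_top[of t0]]
  obtain t4 where t4: "\<And>t. t \<ge> t4 \<Longrightarrow> X t \<ge> 1 / r t0 + 2" "\<And>t. t \<ge> t4 \<Longrightarrow> t0 \<le> t"
    unfolding eventually_at_top_linorder by auto
  have "filterlim N at_bot at_top"
  proof (rule filterlim_at_bot_of_deriv[OF N_deriv, where c = 1])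
    fix t assume t: "t4 \<le> t"
    note tt = t4(2)[OF t]
    show "t \<in> I" using mem[OF tt] .
    have "1 / r t \<le> 1 / r t0" using r_mono[OF mem[of t0] tt] r_pos[OF mem[of t0]] by (intro divide_left_mono) auto
    then have "2 \<le> X t - 1 / r t" using t4(1)[OF t] by simp
    then have "4 \<le> (X t - 1 / r t)\<^sup>2" using power_mono[of 2 "X t - 1 / r t" 2] by simp
    also have "(X t - 1 / r t)\<^sup>2 = B t"
      unfolding X_def B_def diff_divide_distrib[symmetric] power_divide by (simp add: power2_commute)
    finally show "D t * N t - 2 * (U t)\<^sup>2 \<le> - 1"
      using N_rate[OF mem[OF tt]] zero_le_power2[of "N t"] zero_le_power2[of "U t"] mass_nonneg[of t] by argo
  qed simp
  then have "eventually (\<lambda>t. N t \<le> - 1) at_top" by (simp add: filterlim_at_bot)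
  from eventually_conj[OF this eventually_ge_at_top[of t0]]
  obtain t where "N t \<le> - 1" "t0 \<le> t" using eventually_happens[of _ "at_top :: real filter"] by fastforce
  then show False using N_pos[OF mem] by force
qed

lemma tail:
  obtains t0 where "\<And>t. t0 \<le> t \<Longrightarrow> t \<in> I" "\<And>t. t0 \<le> t \<Longrightarrow> D t \<le> 7" "\<And>t. t0 \<le> t \<Longrightarrow> N t \<le> 2"
  using eventually_conj[OF eventually_in_I eventually_conj[OF eventually_D_le eventually_N_le]]
  unfolding eventually_at_top_linorder by auto

lemma W_bounded: obtains C where "eventually (\<lambda>t. (W t)\<^sup>2 \<le> C) at_top" "C \<ge> 1"
proof -
  obtain t0 where t0: "\<And>t. t0 \<le> t \<Longrightarrow> t \<in> I" "\<And>t. t0 \<le> t \<Longrightarrow> D t \<le> 7" "\<And>t. t0 \<le> t \<Longrightarrow> N t \<le> 2"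
    using tail by blast
  have "(W t)\<^sup>2 \<le> max ((W t0)\<^sup>2) 1" if "t0 \<le> t" for t
  proof (rule barrier[OF that W_square_deriv[OF t0(1)]])
    fix x assume "t0 \<le> x" "1 < (W x)\<^sup>2"
    then show "2 * p x \<le> 0" using W_not_growing_outside[of x] t0 by force
  qed
  then show ?thesis using that[of "max ((W t0)\<^sup>2) 1"] by (auto simp: eventually_at_top_linorder)
qed

end

section \<open>Eventually bounded functions and perturbed Riccati equations\<close>

definition ev_bounded :: "(real \<Rightarrow> real) \<Rightarrow> bool" where
  "ev_bounded f \<longleftrightarrow> (\<exists>C. eventually (\<lambda>t. \<bar>f t\<bar> \<le> C) at_top)"

lemma ev_bounded_const: "ev_bounded (\<lambda>t. c)"
  unfolding ev_bounded_def by (rule exI[of _ "\<bar>c\<bar>"]) simp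

lemma ev_bounded_add:
  assumes "ev_bounded f" "ev_bounded g" shows "ev_bounded (\<lambda>t. f t + g t)"
proof -
  obtain C C' where "eventually (\<lambda>t. \<bar>f t\<bar> \<le> C) at_top" "eventually (\<lambda>t. \<bar>g t\<bar> \<le> C') at_top"
    using assms by (auto simp: ev_bounded_def)
  then have "eventually (\<lambda>t. \<bar>f t + g t\<bar> \<le> C + C') at_top"
    by eventually_elim linarith
  then show ?thesis by (auto simp: ev_bounded_def)
qed

lemma ev_bounded_mult:
  assumes "ev_bounded f" "ev_bounded g" shows "ev_bounded (\<lambda>t. f t * g t)"
proof -
  obtain C C' where "eventually (\<lambda>t. \<bar>f t\<bar> \<le> C) at_top" "eventually (\<lambda>t. \<bar>g t\<bar> \<le> C') at_top"
    using assms by (auto simp: ev_bounded_def)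
  then have "eventually (\<lambda>t. \<bar>f t * g t\<bar> \<le> C * C') at_top"
    by eventually_elim (auto simp: abs_mult intro!: mult_mono)
  then show ?thesis by (auto simp: ev_bounded_def)
qed

lemma ev_bounded_uminus: "ev_bounded f \<Longrightarrow> ev_bounded (\<lambda>t. - f t)"
  by (simp add: ev_bounded_def)

lemma ev_bounded_diff:
  assumes "ev_bounded f" "ev_bounded g" shows "ev_bounded (\<lambda>t. f t - g t)"
  using ev_bounded_add[OF assms(1) ev_bounded_uminus[OF assms(2)]] by simp

lemma ev_bounded_power: "ev_bounded f \<Longrightarrow> ev_bounded (\<lambda>t. f t ^ n)"
  by (induction n) (auto intro: ev_bounded_const ev_bounded_mult)

lemmas ev_bounded_intros = ev_bounded_const ev_bounded_add ev_bounded_diff ev_bounded_mult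
  ev_bounded_uminus ev_bounded_power

lemma ev_bounded_tendsto_0_mult:
  assumes "ev_bounded f" "(g \<longlongrightarrow> 0) at_top" shows "((\<lambda>t. f t * g t) \<longlongrightarrow> 0) at_top"
proof -
  obtain C where "eventually (\<lambda>t. \<bar>f t\<bar> \<le> C) at_top" using assms(1) by (auto simp: ev_bounded_def)
  then have "eventually (\<lambda>t. norm (f t * g t) \<le> \<bar>g t\<bar> * C) at_top"
    by eventually_elim (simp add: abs_mult mult.commute[of _ C] mult_right_mono)
  moreover have "((\<lambda>t. \<bar>g t\<bar> * C) \<longlongrightarrow> 0) at_top"
    using tendsto_mult_left_zero[OF tendsto_rabs_zero[OF assms(2)]] .
  ultimately show ?thesis by (rule Lim_null_comparison)
qed

lemma tendsto_eventually_eq: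
  "(f \<longlongrightarrow> l) F \<Longrightarrow> eventually (\<lambda>x. f x = g x) F \<Longrightarrow> l = l' \<Longrightarrow> (g \<longlongrightarrow> l') F"
  using Lim_transform_eventually by blast

lemma ev_bounded_tendsto: "(f \<longlongrightarrow> l) at_top \<Longrightarrow> ev_bounded f"
proof -
  assume "(f \<longlongrightarrow> l) at_top"
  then have "eventually (\<lambda>t. dist (f t) l < 1) at_top" by (rule tendstoD) simp
  then have "eventually (\<lambda>t. \<bar>f t\<bar> \<le> \<bar>l\<bar> + 1) at_top"
    by eventually_elim (auto simp: dist_real_def)
  then show ?thesis by (auto simp: ev_bounded_def)
qed

lemma deriv_tendsto_0':
  assumes "(f \<longlongrightarrow> l) at_top" "eventually (\<lambda>x. (f has_real_derivative g x) (at x)) at_top"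
    "eventually (\<lambda>x. (g has_real_derivative h x) (at x)) at_top" "ev_bounded h"
  shows "(g \<longlongrightarrow> 0) at_top"
  using deriv_tendsto_0[OF assms(1-3)] assms(4) by (auto simp: ev_bounded_def)

lemma tendsto_0_of_square:
  assumes "((\<lambda>t. (f t)\<^sup>2) \<longlongrightarrow> 0) F" shows "(f \<longlongrightarrow> (0::real)) F"
proof -
  have "((\<lambda>t. sqrt ((f t)\<^sup>2)) \<longlongrightarrow> sqrt 0) F" by (intro tendsto_real_sqrt assms)
  then show ?thesis by (simp add: tendsto_rabs_zero_iff)
qed

text \<open>Of the equilibria 1 and -1 of \<open>f' = c (1 - f^2)\<close> only the attracting one,
  1, is compatible with \<open>f \<ge> 0\<close>. Outside any neighbourhood of it half of the
  restoring rate absorbs the vanishing error.\<close>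

lemma riccati_tendsto_1:
  fixes f f' :: "real \<Rightarrow> real"
  assumes der: "eventually (\<lambda>t. (f has_real_derivative f' t) (at t)) at_top"
    and nonneg: "eventually (\<lambda>t. f t \<ge> 0) at_top" and c: "c > 0"
    and lim: "((\<lambda>t. f' t - c * (1 - (f t)\<^sup>2)) \<longlongrightarrow> 0) at_top"
  shows "(f \<longlongrightarrow> 1) at_top"
proof (rule tendstoI)
  fix e0 :: real assume "e0 > 0"
  \<comment> \<open>\<open>e \<le> 1\<close> keeps \<open>1 - e\<close> nonnegative, with square at
    most \<open>1 - e\<close>; the halving leaves room for the strict inequality.\<close>
  define e where "e = min (e0 / 2) 1"
  have e: "e > 0" "e < e0" "e \<le> 1" using \<open>e0 > 0\<close> by (auto simp: e_def)
  have ce: "c * e / 2 > 0" using c e by simp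
  have small: "eventually (\<lambda>t. dist (f' t - c * (1 - (f t)\<^sup>2)) 0 < c * e / 2) at_top"
    using lim ce by (rule tendstoD)
  have "eventually (\<lambda>t. f t \<le> 1 + e) at_top"
  proof (rule eventually_le_of_deriv[OF der _ ce])
    show "eventually (\<lambda>t. 1 + e < f t \<longrightarrow> f' t \<le> - (c * e / 2)) at_top"
      using small
    proof eventually_elim
      case (elim t)
      show ?case
      proof
        assume "1 + e < f t"
        then have "(1 + e)\<^sup>2 \<le> (f t)\<^sup>2" using e by (intro power_mono) auto
        moreover have "1 + e \<le> (1 + e)\<^sup>2" using e by (simp add: power2_eq_square algebra_simps)
        ultimately have "c * (1 - (f t)\<^sup>2) \<le> c * (- e)" using c by (intro mult_left_mono) auto
        moreover have "f' t - c * (1 - (f t)\<^sup>2) < c * e / 2"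
          using elim unfolding dist_real_def abs_less_iff by simp
        ultimately show "f' t \<le> - (c * e / 2)" by (simp add: algebra_simps)
      qed
    qed
  qed
  moreover have "eventually (\<lambda>t. f t \<ge> 1 - e) at_top"
  proof (rule eventually_ge_of_deriv[OF der _ ce])
    show "eventually (\<lambda>t. f t < 1 - e \<longrightarrow> c * e / 2 \<le> f' t) at_top"
      using small nonneg
    proof eventually_elim
      case (elim t)
      show ?case
      proof
        assume "f t < 1 - e"
        then have "(f t)\<^sup>2 \<le> (1 - e)\<^sup>2" using elim by (intro power_mono) auto
        also have "\<dots> \<le> 1 - e" using e by (simp add: power2_eq_square algebra_simps mult_left_le)
        finally have "c * e \<le> c * (1 - (f t)\<^sup>2)" using c by (intro mult_left_mono) auto
        moreover have "c * (1 - (f t)\<^sup>2) - f' t < c * e / 2"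
          using elim unfolding dist_real_def abs_less_iff by simp
        ultimately show "c * e / 2 \<le> f' t" by (simp add: algebra_simps)
      qed
    qed
  qed
  ultimately show "eventually (\<lambda>t. dist (f t) 1 < e0) at_top"
    by eventually_elim (use e in \<open>auto simp: dist_real_def\<close>)
qed

context eymh_global
begin

lemma ev_bounded_N: "ev_bounded N"
proof -
  have "eventually (\<lambda>t. \<bar>N t\<bar> \<le> 2) at_top"
    using eventually_N_le eventually_in_I by eventually_elim (use N_pos in force)
  then show ?thesis by (auto simp: ev_bounded_def)
qed

lemma ev_bounded_D: "ev_bounded D"
proof -
  have "eventually (\<lambda>t. \<bar>D t\<bar> \<le> 7) at_top"
    using eventually_D_le eventually_in_I by eventually_elim (use D0 in force)
  then show ?thesis by (auto simp: ev_bounded_def)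
qed

lemma ev_bounded_W: "ev_bounded W"
proof -
  obtain C where C: "eventually (\<lambda>t. (W t)\<^sup>2 \<le> C) at_top" "C \<ge> 1" using W_bounded by blast
  have "eventually (\<lambda>t. \<bar>W t\<bar> \<le> sqrt C) at_top"
    using C(1) by eventually_elim (metis real_sqrt_abs real_sqrt_le_mono)
  then show ?thesis by (auto simp: ev_bounded_def)
qed

lemma ev_bounded_inverse_r: "ev_bounded (\<lambda>t. 1 / r t)"
proof -
  obtain s where s: "s \<in> I" using N_pos_start by blast
  have "eventually (\<lambda>t. \<bar>1 / r t\<bar> \<le> 1 / r s) at_top"
    using eventually_ge_at_top[of s] eventually_in_I
  proof eventually_elim
    case (elim t)
    then show ?case using r_mono[OF s elim(1)] r_pos[OF s] by (simp add: frac_le)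
  qed
  then show ?thesis by (auto simp: ev_bounded_def)
qed

section \<open>Bounded \<open>r\<close>: convergence to the fixed point\<close>

definition V :: "real \<Rightarrow> real" where "V t = r t * U t"

definition V' :: "real \<Rightarrow> real" where
  "V' t = W t * ((W t)\<^sup>2 - 1 + \<alpha>\<^sup>2 * (r t)\<^sup>2) + (N t - D t) * V t"

lemma V_deriv: assumes "t \<in> I" shows "(V has_real_derivative V' t) (at t)"
proof -
  have "(V has_real_derivative r t * N t * U t + (F t - D t * U t) * r t) (at t)"
    unfolding V_def by (rule DERIV_mult[OF r_deriv[OF assms] U_deriv[OF assms]])
  moreover have "r t * N t * U t + (F t - D t * U t) * r t = V' t"
    using rF[OF assms] unfolding V'_def V_def by algebra
  ultimately show ?thesis by simp
qed

lemma W_deriv': "t \<in> I \<Longrightarrow> (W has_real_derivative V t) (at t)"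
  using W_deriv by (simp add: V_def)

lemma D_N_rate_deriv:
  assumes "t \<in> I"
  shows "((\<lambda>t. D t * N t - 2 * (U t)\<^sup>2) has_real_derivative
    (B t + 2 * (U t)\<^sup>2 - D t * (D t + N t)) * N t + (D t * N t - 2 * (U t)\<^sup>2) * D t - 4 * U t * (F t - D t * U t)) (at t)"
  by (rule derivative_eq_intros D_deriv[OF assms] N_deriv[OF assms] U_deriv[OF assms] refl)+ (simp add: D_def algebra_simps)

lemma V'_deriv:
  assumes "t \<in> I"
  shows "(V' has_real_derivative V t * ((W t)\<^sup>2 - 1 + \<alpha>\<^sup>2 * (r t)\<^sup>2) + W t * (2 * W t * V t + \<alpha>\<^sup>2 * (2 * (r t)\<^sup>2 * N t))
    + ((D t * N t - 2 * (U t)\<^sup>2) - (B t + 2 * (U t)\<^sup>2 - D t * (D t + N t))) * V t + (N t - D t) * V' t) (at t)"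
  unfolding V'_def[abs_def]
  by (rule derivative_eq_intros D_deriv[OF assms] N_deriv[OF assms] W_deriv'[OF assms] r_deriv[OF assms] V_deriv[OF assms] refl)+
    (simp add: D_def V'_def algebra_simps power2_eq_square)

text \<open>Barbalat's lemma is applied to \<open>ln r\<close>, to \<open>N\<close> and to
  \<open>V\<close>: the first two uses give \<open>N\<close>, its derivative and hence
  \<open>U\<close> the limit 0, the third does so for \<open>V'\<close>. This leaves
  \<open>W (W^2 - 1 + \<alpha>^2 r^2)\<close> tending to 0, and the constraint decides which factor
  vanishes.\<close>

lemma r_bounded_limits:
  assumes R: "\<And>t. t \<in> I \<Longrightarrow> r t \<le> R"
  shows "(N \<longlongrightarrow> 0) at_top" "(U \<longlongrightarrow> 0) at_top" "(W \<longlongrightarrow> 0) at_top" "(r \<longlongrightarrow> 1) at_top" "(\<kappa> \<longlongrightarrow> 1) at_top"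
proof -
  obtain s where s: "s \<in> I" "2 * \<alpha>\<^sup>2 - 1 < \<alpha> ^ 4 * (r s)\<^sup>2" using r_large by blast
  have mem: "t \<in> I" if "s \<le> t" for t using right_mem[OF T_infinite s(1) that] .
  obtain \<rho> where \<rho>: "(r \<longlongrightarrow> \<rho>) at_top" "\<And>t. s \<le> t \<Longrightarrow> r t \<le> \<rho>"
    by (rule tendsto_of_nondecreasing[of s r R]) (use r_mono R mem in auto)
  have \<rho>0: "\<rho> > 0" using \<rho>(2)[of s] r_pos[OF s(1)] by simp
  have bN: "ev_bounded N" and bD: "ev_bounded D" and bW: "ev_bounded W" and bir: "ev_bounded (\<lambda>t. 1 / r t)"
    by (rule ev_bounded_N ev_bounded_D ev_bounded_W ev_bounded_inverse_r)+
  have br: "ev_bounded r" by (rule ev_bounded_tendsto[OF \<rho>(1)])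
  have "B = (\<lambda>t. (1 - (W t)\<^sup>2)\<^sup>2 * (1 / r t)\<^sup>2)" by (auto simp: B_def power_divide)
  then have bB: "ev_bounded B" by (simp only:) (intro ev_bounded_intros bW bir)
  have "F = (\<lambda>t. W t * ((W t)\<^sup>2 - 1) * (1 / r t) + \<alpha>\<^sup>2 * r t * W t)" by (auto simp: F_def)
  then have bF: "ev_bounded F" by (simp only:) (intro ev_bounded_intros bW bir br)
  then obtain C where C: "eventually (\<lambda>t. \<bar>F t\<bar> \<le> C) at_top" by (auto simp: ev_bounded_def)
  \<comment> \<open>By the constraint \<open>2 N'\<close> contributes \<open>- 2 U^2\<close>, which
    beats the \<open>U^2 + F^2\<close> coming from \<open>2 U F\<close>; for \<open>U^2\<close>
    alone the friction \<open>D\<close> might be too weak.\<close>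
  have "eventually (\<lambda>t. (U t)\<^sup>2 + 2 * N t \<le> C\<^sup>2 + 6) at_top"
  proof (rule eventually_le_of_deriv[where d = 1])
    show "eventually (\<lambda>t. ((\<lambda>t. (U t)\<^sup>2 + 2 * N t) has_real_derivative
        2 * U t * (F t - D t * U t) + 2 * (D t * N t - 2 * (U t)\<^sup>2)) (at t)) at_top"
    proof (rule eventually_deriv)
      fix t assume t: "t \<in> I"
      show "((\<lambda>t. (U t)\<^sup>2 + 2 * N t) has_real_derivative
        2 * U t * (F t - D t * U t) + 2 * (D t * N t - 2 * (U t)\<^sup>2)) (at t)"
        by (rule derivative_eq_intros U_deriv[OF t] N_deriv[OF t] refl)+ simp
    qed
    show "eventually (\<lambda>t. C\<^sup>2 + 6 < (U t)\<^sup>2 + 2 * N t \<longrightarrow>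
        2 * U t * (F t - D t * U t) + 2 * (D t * N t - 2 * (U t)\<^sup>2) \<le> - 1) at_top"
      using C eventually_N_le eventually_in_I
    proof eventually_elim
      case (elim t)
      show ?case
      proof
        assume big: "C\<^sup>2 + 6 < (U t)\<^sup>2 + 2 * N t"
        have "(F t)\<^sup>2 \<le> C\<^sup>2" using elim(1) by (metis abs_ge_zero power2_abs power_mono)
        moreover have "2 * U t * F t \<le> (U t)\<^sup>2 + (F t)\<^sup>2" using sum_squares_bound[of "U t" "F t"] by simp
        moreover have "0 \<le> D t * (U t)\<^sup>2" using D0[OF elim(3)] by simp
        moreover have "2 * U t * (F t - D t * U t) = 2 * U t * F t - 2 * (D t * (U t)\<^sup>2)"
          by (simp add: algebra_simps power2_eq_square)
        ultimately show "2 * U t * (F t - D t * U t) + 2 * (D t * N t - 2 * (U t)\<^sup>2) \<le> - 1"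
          using N_rate[OF elim(3)] B_nonneg[of t] mass_nonneg[of t] zero_le_power2[of "N t"] big elim(2) by argo
      qed
    qed
  qed simp
  then have "eventually (\<lambda>t. \<bar>U t\<bar> \<le> sqrt (C\<^sup>2 + 6)) at_top"
    using eventually_in_I
  proof eventually_elim
    case (elim t)
    then have "(U t)\<^sup>2 \<le> C\<^sup>2 + 6" using N_pos[OF elim(2)] by simp
    then show ?case by (metis real_sqrt_abs real_sqrt_le_mono)
  qed
  then have bU: "ev_bounded U" by (auto simp: ev_bounded_def)
  have bV: "ev_bounded V" unfolding V_def[abs_def] by (intro ev_bounded_intros br bU)
  have bV': "ev_bounded V'" unfolding V'_def[abs_def] by (intro ev_bounded_intros br bU bW bN bD bV)
  note bnd = bN bD bW br bB bF bU bV bV'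
  show N0: "(N \<longlongrightarrow> 0) at_top"
  proof (rule deriv_tendsto_0'[where f = "\<lambda>t. ln (r t)"])
    show "((\<lambda>t. ln (r t)) \<longlongrightarrow> ln \<rho>) at_top" using \<rho>(1) \<rho>0 by (intro tendsto_intros) auto
    show "eventually (\<lambda>t. ((\<lambda>t. ln (r t)) has_real_derivative N t) (at t)) at_top"
    proof (rule eventually_deriv)
      fix t assume t: "t \<in> I"
      show "((\<lambda>t. ln (r t)) has_real_derivative N t) (at t)"
        using r_pos[OF t] by (auto intro!: derivative_eq_intros r_deriv[OF t])
    qed
    show "ev_bounded (\<lambda>t. D t * N t - 2 * (U t)\<^sup>2)" by (intro ev_bounded_intros bnd)
  qed (rule eventually_deriv[OF N_deriv])
  have N'0: "((\<lambda>t. D t * N t - 2 * (U t)\<^sup>2) \<longlongrightarrow> 0) at_top"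
    by (rule deriv_tendsto_0'[OF N0 eventually_deriv[OF N_deriv] eventually_deriv[OF D_N_rate_deriv]])
      (assumption | intro ev_bounded_intros bnd)+
  have "((\<lambda>t. (D t * N t - (D t * N t - 2 * (U t)\<^sup>2)) / 2) \<longlongrightarrow> (0 - 0) / 2) at_top"
    by (intro tendsto_intros ev_bounded_tendsto_0_mult bD N0 N'0) simp
  then have "((\<lambda>t. (U t)\<^sup>2) \<longlongrightarrow> 0) at_top" by simp
  then show U0: "(U \<longlongrightarrow> 0) at_top" by (rule tendsto_0_of_square)
  have V0: "(V \<longlongrightarrow> 0) at_top" unfolding V_def[abs_def] by (rule ev_bounded_tendsto_0_mult[OF br U0])
  have V'0: "(V' \<longlongrightarrow> 0) at_top"
    by (rule deriv_tendsto_0'[OF V0 eventually_deriv[OF V_deriv] eventually_deriv[OF V'_deriv]])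
      (assumption | intro ev_bounded_intros bnd)+
  define q where "q t = W t * ((W t)\<^sup>2 - 1 + \<alpha>\<^sup>2 * (r t)\<^sup>2)" for t
  have "((\<lambda>t. V' t - (N t - D t) * V t) \<longlongrightarrow> 0 - 0) at_top"
    by (intro tendsto_intros ev_bounded_tendsto_0_mult V0 V'0 ev_bounded_diff bN bD)
  then have q0: "(q \<longlongrightarrow> 0) at_top" by (simp add: V'_def q_def[abs_def])
  define y where "y t = (W t)\<^sup>2 - 1 + \<alpha>\<^sup>2 * (r t)\<^sup>2" for t
  \<comment> \<open>By the constraint this is the limit of \<open>y^2\<close>, since
    \<open>N\<close>, its derivative and \<open>U\<close> tend to 0. The second factor is positive
    by \<open>r_large\<close> and the growth of \<open>r\<close>, so \<open>y\<close> stays away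
    from 0 and \<open>W\<close> has to vanish.\<close>
  define \<Lambda> where "\<Lambda> = \<rho>\<^sup>2 * (1 - 2 * \<alpha>\<^sup>2 + \<alpha> ^ 4 * \<rho>\<^sup>2)"
  have "\<alpha> ^ 4 * (r s)\<^sup>2 \<le> \<alpha> ^ 4 * \<rho>\<^sup>2"
    using \<rho>(2)[of s] r_pos[OF s(1)] by (intro mult_left_mono power_mono) auto
  then have \<Lambda>0: "\<Lambda> > 0" unfolding \<Lambda>_def using s(2) \<rho>0 by (intro mult_pos_pos) auto
  have "((\<lambda>t. - (r t)\<^sup>2 * (2 * (D t * N t - 2 * (U t)\<^sup>2) + (N t)\<^sup>2 + 2 * (U t)\<^sup>2)
      + (r t)\<^sup>2 * (1 - 2 * \<alpha>\<^sup>2 + \<alpha> ^ 4 * (r t)\<^sup>2)) \<longlongrightarrow> - \<rho>\<^sup>2 * (2 * 0 + 0\<^sup>2 + 2 * 0\<^sup>2) + \<Lambda>) at_top"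
    unfolding \<Lambda>_def by (intro tendsto_intros N'0 N0 U0 \<rho>(1))
  moreover have "eventually (\<lambda>t. - (r t)\<^sup>2 * (2 * (D t * N t - 2 * (U t)\<^sup>2) + (N t)\<^sup>2 + 2 * (U t)\<^sup>2)
      + (r t)\<^sup>2 * (1 - 2 * \<alpha>\<^sup>2 + \<alpha> ^ 4 * (r t)\<^sup>2) = (y t)\<^sup>2) at_top"
    using eventually_in_I
  proof eventually_elim
    case (elim t)
    have rB: "(r t)\<^sup>2 * B t = (1 - (W t)\<^sup>2)\<^sup>2" using r_pos[OF elim] by (simp add: B_def)
    have "2 * (D t * N t - 2 * (U t)\<^sup>2) + (N t)\<^sup>2 + 2 * (U t)\<^sup>2 = 1 - B t - 2 * \<alpha>\<^sup>2 * (W t)\<^sup>2"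
      using N_rate[OF elim] by simp
    then show ?case using rB unfolding y_def by algebra
  qed
  ultimately have y2: "((\<lambda>t. (y t)\<^sup>2) \<longlongrightarrow> \<Lambda>) at_top" by (rule tendsto_eventually_eq) simp
  have "((\<lambda>t. (q t)\<^sup>2 / (y t)\<^sup>2) \<longlongrightarrow> 0\<^sup>2 / \<Lambda>) at_top"
    using \<Lambda>0 by (intro tendsto_intros q0 y2) auto
  moreover have "eventually (\<lambda>t. (q t)\<^sup>2 / (y t)\<^sup>2 = (W t)\<^sup>2) at_top"
    using order_tendstoD(1)[OF y2 \<Lambda>0]
    by eventually_elim (auto simp: q_def y_def power_mult_distrib)
  ultimately have W2: "((\<lambda>t. (W t)\<^sup>2) \<longlongrightarrow> 0) at_top" by (rule tendsto_eventually_eq) simp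
  then show W0: "(W \<longlongrightarrow> 0) at_top" by (rule tendsto_0_of_square)
  have "((\<lambda>t. (y t)\<^sup>2) \<longlongrightarrow> (0 - 1 + \<alpha>\<^sup>2 * \<rho>\<^sup>2)\<^sup>2) at_top"
    unfolding y_def by (intro tendsto_intros W2 \<rho>(1))
  \<comment> \<open>Two expressions for the limit of \<open>y^2\<close>, one from
    \<open>W = 0\<close> and one from the constraint; equating them leaves
    \<open>\<rho>^2 = 1\<close>.\<close>
  then have "(0 - 1 + \<alpha>\<^sup>2 * \<rho>\<^sup>2)\<^sup>2 = \<Lambda>" using y2 tendsto_unique[OF trivial_limit_at_top_linorder] by blast
  then have "\<rho>\<^sup>2 = 1" unfolding \<Lambda>_def by algebra
  then have \<rho>1: "\<rho> = 1" using \<rho>0 by (simp add: power2_eq_1_iff)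
  show r1: "(r \<longlongrightarrow> 1) at_top" using \<rho>(1) \<rho>1 by simp
  have "(B \<longlongrightarrow> (1 - 0)\<^sup>2 / 1\<^sup>2) at_top" unfolding B_def[abs_def] by (intro tendsto_intros W2 r1) simp
  then have B1: "(B \<longlongrightarrow> 1) at_top" by simp
  have "(D \<longlongrightarrow> 1) at_top"
  proof (rule riccati_tendsto_1[OF eventually_deriv[OF D_deriv], where c = 1])
    show "eventually (\<lambda>t. 0 \<le> D t) at_top" using eventually_in_I by eventually_elim (rule D0)
    have "((\<lambda>t. (B t - 1) + 2 * (U t)\<^sup>2 - D t * N t) \<longlongrightarrow> (1 - 1) + 2 * 0\<^sup>2 - 0) at_top"
      by (intro tendsto_intros B1 U0 ev_bounded_tendsto_0_mult bD N0)
    then show "((\<lambda>t. B t + 2 * (U t)\<^sup>2 - D t * \<kappa> t - 1 * (1 - (D t)\<^sup>2)) \<longlongrightarrow> 0) at_top"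
      by (simp add: D_def algebra_simps power2_eq_square)
  qed auto
  then have "((\<lambda>t. D t + N t) \<longlongrightarrow> 1 + 0) at_top" by (intro tendsto_intros N0)
  then show "(\<kappa> \<longlongrightarrow> 1) at_top" by (simp add: D_def)
qed

section \<open>Unbounded \<open>r\<close>: asymptotic flatness\<close>

lemma r_at_top:
  assumes "\<And>R. \<exists>t\<in>I. R < r t" shows "filterlim r at_top at_top"
proof -
  have "eventually (\<lambda>t. Z \<le> r t) at_top" for Z
  proof -
    obtain t where "t \<in> I" "Z < r t" using assms by blast
    then show ?thesis using r_mono[of t] eventually_ge_at_top[of t] by (force elim!: eventually_mono)
  qed
  then show ?thesis by (simp add: filterlim_at_top)
qed

lemma B_tendsto_0:
  assumes r: "filterlim r at_top at_top" shows "(B \<longlongrightarrow> 0) at_top"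
proof -
  have "((\<lambda>t. inverse (r t)) \<longlongrightarrow> 0) at_top" by (rule tendsto_inverse_0_at_top[OF r])
  then have "((\<lambda>t. (1 / r t)\<^sup>2) \<longlongrightarrow> 0\<^sup>2) at_top" by (intro tendsto_intros) (simp add: inverse_eq_divide)
  then have "((\<lambda>t. (1 - (W t)\<^sup>2)\<^sup>2 * (1 / r t)\<^sup>2) \<longlongrightarrow> 0) at_top"
    by (intro ev_bounded_tendsto_0_mult ev_bounded_intros ev_bounded_W) simp
  then show ?thesis by (simp add: B_def[abs_def] power_divide)
qed

lemma W_square_not_at_top: "\<not> filterlim (\<lambda>t. (W t)\<^sup>2) at_top at_top"
proof
  assume "filterlim (\<lambda>t. (W t)\<^sup>2) at_top at_top"
  moreover obtain C where C: "eventually (\<lambda>t. (W t)\<^sup>2 \<le> C) at_top" using W_bounded by blast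
  ultimately have "eventually (\<lambda>t. (W t)\<^sup>2 \<ge> C + 1) at_top" by (simp add: filterlim_at_top)
  with C have "eventually (\<lambda>t::real. False) at_top" by eventually_elim simp
  then show False by simp
qed

text \<open>Once \<open>\<alpha>^2 r^2 \<ge> 2\<close> the force repels \<open>W\<close> from 0. If
  \<open>W^2\<close> ever grew, it would grow without bound, so it decreases to a limit
  \<open>w\<close>; a positive \<open>w\<close> would leave a force that eventually turns the
  decrease into growth.\<close>

lemma W_tendsto_0_massive:
  assumes r: "filterlim r at_top at_top" and \<alpha>: "\<alpha> \<noteq> 0"
  shows "(W \<longlongrightarrow> 0) at_top"
proof -
  have r2: "filterlim (\<lambda>t. \<alpha>\<^sup>2 * (r t)\<^sup>2) at_top at_top"
    using \<alpha> by (intro filterlim_tendsto_pos_mult_at_top[OF tendsto_const] filterlim_pow_at_top r) auto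
  then have "eventually (\<lambda>t. \<alpha>\<^sup>2 * (r t)\<^sup>2 \<ge> 2) at_top" by (simp add: filterlim_at_top)
  from eventually_conj[OF this eventually_conj[OF eventually_in_I eventually_conj[OF eventually_D_le eventually_N_le]]]
  obtain t0 where t0: "\<And>t. t0 \<le> t \<Longrightarrow> \<alpha>\<^sup>2 * (r t)\<^sup>2 \<ge> 2" "\<And>t. t0 \<le> t \<Longrightarrow> t \<in> I"
    "\<And>t. t0 \<le> t \<Longrightarrow> D t \<le> 7" "\<And>t. t0 \<le> t \<Longrightarrow> N t \<le> 2"
    unfolding eventually_at_top_linorder by auto
  have p_le: "p s \<le> 0" if s: "t0 \<le> s" for s
  proof (rule ccontr)
    assume "\<not> p s \<le> 0"
    then have ps: "p s > 0" by simp
    have pos: "p t > 0" if "s \<le> t" for t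
    proof (rule p_stays_positive[OF _ _ ps _ that])
      fix x assume "s \<le> x"
      then have x: "t0 \<le> x" using s by simp
      show "x \<in> I" "D x \<le> 7" using t0(2,3)[OF x] by auto
      show "0 \<le> (W x)\<^sup>2 - 1 + \<alpha>\<^sup>2 * (r x)\<^sup>2" using t0(1)[OF x] zero_le_power2[of "W x"] by linarith
    qed
    have mem: "t \<in> I" if "s \<le> t" for t using t0(2) s that by simp
    have W_mono: "(W s)\<^sup>2 \<le> (W t)\<^sup>2" if "s \<le> t" for t
      by (rule nondecreasing_of_deriv[OF that W_square_deriv[OF mem]]) (use pos that in \<open>auto intro: less_imp_le\<close>)
    define w where "w = (W s)\<^sup>2"
    have w0: "w > 0" using ps by (auto simp: w_def p_def)
    have "eventually (\<lambda>t. \<alpha>\<^sup>2 * (r t)\<^sup>2 \<ge> 1 + 8 / w) at_top" using r2 by (simp add: filterlim_at_top)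
    then have "eventually (\<lambda>t. p t < 1 \<longrightarrow> 1 \<le> p' t) at_top"
      using eventually_ge_at_top[of s]
    proof eventually_elim
      case (elim t)
      show ?case
      proof
        assume "p t < 1"
        have "w * (8 / w) \<le> (W t)\<^sup>2 * ((W t)\<^sup>2 - 1 + \<alpha>\<^sup>2 * (r t)\<^sup>2)"
          using W_mono[OF elim(2)] w0 elim(1) unfolding w_def[symmetric]
          by (intro mult_mono) (auto intro: order_trans[OF _ add_increasing])
        then have "8 \<le> (W t)\<^sup>2 * ((W t)\<^sup>2 - 1 + \<alpha>\<^sup>2 * (r t)\<^sup>2)" using w0 by simp
        moreover have "(N t - D t) * p t \<ge> (- 7) * p t"
          using t0(3)[of t] s elim(2) N_pos[OF mem[OF elim(2)]] pos[OF elim(2)] by (intro mult_right_mono) auto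
        moreover have "0 \<le> (r t)\<^sup>2 * (U t)\<^sup>2" by simp
        ultimately show "1 \<le> p' t" unfolding p'_def using \<open>p t < 1\<close> by linarith
      qed
    qed
    from eventually_ge_of_deriv[OF eventually_deriv[OF p_deriv] this]
    have "eventually (\<lambda>t. p t \<ge> 1) at_top" by simp
    from eventually_conj[OF this eventually_ge_at_top[of s]]
    obtain t2 where t2: "\<And>t. t2 \<le> t \<Longrightarrow> p t \<ge> 1" "\<And>t. t2 \<le> t \<Longrightarrow> s \<le> t"
      unfolding eventually_at_top_linorder by auto
    have "filterlim (\<lambda>t. (W t)\<^sup>2) at_top at_top"
    proof (rule filterlim_at_top_of_deriv[OF W_square_deriv, where c = 2])
      fix t assume "t2 \<le> t"
      then show "t \<in> I" "2 \<le> 2 * p t" using mem t2 by auto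
    qed auto
    then show False using W_square_not_at_top by simp
  qed
  have W_mono: "(W t)\<^sup>2 \<le> (W s)\<^sup>2" if "t0 \<le> s" "s \<le> t" for s t
    by (rule nonincreasing_of_deriv[OF that(2) W_square_deriv]) (use p_le t0 that in auto)
  obtain w where w: "((\<lambda>t. (W t)\<^sup>2) \<longlongrightarrow> w) at_top" "\<And>t. t0 \<le> t \<Longrightarrow> w \<le> (W t)\<^sup>2"
    by (rule tendsto_of_nonincreasing[of t0 "\<lambda>t. (W t)\<^sup>2" 0]) (use W_mono in auto)
  have "w \<ge> 0" by (rule tendsto_lowerbound[OF w(1)]) auto
  have "\<not> w > 0"
  proof
    assume w0: "w > 0"
    \<comment> \<open>As \<open>p \<le> 0\<close> and \<open>N - D \<le> 2\<close>, subtracting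
      \<open>W^2\<close> gives the friction term a good sign; the difference would grow at least at
      the rate \<open>w\<close>, against \<open>p \<le> 0\<close>.\<close>
    have "filterlim (\<lambda>t. p t - (W t)\<^sup>2) at_top at_top"
    proof (rule filterlim_at_top_of_deriv[OF DERIV_diff[OF p_deriv W_square_deriv], where c = w and a = t0])
      fix t assume t: "t0 \<le> t"
      show "t \<in> I" "t \<in> I" using t0(2) t by auto
      have "0 \<le> (N t - D t - 2) * p t"
        using D0[OF t0(2)[OF t]] t0(4)[OF t] p_le[OF t] by (intro mult_nonpos_nonpos) auto
      moreover have "w * 1 \<le> (W t)\<^sup>2 * ((W t)\<^sup>2 - 1 + \<alpha>\<^sup>2 * (r t)\<^sup>2)"
        using w(2)[OF t] w0 t0(1)[OF t] by (intro mult_mono) (auto intro: order_trans[OF _ add_increasing])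
      moreover have "0 \<le> (r t)\<^sup>2 * (U t)\<^sup>2" by simp
      ultimately show "w \<le> p' t - 2 * p t" unfolding p'_def left_diff_distrib by linarith
    qed fact
    then have "eventually (\<lambda>t. p t - (W t)\<^sup>2 \<ge> 1) at_top" by (simp add: filterlim_at_top)
    from eventually_conj[OF this eventually_ge_at_top[of t0]]
    obtain t where "p t - (W t)\<^sup>2 \<ge> 1" "t0 \<le> t" using eventually_happens[of _ "at_top :: real filter"] by fastforce
    then show False using p_le[of t] by (smt (verit) zero_le_power2)
  qed
  then have "w = 0" using \<open>w \<ge> 0\<close> by simp
  then show ?thesis using w(1) tendsto_0_of_square by blast
qed

text \<open>By the constraint this quantity is the energy
  \<open>U^2 - B / 2 - \<alpha>^2 W^2\<close>. Friction lowers it, and for bounded \<open>W\<close>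
  the only gain \<open>N B\<close> is at most a multiple of \<open>N / r^2\<close>, the derivative
  of \<open>- 1 / (2 r^2)\<close>.\<close>

lemma energy_deriv:
  assumes t: "t \<in> I"
  shows "((\<lambda>t. \<kappa> t * N t - (1 + (N t)\<^sup>2) / 2) has_real_derivative N t * B t - 2 * D t * (U t)\<^sup>2) (at t)"
proof -
  have "((\<lambda>t. \<kappa> t * N t - (1 + (N t)\<^sup>2) / 2) has_real_derivative
      (B t - (D t)\<^sup>2) * N t + (D t * N t - 2 * (U t)\<^sup>2) * \<kappa> t - N t * (D t * N t - 2 * (U t)\<^sup>2)) (at t)"
    by (auto intro!: derivative_eq_intros kappa_deriv[OF t] N_deriv[OF t] simp: field_simps)
  moreover have "\<kappa> t = D t + N t" by (simp add: D_def)
  ultimately show ?thesis by (simp add: algebra_simps power2_eq_square)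
qed

text \<open>The assumption on \<open>\<alpha>^2 W^2\<close> covers both a vanishing \<open>W\<close>
  and \<open>\<alpha> = 0\<close>. The corrected energy \<open>G\<close> is monotone and bounded
  below, so \<open>U^2\<close> has a limit \<open>l\<close>; a positive \<open>l\<close> would make
  \<open>W U\<close> grow without bound.\<close>

lemma U_tendsto_0:
  assumes r: "filterlim r at_top at_top" and M: "((\<lambda>t. \<alpha>\<^sup>2 * (W t)\<^sup>2) \<longlongrightarrow> 0) at_top"
  shows "(U \<longlongrightarrow> 0) at_top"
proof -
  define E where "E t = \<kappa> t * N t - (1 + (N t)\<^sup>2) / 2" for t
  have E_eq: "E t = (U t)\<^sup>2 - B t / 2 - \<alpha>\<^sup>2 * (W t)\<^sup>2" if "t \<in> I" for t
    using constraint[OF that] by (simp add: E_def field_simps)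
  note B0 = B_tendsto_0[OF r]
  obtain C where C: "eventually (\<lambda>t. (W t)\<^sup>2 \<le> C) at_top" "C \<ge> 1" using W_bounded by blast
  have "eventually (\<lambda>t. B t < 1) at_top" "eventually (\<lambda>t. \<alpha>\<^sup>2 * (W t)\<^sup>2 < 1) at_top"
    using order_tendstoD(2)[OF B0, of 1] order_tendstoD(2)[OF M, of 1] by auto
  from eventually_conj[OF C(1) eventually_conj[OF this(1) eventually_conj[OF this(2) eventually_in_I]]]
  obtain t0 where t0: "\<And>t. t0 \<le> t \<Longrightarrow> (W t)\<^sup>2 \<le> C" "\<And>t. t0 \<le> t \<Longrightarrow> B t < 1"
    "\<And>t. t0 \<le> t \<Longrightarrow> \<alpha>\<^sup>2 * (W t)\<^sup>2 < 1" "\<And>t. t0 \<le> t \<Longrightarrow> t \<in> I"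
    unfolding eventually_at_top_linorder by auto
  \<comment> \<open>The added term decreases at the rate \<open>C^2 N / r^2\<close>, an upper bound
    for \<open>N B\<close>.\<close>
  define G where "G t = E t + C\<^sup>2 / 2 * (1 / (r t)\<^sup>2)" for t
  have G_mono: "G t \<le> G s" if "t0 \<le> s" "s \<le> t" for s t
  proof (rule nonincreasing_of_deriv[OF that(2)])
    fix x assume "s \<le> x" "x \<le> t"
    then have x: "t0 \<le> x" using that by simp
    note xI = t0(4)[OF x]
    have rx: "r x > 0" using r_pos[OF xI] .
    have "((\<lambda>t. 1 / (r t)\<^sup>2) has_real_derivative - 2 * N x / (r x)\<^sup>2) (at x)"
      using rx by (auto intro!: derivative_eq_intros r_deriv[OF xI] simp: power2_eq_square field_simps)
    then show "(G has_real_derivative (N x * B x - 2 * D x * (U x)\<^sup>2) + C\<^sup>2 / 2 * (- 2 * N x / (r x)\<^sup>2)) (at x)"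
      unfolding G_def E_def by (intro DERIV_add energy_deriv[OF xI] DERIV_cmult)
    have "\<bar>1 - (W x)\<^sup>2\<bar> \<le> C" using t0(1)[OF x] C(2) by (smt (verit) zero_le_power2)
    then have "(1 - (W x)\<^sup>2)\<^sup>2 \<le> C\<^sup>2" by (metis abs_ge_zero power2_abs power_mono)
    then have "B x \<le> C\<^sup>2 / (r x)\<^sup>2" unfolding B_def by (simp add: divide_right_mono)
    then have "N x * B x \<le> N x * (C\<^sup>2 / (r x)\<^sup>2)" using N_pos[OF xI] by (intro mult_left_mono) auto
    moreover have "0 \<le> D x * (U x)\<^sup>2" using D0[OF xI] by simp
    ultimately show "(N x * B x - 2 * D x * (U x)\<^sup>2) + C\<^sup>2 / 2 * (- 2 * N x / (r x)\<^sup>2) \<le> 0"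
      by (simp add: algebra_simps)
  qed
  have G_ge: "- 2 \<le> G t" if "t0 \<le> t" for t
  proof -
    have "0 \<le> C\<^sup>2 / 2 * (1 / (r t)\<^sup>2)" by simp
    moreover have "E t \<ge> - 1 / 2 - 1" using E_eq[OF t0(4)[OF that]] t0(2,3)[OF that] by (smt (verit) zero_le_power2 field_sum_of_halves)
    ultimately show ?thesis unfolding G_def by linarith
  qed
  obtain l where l: "(G \<longlongrightarrow> l) at_top"
    by (rule tendsto_of_nonincreasing[of t0 G "- 2"]) (use G_mono G_ge in auto)
  have "((\<lambda>t. inverse (r t)) \<longlongrightarrow> 0) at_top" by (rule tendsto_inverse_0_at_top[OF r])
  then have ir: "((\<lambda>t. C\<^sup>2 / 2 * (inverse (r t))\<^sup>2) \<longlongrightarrow> C\<^sup>2 / 2 * 0\<^sup>2) at_top" by (intro tendsto_intros)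
  have "((\<lambda>t. G t - C\<^sup>2 / 2 * (inverse (r t))\<^sup>2 + B t / 2 + \<alpha>\<^sup>2 * (W t)\<^sup>2) \<longlongrightarrow> l - C\<^sup>2 / 2 * 0\<^sup>2 + 0 / 2 + 0) at_top"
    by (intro tendsto_add tendsto_diff tendsto_divide l B0 M ir tendsto_const) simp
  moreover have "eventually (\<lambda>t. G t - C\<^sup>2 / 2 * (inverse (r t))\<^sup>2 + B t / 2 + \<alpha>\<^sup>2 * (W t)\<^sup>2 = (U t)\<^sup>2) at_top"
    using eventually_in_I
  proof eventually_elim
    case (elim t)
    have "1 / (r t)\<^sup>2 = (inverse (r t))\<^sup>2" by (simp add: divide_inverse power_inverse)
    then show ?case using E_eq[OF elim] by (simp add: G_def)
  qed
  ultimately have U2: "((\<lambda>t. (U t)\<^sup>2) \<longlongrightarrow> l) at_top" by (rule tendsto_eventually_eq) simp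
  have "l \<ge> 0" by (rule tendsto_lowerbound[OF U2]) auto
  have bU2: "ev_bounded (\<lambda>t. (U t)\<^sup>2)" by (rule ev_bounded_tendsto[OF U2])
  have bU: "ev_bounded U"
  proof -
    obtain K where "eventually (\<lambda>t. \<bar>(U t)\<^sup>2\<bar> \<le> K) at_top" using bU2 by (auto simp: ev_bounded_def)
    then have "eventually (\<lambda>t. \<bar>U t\<bar> \<le> sqrt K) at_top"
      by eventually_elim (simp, metis real_sqrt_abs real_sqrt_le_mono)
    then show ?thesis by (auto simp: ev_bounded_def)
  qed
  have "\<not> l > 0"
  proof
    assume l0: "l > 0"
    \<comment> \<open>The derivative of \<open>W U\<close> consists of \<open>r U^2\<close>, which
      would tend to infinity, of \<open>\<alpha>^2 r W^2 \<ge> 0\<close>, and of these bounded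
      terms.\<close>
    have "ev_bounded (\<lambda>t. W t * (W t * ((W t)\<^sup>2 - 1) * (1 / r t)) - D t * (W t * U t))"
      by (intro ev_bounded_intros ev_bounded_W ev_bounded_D ev_bounded_inverse_r bU)
    then obtain K where K: "eventually (\<lambda>t. \<bar>W t * (W t * ((W t)\<^sup>2 - 1) * (1 / r t)) - D t * (W t * U t)\<bar> \<le> K) at_top"
      by (auto simp: ev_bounded_def)
    have "eventually (\<lambda>t. (U t)\<^sup>2 > l / 2) at_top" using order_tendstoD(1)[OF U2, of "l/2"] l0 by simp
    moreover have "eventually (\<lambda>t. r t \<ge> 2 * (\<bar>K\<bar> + 1) / l) at_top" using r by (simp add: filterlim_at_top)
    ultimately have "eventually (\<lambda>t. 1 \<le> r t * U t * U t + (F t - D t * U t) * W t) at_top"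
      using K eventually_in_I
    proof eventually_elim
      case (elim t)
      have "2 * (\<bar>K\<bar> + 1) / l * (l / 2) \<le> r t * (U t)\<^sup>2"
        using elim l0 r_pos[OF elim(4)] by (intro mult_mono) auto
      then have 1: "\<bar>K\<bar> + 1 \<le> r t * (U t)\<^sup>2" using l0 by simp
      have 2: "0 \<le> \<alpha>\<^sup>2 * r t * (W t)\<^sup>2" using r_pos[OF elim(4)] by simp
      have "(F t - D t * U t) * W t = (W t * (W t * ((W t)\<^sup>2 - 1) * (1 / r t)) - D t * (W t * U t)) + \<alpha>\<^sup>2 * r t * (W t)\<^sup>2"
      proof -
        have "F t = W t * ((W t)\<^sup>2 - 1) * (1 / r t) + \<alpha>\<^sup>2 * r t * W t" by (simp add: F_def)
        then show ?thesis by algebra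
      qed
      moreover have "r t * U t * U t = r t * (U t)\<^sup>2" by (simp add: power2_eq_square)
      ultimately show ?case using 1 2 elim(3) by linarith
    qed
    from eventually_conj[OF this eventually_in_I]
    obtain t1 where t1: "\<And>t. t1 \<le> t \<Longrightarrow> 1 \<le> r t * U t * U t + (F t - D t * U t) * W t" "\<And>t. t1 \<le> t \<Longrightarrow> t \<in> I"
      unfolding eventually_at_top_linorder by auto
    have "filterlim (\<lambda>t. W t * U t) at_top at_top"
      by (rule filterlim_at_top_of_deriv[OF DERIV_mult[OF W_deriv U_deriv], where c = 1 and a = t1]) (use t1 in auto)
    moreover have "ev_bounded (\<lambda>t. W t * U t)" by (intro ev_bounded_intros ev_bounded_W bU)
    then obtain K' where K': "eventually (\<lambda>t. \<bar>W t * U t\<bar> \<le> K') at_top" by (auto simp: ev_bounded_def)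
    ultimately have "eventually (\<lambda>t. W t * U t \<ge> K' + 1) at_top" by (simp add: filterlim_at_top)
    with K' have "eventually (\<lambda>t::real. False) at_top" by eventually_elim linarith
    then show False by simp
  qed
  then have "l = 0" using \<open>l \<ge> 0\<close> by simp
  then show ?thesis using U2 tendsto_0_of_square by blast
qed

text \<open>\<open>N\<close> obeys a Riccati equation with vanishing error. Then
  \<open>\<kappa> \<ge> N > 1/2\<close> eventually, so \<open>D\<close> is damped while its source
  \<open>B + 2 U^2\<close> vanishes.\<close>

lemma asymptotically_flat:
  assumes r: "filterlim r at_top at_top" and M: "((\<lambda>t. \<alpha>\<^sup>2 * (W t)\<^sup>2) \<longlongrightarrow> 0) at_top"
  shows "(N \<longlongrightarrow> 1) at_top" "(D \<longlongrightarrow> 0) at_top" "(\<kappa> \<longlongrightarrow> 1) at_top"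
proof -
  note B0 = B_tendsto_0[OF r] and U0 = U_tendsto_0[OF r M]
  show N1: "(N \<longlongrightarrow> 1) at_top"
  proof (rule riccati_tendsto_1[OF eventually_deriv[OF N_deriv], where c = "1/2"])
    show "eventually (\<lambda>t. 0 \<le> N t) at_top" using eventually_in_I by eventually_elim (use N_pos in \<open>auto intro: less_imp_le\<close>)
    have "((\<lambda>t. - (U t)\<^sup>2 - B t / 2 - \<alpha>\<^sup>2 * (W t)\<^sup>2) \<longlongrightarrow> - 0\<^sup>2 - 0 / 2 - 0) at_top"
      by (intro tendsto_intros U0 B0 M) simp
    moreover have "eventually (\<lambda>t. - (U t)\<^sup>2 - B t / 2 - \<alpha>\<^sup>2 * (W t)\<^sup>2 = D t * N t - 2 * (U t)\<^sup>2 - 1 / 2 * (1 - (N t)\<^sup>2)) at_top"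
      using eventually_in_I
    proof eventually_elim
      case (elim t)
      show ?case using N_rate[OF elim] by (simp add: field_simps)
    qed
    ultimately show "((\<lambda>t. D t * N t - 2 * (U t)\<^sup>2 - 1 / 2 * (1 - (N t)\<^sup>2)) \<longlongrightarrow> 0) at_top"
      by (rule tendsto_eventually_eq) simp
  qed auto
  have BU: "((\<lambda>t. B t + 2 * (U t)\<^sup>2) \<longlongrightarrow> 0 + 2 * 0\<^sup>2) at_top" by (intro tendsto_intros B0 U0)
  show D0': "(D \<longlongrightarrow> 0) at_top"
  proof (rule order_tendstoI)
    fix y :: real assume "y < 0"
    then show "eventually (\<lambda>t. y < D t) at_top" using eventually_in_I by (auto elim!: eventually_mono dest: D0)
  next
    fix y :: real assume "0 < y"
    define e where "e = y / 2"
    have e: "0 < e" "e < y" using \<open>0 < y\<close> by (auto simp: e_def)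
    have "eventually (\<lambda>t. D t \<le> e) at_top"
    proof (rule eventually_le_of_deriv[OF eventually_deriv[OF D_deriv], where d = "e / 4"])
      have "eventually (\<lambda>t. B t + 2 * (U t)\<^sup>2 < e / 4) at_top" using order_tendstoD(2)[OF BU, of "e/4"] e by simp
      moreover have "eventually (\<lambda>t. N t > 1 / 2) at_top" using order_tendstoD(1)[OF N1, of "1/2"] by simp
      ultimately show "eventually (\<lambda>t. e < D t \<longrightarrow> B t + 2 * (U t)\<^sup>2 - D t * \<kappa> t \<le> - (e / 4)) at_top"
      proof eventually_elim
        case (elim t)
        show ?case
        proof
          assume "e < D t"
          then have "e * (1 / 2) \<le> D t * \<kappa> t" using elim(2) e by (intro mult_mono) (auto simp: D_def)
          then show "B t + 2 * (U t)\<^sup>2 - D t * \<kappa> t \<le> - (e / 4)" using elim(1) by linarith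
        qed
      qed
    qed (use e in auto)
    then show "eventually (\<lambda>t. D t < y) at_top" by eventually_elim (use e in simp)
  qed
  have "((\<lambda>t. D t + N t) \<longlongrightarrow> 0 + 1) at_top" by (intro tendsto_intros N1 D0')
  then show "(\<kappa> \<longlongrightarrow> 1) at_top" by (simp add: D_def)
qed

text \<open>Without mass term the field moves by \<open>W'' = W (W^2 - 1) + (N - D) W'\<close>, with
  an antifriction coefficient tending to 1. Its energy \<open>e\<close> increases, and it converges
  because bounded \<open>W\<close> leaves it no way to diverge. Hence \<open>V\<close> tends to 0
  and \<open>W\<close> to an equilibrium: 0 or one of the vacua 1 and -1.\<close>

lemma W_limit_massless:
  assumes r: "filterlim r at_top at_top" and \<alpha>: "\<alpha> = 0"
  shows "(W \<longlongrightarrow> 0) at_top \<or> (W \<longlongrightarrow> 1) at_top \<or> (W \<longlongrightarrow> -1) at_top"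
proof -
  have M: "((\<lambda>t. \<alpha>\<^sup>2 * (W t)\<^sup>2) \<longlongrightarrow> 0) at_top" using \<alpha> by simp
  note flat = asymptotically_flat[OF r M]
  have \<alpha>2: "\<alpha>\<^sup>2 = 0" using \<alpha> by simp
  have ND: "((\<lambda>t. N t - D t) \<longlongrightarrow> 1 - 0) at_top" by (intro tendsto_intros flat)
  obtain C where C: "eventually (\<lambda>t. (W t)\<^sup>2 \<le> C) at_top" "C \<ge> 1" using W_bounded by blast
  have "eventually (\<lambda>t. N t - D t > 1 / 2) at_top" "eventually (\<lambda>t. N t - D t < 3 / 2) at_top"
    using order_tendstoD(1)[OF ND, of "1/2"] order_tendstoD(2)[OF ND, of "3/2"] by auto
  from eventually_conj[OF C(1) eventually_conj[OF this(1) eventually_conj[OF this(2) eventually_in_I]]]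
  obtain t0 where t0: "\<And>t. t0 \<le> t \<Longrightarrow> (W t)\<^sup>2 \<le> C" "\<And>t. t0 \<le> t \<Longrightarrow> N t - D t > 1 / 2"
    "\<And>t. t0 \<le> t \<Longrightarrow> N t - D t < 3 / 2" "\<And>t. t0 \<le> t \<Longrightarrow> t \<in> I"
    unfolding eventually_at_top_linorder by auto
  define e where "e t = 1 / 2 * (V t)\<^sup>2 - 1 / 4 * ((W t)\<^sup>2 - 1)\<^sup>2" for t
  have V'_eq: "V' t = W t * ((W t)\<^sup>2 - 1) + (N t - D t) * V t" for t unfolding V'_def by (simp add: \<alpha>)
  have e_deriv: "(e has_real_derivative (N t - D t) * (V t)\<^sup>2) (at t)" if "t \<in> I" for t
    unfolding e_def
    by (rule derivative_eq_intros V_deriv[OF that] W_deriv'[OF that] refl)+ (simp add: V'_eq algebra_simps power2_eq_square)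
  have e_mono: "e s \<le> e t" if "t0 \<le> s" "s \<le> t" for s t
  proof (rule nondecreasing_of_deriv[OF that(2) e_deriv])
    fix x assume "s \<le> x" "x \<le> t"
    then have x: "t0 \<le> x" using that by simp
    show "x \<in> I" using t0(4)[OF x] .
    show "0 \<le> (N x - D x) * (V x)\<^sup>2" using t0(2)[OF x] by (intro mult_nonneg_nonneg) auto
  qed
  have e_le: "e s \<le> C + 2" if s: "t0 \<le> s" for s
  proof (rule ccontr)
    assume big: "\<not> e s \<le> C + 2"
    have V_big: "(V t)\<^sup>2 \<ge> 2 * (C + 2)" if "s \<le> t" for t
    proof -
      have "C + 2 \<le> e t" using big e_mono[OF s that] by simp
      moreover have "0 \<le> ((W t)\<^sup>2 - 1)\<^sup>2" by simp
      ultimately show ?thesis unfolding e_def by argo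
    qed
    \<comment> \<open>Subtracting \<open>W^2 / 2\<close> replaces \<open>N - D\<close> by the small
      coefficient \<open>N - D - 1\<close>; with \<open>V^2 \<ge> 2 (C + 2)\<close> and
      \<open>W^2 \<le> C\<close> the growth rate is at least 1. Then \<open>W V \<ge> 1\<close>
      eventually, and \<open>W^2\<close> would diverge.\<close>
    have "filterlim (\<lambda>t. W t * V t - (W t)\<^sup>2 / 2) at_top at_top"
    proof (rule filterlim_at_top_of_deriv[where a = s and c = 1])
      fix t assume t: "s \<le> t"
      then have t0t: "t0 \<le> t" using s by simp
      note tI = t0(4)[OF t0t]
      have pV: "p t = W t * V t" by (simp add: p_def V_def)
      show "((\<lambda>t. W t * V t - (W t)\<^sup>2 / 2) has_real_derivative (V t)\<^sup>2 + W t * V' t - W t * V t) (at t)"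
        using DERIV_diff[OF DERIV_mult[OF W_deriv'[OF tI] V_deriv[OF tI]] DERIV_cdivide[OF W_square_deriv[OF tI], of 2]]
        by (simp add: pV algebra_simps power2_eq_square)
      have eq: "(V t)\<^sup>2 + W t * V' t - W t * V t = (V t)\<^sup>2 + (W t)\<^sup>2 * ((W t)\<^sup>2 - 1) + (N t - D t - 1) * (W t * V t)"
        by (simp add: V'_eq algebra_simps power2_eq_square)
      have 1: "(W t)\<^sup>2 * ((W t)\<^sup>2 - 1) \<ge> - 1 / 4"
        using zero_le_power2[of "(W t)\<^sup>2 - 1 / 2"] by (simp add: power2_eq_square algebra_simps)
      have "\<bar>(N t - D t - 1) * (W t * V t)\<bar> \<le> 1 / 2 * (((W t)\<^sup>2 + (V t)\<^sup>2) / 2)"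
        unfolding abs_mult[of "N t - D t - 1"]
      proof (intro mult_mono)
        show "\<bar>N t - D t - 1\<bar> \<le> 1 / 2" using t0(2,3)[OF t0t] by (intro abs_leI) linarith+
        show "\<bar>W t * V t\<bar> \<le> ((W t)\<^sup>2 + (V t)\<^sup>2) / 2"
          using abs_mult_le_mean_squares[of "W t" "V t"] by (simp add: abs_mult)
      qed auto
      then have 2: "(N t - D t - 1) * (W t * V t) \<ge> - ((W t)\<^sup>2 / 4 + (V t)\<^sup>2 / 4)" by (simp add: abs_le_iff)
      show "1 \<le> (V t)\<^sup>2 + W t * V' t - W t * V t"
        unfolding eq using 1 2 V_big[OF t] t0(1)[OF t0t] C(2) by argo
    qed auto
    then have "eventually (\<lambda>t. W t * V t - (W t)\<^sup>2 / 2 \<ge> 1) at_top" by (simp add: filterlim_at_top)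
    from eventually_conj[OF this eventually_in_I]
    obtain t1 where t1: "\<And>t. t1 \<le> t \<Longrightarrow> W t * V t - (W t)\<^sup>2 / 2 \<ge> 1" "\<And>t. t1 \<le> t \<Longrightarrow> t \<in> I"
      unfolding eventually_at_top_linorder by auto
    have "filterlim (\<lambda>t. (W t)\<^sup>2) at_top at_top"
    proof (rule filterlim_at_top_of_deriv[OF W_square_deriv, where c = 2 and a = t1])
      fix t assume t: "t1 \<le> t"
      show "t \<in> I" using t1(2)[OF t] .
      show "2 \<le> 2 * p t" using t1(1)[OF t] zero_le_power2[of "W t"] unfolding p_def V_def by argo
    qed auto
    then show False using W_square_not_at_top by simp
  qed
  obtain l where l: "(e \<longlongrightarrow> l) at_top"
    by (rule tendsto_of_nondecreasing[of t0 e "C + 2"]) (use e_mono e_le in auto)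
  have bV: "ev_bounded V"
  proof -
    have "eventually (\<lambda>t. \<bar>V t\<bar> \<le> sqrt (2 * (C + 2) + C\<^sup>2)) at_top"
      using eventually_ge_at_top[of t0]
    proof eventually_elim
      case (elim t)
      have "\<bar>(W t)\<^sup>2 - 1\<bar> \<le> C" using t0(1)[OF elim] C(2) by (smt (verit) zero_le_power2)
      then have "((W t)\<^sup>2 - 1)\<^sup>2 \<le> C\<^sup>2" by (metis abs_ge_zero power2_abs power_mono)
      moreover have "(V t)\<^sup>2 = 2 * e t + ((W t)\<^sup>2 - 1)\<^sup>2 / 2" by (simp add: e_def)
      moreover have "0 \<le> C\<^sup>2" by simp
      ultimately have "(V t)\<^sup>2 \<le> 2 * (C + 2) + C\<^sup>2" using e_le[OF elim] by argo
      then show ?case by (metis real_sqrt_abs real_sqrt_le_mono)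
    qed
    then show ?thesis by (auto simp: ev_bounded_def)
  qed
  have bU: "ev_bounded U" and bB: "ev_bounded B"
    by (rule ev_bounded_tendsto[OF U_tendsto_0[OF r M]] ev_bounded_tendsto[OF B_tendsto_0[OF r]])+
  have bV': "ev_bounded V'" unfolding V'_eq[abs_def]
    by (intro ev_bounded_intros ev_bounded_W ev_bounded_N ev_bounded_D bV)
  note bnd = ev_bounded_W ev_bounded_N ev_bounded_D bV bU bB bV'
  have "((\<lambda>t. (N t - D t) * (V t)\<^sup>2) \<longlongrightarrow> 0) at_top"
  proof (rule deriv_tendsto_0'[OF l eventually_deriv[OF e_deriv]])
    show "eventually (\<lambda>t. ((\<lambda>t. (N t - D t) * (V t)\<^sup>2) has_real_derivative
        ((D t * N t - 2 * (U t)\<^sup>2) - (B t + 2 * (U t)\<^sup>2 - D t * (D t + N t))) * (V t)\<^sup>2 + (N t - D t) * (2 * V t * V' t)) (at t)) at_top"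
    proof (rule eventually_deriv)
      fix t assume t: "t \<in> I"
      show "((\<lambda>t. (N t - D t) * (V t)\<^sup>2) has_real_derivative
        ((D t * N t - 2 * (U t)\<^sup>2) - (B t + 2 * (U t)\<^sup>2 - D t * (D t + N t))) * (V t)\<^sup>2 + (N t - D t) * (2 * V t * V' t)) (at t)"
        by (rule derivative_eq_intros N_deriv[OF t] D_deriv[OF t] V_deriv[OF t] refl)+ (simp add: D_def algebra_simps)
    qed
    show "ev_bounded (\<lambda>t. ((D t * N t - 2 * (U t)\<^sup>2) - (B t + 2 * (U t)\<^sup>2 - D t * (D t + N t))) * (V t)\<^sup>2 + (N t - D t) * (2 * V t * V' t))"
      by (intro ev_bounded_intros bnd)
  qed
  then have "((\<lambda>t. (N t - D t) * (V t)\<^sup>2 / (N t - D t)) \<longlongrightarrow> 0 / (1 - 0)) at_top" by (intro tendsto_intros ND) auto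
  moreover have "eventually (\<lambda>t. (N t - D t) * (V t)\<^sup>2 / (N t - D t) = (V t)\<^sup>2) at_top"
    using eventually_ge_at_top[of t0] by eventually_elim (use t0(2) in force)
  ultimately have V2: "((\<lambda>t. (V t)\<^sup>2) \<longlongrightarrow> 0) at_top" by (rule tendsto_eventually_eq) simp
  then have V0: "(V \<longlongrightarrow> 0) at_top" by (rule tendsto_0_of_square)
  have V'0: "(V' \<longlongrightarrow> 0) at_top"
  proof (rule deriv_tendsto_0'[OF V0 eventually_deriv[OF V_deriv] eventually_deriv[OF V'_deriv]])
    show "ev_bounded (\<lambda>t. V t * ((W t)\<^sup>2 - 1 + \<alpha>\<^sup>2 * (r t)\<^sup>2) + W t * (2 * W t * V t + \<alpha>\<^sup>2 * (2 * (r t)\<^sup>2 * N t))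
      + ((D t * N t - 2 * (U t)\<^sup>2) - (B t + 2 * (U t)\<^sup>2 - D t * (D t + N t))) * V t + (N t - D t) * V' t)"
      unfolding \<alpha>2 mult_zero_left add_0_right by (intro ev_bounded_intros bnd)
  qed (assumption)+
  have "((\<lambda>t. V' t - (N t - D t) * V t) \<longlongrightarrow> 0 - (1 - 0) * 0) at_top" by (intro tendsto_intros V'0 ND V0)
  then have q0: "((\<lambda>t. W t * ((W t)\<^sup>2 - 1)) \<longlongrightarrow> 0) at_top" by (simp add: V'_eq)
  have "((\<lambda>t. 2 * (V t)\<^sup>2 - 4 * e t) \<longlongrightarrow> 2 * 0 - 4 * l) at_top" by (intro tendsto_intros V2 l)
  then have w2: "((\<lambda>t. ((W t)\<^sup>2 - 1)\<^sup>2) \<longlongrightarrow> - 4 * l) at_top" by (simp add: e_def)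
  \<comment> \<open>The limit \<open>- 4 l\<close> of \<open>(W^2 - 1)^2\<close> separates the
    equilibria: for \<open>l = 0\<close> it is \<open>W^2\<close> that tends to 1, otherwise
    \<open>W\<close> tends to 0.\<close>
  show ?thesis
  proof (cases "l = 0")
    case False
    have "((\<lambda>t. (W t * ((W t)\<^sup>2 - 1))\<^sup>2 / ((W t)\<^sup>2 - 1)\<^sup>2) \<longlongrightarrow> 0\<^sup>2 / (- 4 * l)) at_top"
      using False by (intro tendsto_intros q0 w2) auto
    moreover have "eventually (\<lambda>t. ((W t)\<^sup>2 - 1)\<^sup>2 \<noteq> 0) at_top"
      by (rule tendsto_imp_eventually_ne[OF w2]) (use False in simp)
    then have "eventually (\<lambda>t. (W t * ((W t)\<^sup>2 - 1))\<^sup>2 / ((W t)\<^sup>2 - 1)\<^sup>2 = (W t)\<^sup>2) at_top"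
      by eventually_elim (auto simp: power_mult_distrib)
    ultimately have "((\<lambda>t. (W t)\<^sup>2) \<longlongrightarrow> 0) at_top" by (rule tendsto_eventually_eq) simp
    then show ?thesis using tendsto_0_of_square by blast
  next
    case True
    then have "((\<lambda>t. (W t)\<^sup>2 - 1) \<longlongrightarrow> 0) at_top" using w2 tendsto_0_of_square[of "\<lambda>t. (W t)\<^sup>2 - 1"] by simp
    then have W2: "((\<lambda>t. (W t)\<^sup>2) \<longlongrightarrow> 1) at_top" by (simp add: LIM_zero_iff)
    then have "((\<lambda>t. sqrt ((W t)\<^sup>2)) \<longlongrightarrow> sqrt 1) at_top" by (intro tendsto_real_sqrt)
    then have absW: "((\<lambda>t. \<bar>W t\<bar>) \<longlongrightarrow> 1) at_top" by simp
    have "eventually (\<lambda>t. (W t)\<^sup>2 > 0) at_top" using order_tendstoD(1)[OF W2, of 0] by simp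
    from eventually_conj[OF this eventually_in_I]
    obtain t1 where t1: "\<And>t. t1 \<le> t \<Longrightarrow> W t \<noteq> 0" "\<And>t. t1 \<le> t \<Longrightarrow> t \<in> I"
      unfolding eventually_at_top_linorder by auto
    have sgn: "s * W t > 0" if sg: "s * W t1 > 0" "t1 \<le> t" "\<bar>s\<bar> = 1" for s t
    proof (rule ccontr)
      assume *: "\<not> s * W t > 0"
      have "{t1..t} \<subseteq> I" using t1(2) by auto
      then have "continuous_on {t1..t} (\<lambda>t. s * W t)" by (intro continuous_intros cont_on(3))
      then obtain c where "t1 < c" "s * W c = 0" using first_zero[of t1 t "\<lambda>t. s * W t"] sg * by auto
      then show False using t1(1)[of c] sg(3) by auto
    qed
    show ?thesis
    proof (cases "W t1 > 0")
      case True
      have "eventually (\<lambda>t. \<bar>W t\<bar> = W t) at_top" using eventually_ge_at_top[of t1]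
        by eventually_elim (use sgn[of 1] True in force)
      then have "(W \<longlongrightarrow> 1) at_top" using absW by (blast intro: tendsto_eventually_eq)
      then show ?thesis by simp
    next
      case False
      then have neg: "W t1 < 0" using t1(1)[of t1] by simp
      have "eventually (\<lambda>t. - \<bar>W t\<bar> = W t) at_top" using eventually_ge_at_top[of t1]
        by eventually_elim (use sgn[of "-1"] neg in force)
      moreover have "((\<lambda>t. - \<bar>W t\<bar>) \<longlongrightarrow> - 1) at_top" by (intro tendsto_intros absW)
      ultimately have "(W \<longlongrightarrow> - 1) at_top" by (blast intro: tendsto_eventually_eq)
      then show ?thesis by simp
    qed
  qed
qed

end

section \<open>Oscillation\<close>

text \<open>If zeros are crossed only upwards, there is at most one crossing. In the proofs of
  monotone decay \<open>f\<close> will be a quadratic form in \<open>W\<close> and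
  \<open>U\<close>.\<close>

lemma eventually_sign_of_upcrossing:
  fixes f :: "real \<Rightarrow> real"
  assumes "eventually (\<lambda>t. (f has_real_derivative f' t) (at t)) at_top"
    "eventually (\<lambda>t. f t = 0 \<longrightarrow> f' t > 0) at_top"
  shows "eventually (\<lambda>t. f t > 0) at_top \<or> eventually (\<lambda>t. f t < 0) at_top"
proof -
  from eventually_conj[OF assms] obtain a where a: "\<And>t. a \<le> t \<Longrightarrow> (f has_real_derivative f' t) (at t)"
    "\<And>t. a \<le> t \<Longrightarrow> f t = 0 \<Longrightarrow> f' t > 0" unfolding eventually_at_top_linorder by auto
  show ?thesis
  proof (cases "\<exists>b\<ge>a. f b \<ge> 0")
    case True
    then obtain b where b: "b \<ge> a" "f b \<ge> 0" by blast
    have "f t > 0" if "b < t" for t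
      by (rule positive_after_upcrossing[OF that, where f' = f']) (use a b in auto)
    then have "eventually (\<lambda>t. f t > 0) at_top" by (rule eventually_mono[OF eventually_gt_at_top[of b]])
    then show ?thesis ..
  next
    case False
    then have "eventually (\<lambda>t. f t < 0) at_top" by (intro eventually_mono[OF eventually_ge_at_top[of a]]) force
    then show ?thesis ..
  qed
qed

lemma quadratic_nonneg:
  fixes a b c y :: real
  assumes "a > 0" "b\<^sup>2 \<le> 4 * a * c"
  shows "0 \<le> a * y\<^sup>2 + b * y + c"
proof -
  have "4 * a * (a * y\<^sup>2 + b * y + c) = (2 * a * y + b)\<^sup>2 + (4 * a * c - b\<^sup>2)"
    by (simp add: power2_eq_square algebra_simps)
  also have "\<dots> \<ge> 0" using assms by simp
  finally show ?thesis using assms by (simp add: zero_le_mult_iff)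
qed

text \<open>With \<open>c > 1/4\<close> the limiting equation \<open>W'' + W' + c W = 0\<close> is underdamped: the angle
  \<open>arctan (U / W)\<close> decreases at a uniform rate.\<close>

lemma underdamped_not_eventually_positive:
  fixes W U A D r :: "real \<Rightarrow> real"
  assumes dW: "eventually (\<lambda>t. (W has_real_derivative r t * U t) (at t)) at_top"
    and dU: "eventually (\<lambda>t. (U has_real_derivative A t * W t - D t * U t) (at t)) at_top"
    and r: "(r \<longlongrightarrow> 1) at_top" and D: "(D \<longlongrightarrow> 1) at_top" and A: "(A \<longlongrightarrow> - c) at_top"
    and c: "c > 1 / 4"
  shows "\<not> eventually (\<lambda>t. W t > 0) at_top"
proof
  assume Wpos: "eventually (\<lambda>t. W t > 0) at_top"
  \<comment> \<open>Small enough for \<open>(1 - \<delta>) (c - \<delta>) > 1/4\<close>: the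
    quadratic form stays positive after lowering both outer coefficients by \<open>\<delta>\<close>,
    and this surplus is the uniform angular speed.\<close>
  define \<delta> where "\<delta> = (c - 1 / 4) / (2 * (1 + c))"
  have \<delta>: "\<delta> > 0" "\<delta> < 1" using c by (auto simp: \<delta>_def field_simps)
  have "\<delta> * (1 + c) = (c - 1 / 4) / 2" using c by (simp add: \<delta>_def field_simps)
  moreover have "(1 - \<delta>) * (c - \<delta>) = c - \<delta> * (1 + c) + \<delta>\<^sup>2" by (simp add: algebra_simps power2_eq_square)
  ultimately have "(1 - \<delta>) * (c - \<delta>) > 1 / 4" using c zero_le_power2[of \<delta>] by argo
  then have lim_pos: "4 * (1 - \<delta>) * (c - \<delta>) - 1\<^sup>2 > 0" unfolding mult.assoc one_power2 by linarith
  have "((\<lambda>t. 4 * (r t - \<delta>) * (- A t - \<delta>) - (D t)\<^sup>2) \<longlongrightarrow> 4 * (1 - \<delta>) * (- (- c) - \<delta>) - 1\<^sup>2) at_top"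
    by (intro tendsto_intros r D A)
  then have ev1: "eventually (\<lambda>t. 4 * (r t - \<delta>) * (- A t - \<delta>) - (D t)\<^sup>2 > 0) at_top"
    by (rule order_tendstoD) (use lim_pos in simp)
  have ev2: "eventually (\<lambda>t. r t > \<delta>) at_top" using order_tendstoD(1)[OF r \<delta>(2)] .
  from eventually_conj[OF dW eventually_conj[OF dU eventually_conj[OF Wpos eventually_conj[OF ev1 ev2]]]]
  obtain a where a: "\<And>t. a \<le> t \<Longrightarrow> (W has_real_derivative r t * U t) (at t)"
    "\<And>t. a \<le> t \<Longrightarrow> (U has_real_derivative A t * W t - D t * U t) (at t)"
    "\<And>t. a \<le> t \<Longrightarrow> W t > 0" "\<And>t. a \<le> t \<Longrightarrow> 4 * (r t - \<delta>) * (- A t - \<delta>) - (D t)\<^sup>2 > 0"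
    "\<And>t. a \<le> t \<Longrightarrow> r t > \<delta>" unfolding eventually_at_top_linorder by auto
  define y where "y t = U t / W t" for t
  have "filterlim (\<lambda>t. arctan (y t)) at_bot at_top"
  proof (rule filterlim_at_bot_of_deriv[where a = a and c = \<delta>])
    fix t assume t: "a \<le> t"
    have "(y has_real_derivative A t - D t * y t - r t * (y t)\<^sup>2) (at t)"
      unfolding y_def using a(3)[OF t]
      by (auto intro!: derivative_eq_intros a(1)[OF t] a(2)[OF t] simp: field_simps power2_eq_square)
    then show "((\<lambda>t. arctan (y t)) has_real_derivative (A t - D t * y t - r t * (y t)\<^sup>2) / (1 + (y t)\<^sup>2)) (at t)"
      by (auto intro!: derivative_eq_intros simp: field_simps)
    have "0 \<le> (r t - \<delta>) * (y t)\<^sup>2 + D t * y t + (- A t - \<delta>)"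
      by (rule quadratic_nonneg) (use a(4,5)[OF t] in auto)
    then have "A t - D t * y t - r t * (y t)\<^sup>2 \<le> - \<delta> * (1 + (y t)\<^sup>2)" by (simp add: algebra_simps)
    moreover have "1 + (y t)\<^sup>2 > 0" by (simp add: add_pos_nonneg)
    ultimately show "(A t - D t * y t - r t * (y t)\<^sup>2) / (1 + (y t)\<^sup>2) \<le> - \<delta>" by (simp add: divide_le_eq)
  qed (rule \<delta>(1))
  then have "eventually (\<lambda>t. arctan (y t) \<le> - (pi / 2)) at_top" by (simp add: filterlim_at_bot)
  moreover have "\<not> arctan (y t) \<le> - (pi / 2)" for t using arctan_lbound[of "y t"] by simp
  ultimately show False by simp
qed

text \<open>\<open>1 / (4 t^2)\<close> is the margin that the moving barrier leaves in the
  critically damped case.\<close>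

lemma exp_decay_square_negligible:
  "eventually (\<lambda>t::real. C * exp (- t / 6) < 1 / (4 * t\<^sup>2)) at_top"
proof -
  have "filterlim (\<lambda>t::real. 1 / 6 * t) at_top at_top"
    by (intro filterlim_tendsto_pos_mult_at_top[OF tendsto_const] filterlim_ident) simp
  then have "((\<lambda>t::real. (1 / 6 * t) ^ 2 / exp (1 / 6 * t)) \<longlongrightarrow> 0) at_top"
    by (rule filterlim_compose[OF tendsto_power_div_exp_0])
  then have "((\<lambda>t::real. 144 * C * ((1 / 6 * t) ^ 2 / exp (1 / 6 * t))) \<longlongrightarrow> 144 * C * 0) at_top"
    by (intro tendsto_intros)
  then have "eventually (\<lambda>t::real. 144 * C * ((1 / 6 * t) ^ 2 / exp (1 / 6 * t)) < 1) at_top"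
    by (rule order_tendstoD) simp
  then show ?thesis using eventually_gt_at_top[of 0]
  proof eventually_elim
    case (elim t)
    have "144 * C * ((1 / 6 * t) ^ 2 / exp (1 / 6 * t)) = (C * exp (- t / 6)) * (4 * t\<^sup>2)"
      by (simp add: exp_minus field_simps power2_eq_square)
    then show ?case using elim by (simp add: less_divide_eq)
  qed
qed

text \<open>1/6 is a decay rate which the Lyapunov function of the critically damped case provides;
  fixing one rate makes the class closed under sums and bounded factors.\<close>

definition exp_small :: "(real \<Rightarrow> real) \<Rightarrow> bool" where
  "exp_small f \<longleftrightarrow> (\<exists>C. eventually (\<lambda>t. \<bar>f t\<bar> \<le> C * exp (- t / 6)) at_top)"

lemma exp_small_cong:
  assumes "exp_small f" "eventually (\<lambda>t. f t = g t) at_top" shows "exp_small g"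
proof -
  obtain C where "eventually (\<lambda>t. \<bar>f t\<bar> \<le> C * exp (- t / 6)) at_top"
    using assms(1) by (auto simp: exp_small_def)
  with assms(2) have "eventually (\<lambda>t. \<bar>g t\<bar> \<le> C * exp (- t / 6)) at_top"
    by eventually_elim simp
  then show ?thesis by (auto simp: exp_small_def)
qed

lemma exp_small_add:
  assumes "exp_small f" "exp_small g" shows "exp_small (\<lambda>t. f t + g t)"
proof -
  obtain C C' where "eventually (\<lambda>t. \<bar>f t\<bar> \<le> C * exp (- t / 6)) at_top"
    "eventually (\<lambda>t. \<bar>g t\<bar> \<le> C' * exp (- t / 6)) at_top"
    using assms by (auto simp: exp_small_def)
  then have "eventually (\<lambda>t. \<bar>f t + g t\<bar> \<le> (C + C') * exp (- t / 6)) at_top"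
    by eventually_elim (simp add: distrib_right)
  then show ?thesis by (auto simp: exp_small_def)
qed

lemma exp_small_mult:
  assumes "ev_bounded f" "exp_small g" shows "exp_small (\<lambda>t. f t * g t)"
proof -
  obtain C C' where "eventually (\<lambda>t. \<bar>f t\<bar> \<le> C) at_top"
    "eventually (\<lambda>t. \<bar>g t\<bar> \<le> C' * exp (- t / 6)) at_top"
    using assms by (auto simp: exp_small_def ev_bounded_def)
  then have "eventually (\<lambda>t. \<bar>f t * g t\<bar> \<le> (C * C') * exp (- t / 6)) at_top"
    unfolding abs_mult mult.assoc by eventually_elim (intro mult_mono; simp)
  then show ?thesis by (auto simp: exp_small_def)
qed

lemma exp_small_diff:
  assumes "exp_small f" "exp_small g" shows "exp_small (\<lambda>t. f t - g t)"
  using exp_small_add[OF assms(1) exp_small_mult[OF ev_bounded_const[of "-1"] assms(2)]] by simp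

lemma exp_small_of_le:
  assumes "eventually (\<lambda>t. \<bar>f t\<bar> \<le> C * exp (- t / 6)) at_top" shows "exp_small f"
  using assms by (auto simp: exp_small_def)

lemma exp_weight_deriv: "((\<lambda>t. exp (t / 6)) has_real_derivative exp (t / 6) / 6) (at (t::real))"
  by (auto intro!: derivative_eq_intros)

lemma exp_weight_deriv': "((\<lambda>t. exp (- t / 6)) has_real_derivative - exp (- t / 6) / 6) (at (t::real))"
  by (auto intro!: derivative_eq_intros)

lemma exp_small_of_weighted:
  assumes "eventually (\<lambda>t. \<bar>f t * exp (t / 6)\<bar> \<le> C) at_top" shows "exp_small f"
proof (rule exp_small_of_le)
  show "eventually (\<lambda>t. \<bar>f t\<bar> \<le> C * exp (- t / 6)) at_top"
    using assms by eventually_elim (simp add: abs_mult exp_minus field_simps)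
qed

text \<open>The damping rate \<open>k \<ge> 1\<close> exceeds 1/6, so \<open>f exp (t / 6)\<close>
  is still damped at a rate of at least 1/2 against a bounded source.\<close>

lemma exp_small_of_damped_ode:
  fixes f g k :: "real \<Rightarrow> real"
  assumes der: "eventually (\<lambda>t. (f has_real_derivative g t - k t * f t) (at t)) at_top"
    and g: "exp_small g" and k: "eventually (\<lambda>t. k t \<ge> 1) at_top"
  shows "exp_small f"
proof -
  obtain C where C: "eventually (\<lambda>t. \<bar>g t\<bar> \<le> C * exp (- t / 6)) at_top" using g by (auto simp: exp_small_def)
  have one_sided: "eventually (\<lambda>t. s * f t * exp (t / 6) \<le> 2 * \<bar>C\<bar> + 2) at_top" if s: "\<bar>s\<bar> = 1" for s
  proof (rule eventually_le_of_deriv[where d = 1])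
    show "eventually (\<lambda>t. ((\<lambda>t. s * f t * exp (t / 6)) has_real_derivative
        (s * g t - (k t - 1 / 6) * (s * f t)) * exp (t / 6)) (at t)) at_top"
      using der by eventually_elim
        (auto intro!: derivative_eq_intros simp: algebra_simps)
    show "eventually (\<lambda>t. 2 * \<bar>C\<bar> + 2 < s * f t * exp (t / 6) \<longrightarrow>
        (s * g t - (k t - 1 / 6) * (s * f t)) * exp (t / 6) \<le> - 1) at_top"
      using C k
    proof eventually_elim
      case (elim t)
      show ?case
      proof
        assume big: "2 * \<bar>C\<bar> + 2 < s * f t * exp (t / 6)"
        have "s * g t \<le> \<bar>g t\<bar>" using s by (metis abs_ge_self abs_mult mult_1)
        then have "s * g t * exp (t / 6) \<le> C * exp (- t / 6) * exp (t / 6)"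
          using elim(1) by (intro mult_right_mono) auto
        also have "\<dots> = C" by (simp add: mult.assoc exp_add[symmetric])
        finally have 1: "s * g t * exp (t / 6) \<le> \<bar>C\<bar>" by simp
        have "1 / 2 * (s * f t * exp (t / 6)) \<le> (k t - 1 / 6) * (s * f t * exp (t / 6))"
          using elim(2) big by (intro mult_right_mono) auto
        then show "(s * g t - (k t - 1 / 6) * (s * f t)) * exp (t / 6) \<le> - 1"
          using 1 big by (simp add: left_diff_distrib mult.assoc)
      qed
    qed
  qed simp
  have "eventually (\<lambda>t. \<bar>f t * exp (t / 6)\<bar> \<le> 2 * \<bar>C\<bar> + 2) at_top"
    using one_sided[OF abs_one] one_sided[of "-1", simplified] by eventually_elim (simp add: abs_le_iff)
  then show ?thesis by (rule exp_small_of_weighted)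
qed

section \<open>Behaviour of \<open>W\<close> near the fixed point\<close>

context eymh_global
begin

text \<open>The force is \<open>F = A W\<close>, so \<open>- A\<close> acts as the restoring
  coefficient of the field.\<close>

definition A :: "real \<Rightarrow> real" where "A t = ((W t)\<^sup>2 - 1) / r t + \<alpha>\<^sup>2 * r t"

lemma U_deriv': "t \<in> I \<Longrightarrow> (U has_real_derivative A t * W t - D t * U t) (at t)"
  using U_deriv[of t] by (simp add: F_def A_def algebra_simps)

end

text \<open>The solutions of case (iii). The slice \<open>t = const\<close> ends in an infinitely
  long tube whose radius tends to 1, hence the name.\<close>

locale eymh_horn = eymh_global +
  assumes lims: "(N \<longlongrightarrow> 0) at_top" "(U \<longlongrightarrow> 0) at_top" "(W \<longlongrightarrow> 0) at_top" "(r \<longlongrightarrow> 1) at_top" "(\<kappa> \<longlongrightarrow> 1) at_top"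
begin

lemma D_lim: "(D \<longlongrightarrow> 1) at_top"
proof -
  have "((\<lambda>t. \<kappa> t - N t) \<longlongrightarrow> 1 - 0) at_top" by (intro tendsto_intros lims)
  then show ?thesis by (simp add: D_def[abs_def])
qed

lemma A_lim: "(A \<longlongrightarrow> - (1 - \<alpha>\<^sup>2)) at_top"
proof -
  have "(A \<longlongrightarrow> (0\<^sup>2 - 1) / 1 + \<alpha>\<^sup>2 * 1) at_top" unfolding A_def[abs_def] by (intro tendsto_intros lims) simp
  then show ?thesis by simp
qed

lemma r_le_1: "t \<in> I \<Longrightarrow> r t \<le> 1"
proof -
  assume t: "t \<in> I"
  have "eventually (\<lambda>s. r t \<le> r s) at_top" using eventually_ge_at_top[of t] by eventually_elim (rule r_mono[OF t])
  then show "r t \<le> 1" by (intro tendsto_lowerbound[OF lims(4)]) auto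
qed

text \<open>A common zero of \<open>W\<close> and \<open>U\<close> makes \<open>W\<close> vanish
  identically; such a solution has \<open>r > 1\<close> somewhere, while here \<open>r\<close>
  increases to 1.\<close>

lemma WU_nonzero: "t \<in> I \<Longrightarrow> W t = 0 \<Longrightarrow> U t \<noteq> 0"
  using W_zero_unique[of t] W_nontrivial r_le_1 by force

lemma oscillation:
  assumes "\<alpha>\<^sup>2 < 3 / 4"
  shows "\<exists>\<^sub>F t in at_top. W t > 0" "\<exists>\<^sub>F t in at_top. W t < 0" "infinite {t \<in> I. W t = 0}"
proof -
  have 1: "\<not> eventually (\<lambda>t. W t > 0) at_top"
    by (rule underdamped_not_eventually_positive[OF eventually_deriv[OF W_deriv] eventually_deriv[OF U_deriv'] lims(4) D_lim A_lim])
      (use assms in auto)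
  have 2: "\<not> eventually (\<lambda>t. - W t > 0) at_top"
  proof (rule underdamped_not_eventually_positive[where U = "\<lambda>t. - U t", OF _ _ lims(4) D_lim A_lim])
    show "eventually (\<lambda>t. ((\<lambda>t. - W t) has_real_derivative r t * - U t) (at t)) at_top"
      using eventually_deriv[OF W_deriv] by (auto elim!: eventually_mono intro!: derivative_eq_intros)
    show "eventually (\<lambda>t. ((\<lambda>t. - U t) has_real_derivative A t * - W t - D t * - U t) (at t)) at_top"
      using eventually_deriv[OF U_deriv'] by (auto elim!: eventually_mono intro!: derivative_eq_intros)
  qed (use assms in auto)
  \<comment> \<open>A weak sign is excluded as well: at a zero a function of fixed weak sign has a
    minimum, so \<open>W\<close> and \<open>U\<close> would vanish together.\<close>
  have no_sign: False if ev: "eventually (\<lambda>t. s * W t \<ge> 0) at_top" and s: "\<bar>s\<bar> = 1" for s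
  proof -
    from eventually_conj[OF ev eventually_in_I]
    obtain a where a: "\<And>t. a \<le> t \<Longrightarrow> s * W t \<ge> 0" "\<And>t. a \<le> t \<Longrightarrow> t \<in> I"
      unfolding eventually_at_top_linorder by auto
    have "s * W t > 0" if t: "a < t" for t
    proof (rule ccontr)
      assume "\<not> s * W t > 0"
      then have "s * W t = 0" using a(1)[of t] t by simp
      then have W0: "W t = 0" using s by auto
      have tI: "t \<in> I" using a(2) t by simp
      have "((\<lambda>x. s * W x) has_real_derivative s * (r t * U t)) (at t)"
        by (intro DERIV_cmult W_deriv tI)
      moreover have "\<forall>y. \<bar>t - y\<bar> < t - a \<longrightarrow> s * W t \<le> s * W y" using a(1) \<open>s * W t = 0\<close> by auto
      ultimately have "s * (r t * U t) = 0" using t by (intro DERIV_local_min[of "\<lambda>x. s * W x" _ t "t - a"]) auto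
      then have "U t = 0" using s r_pos[OF tI] by auto
      then show False using WU_nonzero[OF tI W0] by simp
    qed
    then have "eventually (\<lambda>t. s * W t > 0) at_top" by (rule eventually_mono[OF eventually_gt_at_top[of a]])
    moreover have "s = 1 \<or> s = - 1" using s by linarith
    ultimately show False using 1 2 by auto
  qed
  show fpos: "\<exists>\<^sub>F t in at_top. W t > 0"
    using no_sign[of "-1"] by (auto simp: frequently_def not_less)
  show fneg: "\<exists>\<^sub>F t in at_top. W t < 0"
    using no_sign[of 1] by (auto simp: frequently_def not_less)
  show "infinite {t \<in> I. W t = 0}"
  proof
    assume fin: "finite {t \<in> I. W t = 0}"
    then obtain b where b: "\<And>t. t \<in> I \<Longrightarrow> W t = 0 \<Longrightarrow> t \<le> b"
      using bdd_above_finite[OF fin] by (auto simp: bdd_above_def)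
    obtain s where s: "s \<in> I" using N_pos_start by blast
    define c where "c = max (b + 1) s"
    have c: "t \<in> I" "W t \<noteq> 0" if "c \<le> t" for t
      using right_mem[OF T_infinite s, of t] b[of t] that by (auto simp: c_def)
    obtain x where x: "c \<le> x" "W x > 0"
      using frequently_ex[OF frequently_eventually_frequently[OF fpos eventually_ge_at_top[of c]]] by blast
    obtain y where y: "x \<le> y" "W y < 0"
      using frequently_ex[OF frequently_eventually_frequently[OF fneg eventually_ge_at_top[of x]]] by blast
    have "{x..y} \<subseteq> I" using c(1) x(1) by auto
    then have "continuous_on {x..y} W" by (rule cont_on(3))
    then obtain z where "x < z" "W z = 0" using first_zero[of x y W] x y by auto
    then show False using c(2)[of z] x(1) by simp
  qed
qed

text \<open>A positive product \<open>W U\<close> means growing \<open>W^2\<close>, which is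
  incompatible with the limit 0; only the negative sign is left.\<close>

lemma monotone_of_sign:
  assumes ev: "eventually (\<lambda>t. W t * U t > 0) at_top \<or> eventually (\<lambda>t. W t * U t < 0) at_top"
  shows "\<exists>t1\<in>I. strict_antimono_on {t1..} (\<lambda>t. \<bar>W t\<bar>)"
proof -
  have W2: "((\<lambda>t. (W t)\<^sup>2) has_real_derivative 2 * (r t * (W t * U t))) (at t)" if "t \<in> I" for t
    using W_square_deriv[OF that] by (simp add: p_def algebra_simps)
  have "\<not> eventually (\<lambda>t. W t * U t > 0) at_top"
  proof
    assume "eventually (\<lambda>t. W t * U t > 0) at_top"
    from eventually_conj[OF this eventually_in_I]
    obtain a where a: "\<And>t. a \<le> t \<Longrightarrow> W t * U t > 0" "\<And>t. a \<le> t \<Longrightarrow> t \<in> I"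
      unfolding eventually_at_top_linorder by auto
    have mono: "(W a)\<^sup>2 \<le> (W t)\<^sup>2" if "a \<le> t" for t
    proof (rule nondecreasing_of_deriv[OF that W2])
      fix x assume x: "a \<le> x"
      show "x \<in> I" using a(2)[OF x] .
      then show "0 \<le> 2 * (r x * (W x * U x))" using a(1)[OF x] r_pos[of x] by (simp add: less_imp_le)
    qed
    have "((\<lambda>t. (W t)\<^sup>2) \<longlongrightarrow> 0\<^sup>2) at_top" by (intro tendsto_intros lims)
    then have "(W a)\<^sup>2 \<le> 0\<^sup>2"
      by (rule tendsto_lowerbound) (use mono in \<open>auto simp: eventually_at_top_linorder\<close>)
    then show False using a(1)[of a] by simp
  qed
  with ev have "eventually (\<lambda>t. W t * U t < 0) at_top" by simp
  from eventually_conj[OF this eventually_in_I]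
  obtain a where a: "\<And>t. a \<le> t \<Longrightarrow> W t * U t < 0" "\<And>t. a \<le> t \<Longrightarrow> t \<in> I"
    unfolding eventually_at_top_linorder by auto
  have "\<bar>W y\<bar> < \<bar>W x\<bar>" if "a \<le> x" "x < y" for x y
  proof -
    have "(W y)\<^sup>2 < (W x)\<^sup>2"
    proof (rule DERIV_neg_imp_decreasing[OF that(2), where f = "\<lambda>t. (W t)\<^sup>2"])
      fix z assume "x \<le> z" "z \<le> y"
      then have z: "a \<le> z" using that by simp
      have "2 * (r z * (W z * U z)) < 0" using a(1)[OF z] r_pos[OF a(2)[OF z]] by (simp add: mult_pos_neg)
      then show "\<exists>d. ((\<lambda>t. (W t)\<^sup>2) has_real_derivative d) (at z) \<and> d < 0" using W2[OF a(2)[OF z]] by blast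
    qed
    then show ?thesis by (metis abs_le_square_iff linorder_not_le)
  qed
  then have "strict_antimono_on {a..} (\<lambda>t. \<bar>W t\<bar>)" by (auto simp: monotone_on_def)
  then show ?thesis using a(2)[of a] by blast
qed

lemma WU_deriv:
  "t \<in> I \<Longrightarrow> ((\<lambda>t. W t * U t) has_real_derivative r t * (U t)\<^sup>2 + A t * (W t)\<^sup>2 - D t * (W t * U t)) (at t)"
  by (auto intro!: derivative_eq_intros W_deriv U_deriv' simp: algebra_simps power2_eq_square)

text \<open>Where \<open>W U\<close> vanishes its derivative is \<open>r U^2 + A W^2\<close>, which
  is positive, so the sign of \<open>W U\<close> settles.\<close>

lemma monotone_of_repulsive:
  assumes "eventually (\<lambda>t. U t = 0 \<longrightarrow> W t \<noteq> 0 \<longrightarrow> A t > 0) at_top"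
  shows "\<exists>t1\<in>I. strict_antimono_on {t1..} (\<lambda>t. \<bar>W t\<bar>)"
proof (rule monotone_of_sign[OF eventually_sign_of_upcrossing[OF eventually_deriv[OF WU_deriv]]])
  show "eventually (\<lambda>t. W t * U t = 0 \<longrightarrow> 0 < r t * (U t)\<^sup>2 + A t * (W t)\<^sup>2 - D t * (W t * U t)) at_top"
    using assms eventually_in_I
  proof eventually_elim
    case (elim t)
    show ?case
    proof
      assume 0: "W t * U t = 0"
      then consider "W t = 0" "U t \<noteq> 0" | "U t = 0" "W t \<noteq> 0" using WU_nonzero[OF elim(2)] by auto
      then show "0 < r t * (U t)\<^sup>2 + A t * (W t)\<^sup>2 - D t * (W t * U t)"
        using elim(1) r_pos[OF elim(2)] by cases auto
    qed
  qed
qed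

text \<open>The slope \<open>y = U / W\<close> satisfies \<open>y' = A - D y - r y^2\<close>, so the
  second assumption says that \<open>y\<close> crosses the curve \<open>- \<sigma>\<close> only
  upwards. Hence \<open>q\<close> has a strict sign eventually and \<open>W\<close> no zeros; then
  \<open>A < 0\<close> lets \<open>W U\<close> cross 0 only downwards.\<close>

lemma monotone_of_barrier:
  assumes \<sigma>: "eventually (\<lambda>t. (\<sigma> has_real_derivative \<sigma>' t) (at t)) at_top"
    and barrier: "eventually (\<lambda>t. A t + D t * \<sigma> t - r t * (\<sigma> t)\<^sup>2 + \<sigma>' t > 0) at_top"
    and neg: "\<alpha>\<^sup>2 < 1"
  shows "\<exists>t1\<in>I. strict_antimono_on {t1..} (\<lambda>t. \<bar>W t\<bar>)"
proof -
  define q where "q t = W t * (U t + \<sigma> t * W t)" for t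
  define q' where "q' t = r t * U t * (U t + \<sigma> t * W t)
    + W t * (A t * W t - D t * U t + (\<sigma>' t * W t + \<sigma> t * (r t * U t)))" for t
  have "eventually (\<lambda>t. q t > 0) at_top \<or> eventually (\<lambda>t. q t < 0) at_top"
  proof (rule eventually_sign_of_upcrossing)
    show "eventually (\<lambda>t. (q has_real_derivative q' t) (at t)) at_top"
      using \<sigma> eventually_in_I
    proof eventually_elim
      case (elim t)
      show ?case unfolding q_def q'_def
        by (rule derivative_eq_intros W_deriv[OF elim(2)] U_deriv'[OF elim(2)] elim(1) refl)+ (simp add: algebra_simps)
    qed
    show "eventually (\<lambda>t. q t = 0 \<longrightarrow> 0 < q' t) at_top"
      using barrier eventually_in_I
    proof eventually_elim
      case (elim t)
      show ?case
      proof
        assume "q t = 0"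
        then consider "W t = 0" "U t \<noteq> 0" | "U t = - (\<sigma> t * W t)" "W t \<noteq> 0"
          using WU_nonzero[OF elim(2)] by (auto simp: q_def add_eq_0_iff2)
        then show "0 < q' t"
        proof cases
          case 1
          then show ?thesis using r_pos[OF elim(2)] by (simp add: q'_def mult.assoc zero_less_mult_iff not_less less_le)
        next
          case 2
          then have "q' t = (W t)\<^sup>2 * (A t + D t * \<sigma> t - r t * (\<sigma> t)\<^sup>2 + \<sigma>' t)"
            by (simp add: q'_def algebra_simps power2_eq_square)
          then show ?thesis using elim(1) 2 by simp
        qed
      qed
    qed
  qed
  then have Wne: "eventually (\<lambda>t. W t \<noteq> 0) at_top"
    by (auto simp: q_def elim!: eventually_mono)
  have Aneg: "eventually (\<lambda>t. A t < 0) at_top" by (rule order_tendstoD(2)[OF A_lim]) (use neg in simp)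
  have "eventually (\<lambda>t. - (W t * U t) > 0) at_top \<or> eventually (\<lambda>t. - (W t * U t) < 0) at_top"
  proof (rule eventually_sign_of_upcrossing[OF eventually_deriv[OF DERIV_minus[OF WU_deriv]]])
    show "eventually (\<lambda>t. - (W t * U t) = 0 \<longrightarrow> 0 < - (r t * (U t)\<^sup>2 + A t * (W t)\<^sup>2 - D t * (W t * U t))) at_top"
      using Wne Aneg by eventually_elim (auto simp: mult_neg_pos)
  qed auto
  then show ?thesis by (intro monotone_of_sign) auto
qed

text \<open>A Lyapunov function makes \<open>W\<close> and \<open>U\<close> decay exponentially. The
  rate passes on to \<open>N\<close> and \<open>r - 1\<close> by integration from infinity, and to
  \<open>D - 1\<close> through a damped equation.\<close>

lemma exp_small_critical:
  assumes \<alpha>: "\<alpha>\<^sup>2 = 3 / 4"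
  shows "exp_small (\<lambda>t. A t + 1 / 4)" "exp_small (\<lambda>t. D t - 1)" "exp_small (\<lambda>t. r t - 1)"
proof -
  have A1: "(A \<longlongrightarrow> - (1 / 4)) at_top" using A_lim \<alpha> by simp
  \<comment> \<open>In the limit \<open>r = D = 1\<close>, \<open>A = - 1/4\<close> the mixed term
    drops out and \<open>Q' = - U^2 - W^2 / 4\<close>. Even with slightly worse constants this
    outweighs \<open>Q / 6\<close>, since \<open>Q \<le> 5/4 * W^2 + 3/2 * U^2\<close>.\<close>
  define Q where "Q t = 3 / 4 * (W t)\<^sup>2 + W t * U t + (U t)\<^sup>2" for t
  have Q_deriv: "(Q has_real_derivative (r t - 2 * D t) * (U t)\<^sup>2 + A t * (W t)\<^sup>2 + (3 / 2 * r t - D t + 2 * A t) * (W t * U t)) (at t)"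
    if "t \<in> I" for t
    unfolding Q_def
    by (rule derivative_eq_intros W_deriv[OF that] U_deriv'[OF that] refl)+ (simp add: algebra_simps power2_eq_square)
  have Q_eq: "Q t = (U t + W t / 2)\<^sup>2 + (W t)\<^sup>2 / 2" for t by (simp add: Q_def power2_eq_square algebra_simps)
  have l1: "((\<lambda>t. r t - 2 * D t) \<longlongrightarrow> 1 - 2 * 1) at_top" by (intro tendsto_intros lims D_lim)
  have l2: "((\<lambda>t. 3 / 2 * r t - D t + 2 * A t) \<longlongrightarrow> 3 / 2 * 1 - 1 + 2 * - (1 / 4)) at_top"
    by (intro tendsto_intros lims D_lim A1)
  have e1: "eventually (\<lambda>t. r t - 2 * D t < - 49 / 50) at_top" by (rule order_tendstoD(2)[OF l1]) simp
  have e2: "eventually (\<lambda>t. A t < - 23 / 100) at_top" by (rule order_tendstoD(2)[OF A1]) simp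
  have e3: "eventually (\<lambda>t. 3 / 2 * r t - D t + 2 * A t < 1 / 50) at_top" by (rule order_tendstoD(2)[OF l2]) simp
  have e4: "eventually (\<lambda>t. - 1 / 50 < 3 / 2 * r t - D t + 2 * A t) at_top" by (rule order_tendstoD(1)[OF l2]) simp
  have e5: "eventually (\<lambda>t. 1 / 2 < D t) at_top" by (rule order_tendstoD(1)[OF D_lim]) simp
  from eventually_conj[OF e1 eventually_conj[OF e2 eventually_conj[OF e3 eventually_conj[OF e4 eventually_conj[OF e5 eventually_in_I]]]]]
  obtain a where a: "\<And>t. a \<le> t \<Longrightarrow> r t - 2 * D t < - 49 / 50" "\<And>t. a \<le> t \<Longrightarrow> A t < - 23 / 100"
    "\<And>t. a \<le> t \<Longrightarrow> 3 / 2 * r t - D t + 2 * A t < 1 / 50" "\<And>t. a \<le> t \<Longrightarrow> - 1 / 50 < 3 / 2 * r t - D t + 2 * A t"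
    "\<And>t. a \<le> t \<Longrightarrow> 1 / 2 < D t" "\<And>t. a \<le> t \<Longrightarrow> t \<in> I"
    unfolding eventually_at_top_linorder by auto
  have Q_mono: "Q t * exp (t / 6) \<le> Q a * exp (a / 6)" if t: "a \<le> t" for t
  proof (rule nonincreasing_of_deriv[OF t])
    fix x assume x: "a \<le> x"
    define Q' where "Q' = (r x - 2 * D x) * (U x)\<^sup>2 + A x * (W x)\<^sup>2 + (3 / 2 * r x - D x + 2 * A x) * (W x * U x)"
    show "((\<lambda>t. Q t * exp (t / 6)) has_real_derivative (Q' + Q x / 6) * exp (x / 6)) (at x)"
      unfolding Q'_def
      by (rule DERIV_cong[OF DERIV_mult[OF Q_deriv[OF a(6)[OF x]] exp_weight_deriv]]) (simp add: algebra_simps)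
    have 1: "(r x - 2 * D x) * (U x)\<^sup>2 \<le> - 49 / 50 * (U x)\<^sup>2" using a(1)[OF x] by (intro mult_right_mono) auto
    have 2: "A x * (W x)\<^sup>2 \<le> - 23 / 100 * (W x)\<^sup>2" using a(2)[OF x] by (intro mult_right_mono) auto
    have WU: "\<bar>W x * U x\<bar> \<le> (W x)\<^sup>2 / 2 + (U x)\<^sup>2 / 2" using abs_mult_le_mean_squares[of "W x" "U x"] by (simp add: abs_mult)
    have "\<bar>(3 / 2 * r x - D x + 2 * A x) * (W x * U x)\<bar> \<le> 1 / 50 * ((W x)\<^sup>2 / 2 + (U x)\<^sup>2 / 2)"
      unfolding abs_mult[of "3 / 2 * r x - D x + 2 * A x"]
      by (intro mult_mono WU abs_leI) (use a(3,4)[OF x] in auto)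
    then have 3: "(3 / 2 * r x - D x + 2 * A x) * (W x * U x) \<le> (W x)\<^sup>2 / 100 + (U x)\<^sup>2 / 100" by (simp add: abs_le_iff)
    have 4: "Q x \<le> 5 / 4 * (W x)\<^sup>2 + 3 / 2 * (U x)\<^sup>2" using WU unfolding Q_def abs_le_iff by argo
    have "Q' + Q x / 6 \<le> 0"
      unfolding Q'_def using 1 2 3 4 zero_le_power2[of "W x"] zero_le_power2[of "U x"] by argo
    then show "(Q' + Q x / 6) * exp (x / 6) \<le> 0" by (simp add: mult_nonpos_nonneg)
  qed
  define C where "C = Q a * exp (a / 6)"
  have Q_le: "Q t \<le> C * exp (- t / 6)" if "a \<le> t" for t
    using Q_mono[OF that] by (simp add: C_def exp_minus field_simps)
  have C0: "C \<ge> 0" unfolding C_def Q_eq by simp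
  have W2_le: "(W t)\<^sup>2 \<le> 2 * C * exp (- t / 6)" if "a \<le> t" for t
    using Q_le[OF that] zero_le_power2[of "U t + W t / 2"] unfolding Q_eq by argo
  have U2_le: "(U t)\<^sup>2 \<le> 3 * C * exp (- t / 6)" if "a \<le> t" for t
  proof -
    have "(U t)\<^sup>2 \<le> 2 * (U t + W t / 2)\<^sup>2 + (W t)\<^sup>2 / 2"
      using zero_le_power2[of "U t + W t"] by (simp add: power2_eq_square algebra_simps)
    then have "(U t)\<^sup>2 \<le> 2 * (C * exp (- t / 6))"
      using Q_le[OF that] zero_le_power2[of "W t"] unfolding Q_eq by argo
    also have "\<dots> \<le> 3 * C * exp (- t / 6)" using C0 by simp
    finally show ?thesis .
  qed
  have W2s: "exp_small (\<lambda>t. (W t)\<^sup>2)"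
  proof (rule exp_small_of_le)
    show "eventually (\<lambda>t. \<bar>(W t)\<^sup>2\<bar> \<le> 2 * C * exp (- t / 6)) at_top"
      using eventually_ge_at_top[of a] by eventually_elim (use W2_le in simp)
  qed
  have U2s: "exp_small (\<lambda>t. (U t)\<^sup>2)"
  proof (rule exp_small_of_le)
    show "eventually (\<lambda>t. \<bar>(U t)\<^sup>2\<bar> \<le> 3 * C * exp (- t / 6)) at_top"
      using eventually_ge_at_top[of a] by eventually_elim (use U2_le in simp)
  qed
  have E0: "((\<lambda>t::real. exp (- t / 6)) \<longlongrightarrow> 0) at_top"
  proof -
    have "filterlim (\<lambda>t::real. 1 / 6 * t) at_top at_top"
      by (intro filterlim_tendsto_pos_mult_at_top[OF tendsto_const] filterlim_ident) simp
    then have "filterlim (\<lambda>t::real. - t / 6) at_bot at_top" by (simp add: filterlim_uminus_at_top)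
    then show ?thesis by (rule filterlim_compose[OF exp_at_bot])
  qed
  \<comment> \<open>\<open>N' \<ge> - 2 U^2 \<ge> - 6 C exp (- t / 6)\<close>, and integration from
    \<open>t\<close> to infinity, where \<open>N\<close> tends to 0, contributes a further factor
    6.\<close>
  define K where "K = 36 * C"
  have N_le: "N t \<le> K * exp (- t / 6)" if t: "a \<le> t" for t
  proof -
    define f where "f t = N t - K * exp (- t / 6)" for t
    have mono: "f t \<le> f s" if "t \<le> s" for s
    proof (rule nondecreasing_of_deriv[OF that])
      fix x assume "t \<le> x"
      then have x: "a \<le> x" using t by simp
      show "(f has_real_derivative D x * N x - 2 * (U x)\<^sup>2 - K * (- exp (- x / 6) / 6)) (at x)"
        unfolding f_def by (intro DERIV_diff DERIV_cmult N_deriv a(6) x exp_weight_deriv')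
      have "0 \<le> D x * N x" using D0[OF a(6)[OF x]] N_pos[OF a(6)[OF x]] by simp
      then show "0 \<le> D x * N x - 2 * (U x)\<^sup>2 - K * (- exp (- x / 6) / 6)"
        using U2_le[OF x] by (simp add: K_def)
    qed
    have "(f \<longlongrightarrow> 0 - K * 0) at_top" unfolding f_def by (intro tendsto_intros lims E0)
    then have "f t \<le> 0 - K * 0"
      by (rule tendsto_lowerbound) (use mono in \<open>auto simp: eventually_at_top_linorder\<close>)
    then show ?thesis by (simp add: f_def)
  qed
  have Ns: "exp_small N"
  proof (rule exp_small_of_le)
    show "eventually (\<lambda>t. \<bar>N t\<bar> \<le> K * exp (- t / 6)) at_top"
      using eventually_ge_at_top[of a] by eventually_elim (use N_le N_pos a(6) in force)
  qed
  have r_ge: "1 - r t \<le> 6 * K * exp (- t / 6)" if t: "a \<le> t" for t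
  proof -
    define f where "f t = r t + 6 * K * exp (- t / 6)" for t
    have mono: "f s \<le> f t" if "t \<le> s" for s
    proof (rule nonincreasing_of_deriv[OF that])
      fix x assume "t \<le> x"
      then have x: "a \<le> x" using t by simp
      note xI = a(6)[OF x]
      show "(f has_real_derivative r x * N x + 6 * K * (- exp (- x / 6) / 6)) (at x)"
        unfolding f_def by (intro DERIV_add DERIV_cmult r_deriv xI exp_weight_deriv')
      have "r x * N x \<le> 1 * (K * exp (- x / 6))"
        using r_le_1[OF xI] r_pos[OF xI] N_le[OF x] N_pos[OF xI] by (intro mult_mono) auto
      then show "r x * N x + 6 * K * (- exp (- x / 6) / 6) \<le> 0" by simp
    qed
    have "(f \<longlongrightarrow> 1 + 6 * K * 0) at_top" unfolding f_def by (intro tendsto_intros lims E0)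
    then have "1 + 6 * K * 0 \<le> f t"
      by (rule tendsto_upperbound) (use mono in \<open>auto simp: eventually_at_top_linorder\<close>)
    then show ?thesis by (simp add: f_def)
  qed
  show rs: "exp_small (\<lambda>t. r t - 1)"
  proof (rule exp_small_of_le)
    show "eventually (\<lambda>t. \<bar>r t - 1\<bar> \<le> 6 * K * exp (- t / 6)) at_top"
      using eventually_ge_at_top[of a] by eventually_elim (use r_ge r_le_1 a(6) in force)
  qed
  have br: "ev_bounded r" by (rule ev_bounded_tendsto[OF lims(4)])
  note bnd = ev_bounded_inverse_r br ev_bounded_W ev_bounded_D ev_bounded_intros
  have "exp_small (\<lambda>t. 1 / r t * (W t)\<^sup>2 + (1 / r t + 3 / 4) * (r t - 1))"
    by (intro exp_small_add exp_small_mult W2s rs bnd)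
  moreover have "eventually (\<lambda>t. 1 / r t * (W t)\<^sup>2 + (1 / r t + 3 / 4) * (r t - 1) = A t + 1 / 4) at_top"
    using eventually_in_I
  proof eventually_elim
    case (elim t)
    show ?case using r_pos[OF elim] by (simp add: A_def \<alpha> field_simps)
  qed
  ultimately show "exp_small (\<lambda>t. A t + 1 / 4)"
    by (rule exp_small_cong)
  \<comment> \<open>The source of the equation for \<open>D - 1\<close>: it collects
    \<open>B - 1\<close>, written through \<open>W^2\<close> and \<open>r - 1\<close>, and the terms
    \<open>2 U^2\<close> and \<open>- D N\<close>, all of them known to be small.\<close>
  define g where "g t = (1 / r t)\<^sup>2 * (((W t)\<^sup>2 - 2) * (W t)\<^sup>2) - (1 / r t)\<^sup>2 * ((r t + 1) * (r t - 1)) + 2 * (U t)\<^sup>2 - D t * N t" for t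
  have gs: "exp_small g"
    unfolding g_def by (intro exp_small_add exp_small_diff exp_small_mult W2s U2s rs Ns bnd)
  show "exp_small (\<lambda>t. D t - 1)"
  proof (rule exp_small_of_damped_ode[OF _ gs, where k = "\<lambda>t. D t + 1"])
    show "eventually (\<lambda>t. ((\<lambda>t. D t - 1) has_real_derivative g t - (D t + 1) * (D t - 1)) (at t)) at_top"
      using eventually_in_I
    proof eventually_elim
      case (elim t)
      have "B t - 1 = (1 / r t)\<^sup>2 * (((W t)\<^sup>2 - 2) * (W t)\<^sup>2) - (1 / r t)\<^sup>2 * ((r t + 1) * (r t - 1))"
        using r_pos[OF elim] by (simp add: B_def field_simps power2_eq_square)
      then have "B t + 2 * (U t)\<^sup>2 - D t * \<kappa> t = g t - (D t + 1) * (D t - 1)"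
        by (simp add: g_def D_def algebra_simps power2_eq_square)
      then show ?case using D_deriv[OF elim] by (auto intro!: derivative_eq_intros)
    qed
    show "eventually (\<lambda>t. 1 \<le> D t + 1) at_top" using eventually_in_I by eventually_elim (use D0 in auto)
  qed
qed

lemma nonoscillation:
  assumes "3 / 4 \<le> \<alpha>\<^sup>2"
  shows "\<exists>t1\<in>I. strict_antimono_on {t1..} (\<lambda>t. \<bar>W t\<bar>)"
proof -
  consider "\<alpha>\<^sup>2 = 3 / 4" | "3 / 4 < \<alpha>\<^sup>2" "\<alpha>\<^sup>2 < 1" | "\<alpha>\<^sup>2 = 1" | "\<alpha>\<^sup>2 > 1" using assms by linarith
  then show ?thesis
  proof cases
    case 1
    obtain C1 C2 C3 where C: "eventually (\<lambda>t. \<bar>A t + 1 / 4\<bar> \<le> C1 * exp (- t / 6)) at_top"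
      "eventually (\<lambda>t. \<bar>D t - 1\<bar> \<le> C2 * exp (- t / 6)) at_top" "eventually (\<lambda>t. \<bar>r t - 1\<bar> \<le> C3 * exp (- t / 6)) at_top"
      using exp_small_critical[OF 1] by (auto simp: exp_small_def)
    show ?thesis
    proof (rule monotone_of_barrier[where \<sigma> = "\<lambda>t. 1 / 2 - 1 / (2 * t)" and \<sigma>' = "\<lambda>t. 1 / (2 * t\<^sup>2)"])
      show "eventually (\<lambda>t. ((\<lambda>t. 1 / 2 - 1 / (2 * t)) has_real_derivative 1 / (2 * t\<^sup>2)) (at t)) at_top"
        using eventually_gt_at_top[of 0]
        by eventually_elim (auto intro!: derivative_eq_intros simp: field_simps power2_eq_square)
      show "eventually (\<lambda>t. A t + D t * (1 / 2 - 1 / (2 * t)) - r t * (1 / 2 - 1 / (2 * t))\<^sup>2 + 1 / (2 * t\<^sup>2) > 0) at_top"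
        using C eventually_ge_at_top[of 1] exp_decay_square_negligible[of "C1 + C2 + C3"]
      proof eventually_elim
        case (elim t)
        define \<sigma> where "\<sigma> = 1 / 2 - 1 / (2 * t)"
        have \<sigma>: "0 \<le> \<sigma>" "\<sigma> \<le> 1" using elim(4) by (auto simp: \<sigma>_def field_simps)
        \<comment> \<open>Here \<open>\<sigma> - \<sigma>^2\<close> falls short of 1/4 by
          \<open>1 / (4 t^2)\<close>, while the derivative of \<open>\<sigma>\<close> supplies twice
          as much; the difference outweighs the exponentially small errors.\<close>
        have "\<sigma> - \<sigma>\<^sup>2 - 1 / 4 = - (1 / (4 * t\<^sup>2))" using elim(4) by (simp add: \<sigma>_def field_simps power2_eq_square)
        moreover have "1 / (2 * t\<^sup>2) = 2 * (1 / (4 * t\<^sup>2))" by simp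
        moreover have "A t + D t * \<sigma> - r t * \<sigma>\<^sup>2 + 1 / (2 * t\<^sup>2)
            = (A t + 1 / 4) + (D t - 1) * \<sigma> - (r t - 1) * \<sigma>\<^sup>2 + (\<sigma> - \<sigma>\<^sup>2 - 1 / 4) + 1 / (2 * t\<^sup>2)"
          by (simp add: algebra_simps)
        moreover have "\<bar>(D t - 1) * \<sigma>\<bar> \<le> C2 * exp (- t / 6) * 1"
          unfolding abs_mult using elim(2) \<sigma> by (intro mult_mono) auto
        moreover have "\<bar>(r t - 1) * \<sigma>\<^sup>2\<bar> \<le> C3 * exp (- t / 6) * 1"
          unfolding abs_mult using elim(3) \<sigma> by (intro mult_mono) (auto simp: power_le_one)
        moreover have "(C1 + C2 + C3) * exp (- t / 6) = C1 * exp (- t / 6) + C2 * exp (- t / 6) + C3 * exp (- t / 6)"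
          by (simp add: distrib_right)
        ultimately show ?case unfolding \<sigma>_def[symmetric] using elim(1,5) by linarith
      qed
    qed (use 1 in simp)
  next
    case 2
    \<comment> \<open>The value 1/2 maximises \<open>\<sigma> - \<sigma>^2\<close>, and the barrier
      expression then tends to \<open>\<alpha>^2 - 3/4 > 0\<close>.\<close>
    show ?thesis
    proof (rule monotone_of_barrier[where \<sigma> = "\<lambda>t. 1 / 2" and \<sigma>' = "\<lambda>t. 0"])
      have "((\<lambda>t. A t + D t * (1 / 2) - r t * (1 / 2)\<^sup>2 + 0) \<longlongrightarrow> - (1 - \<alpha>\<^sup>2) + 1 * (1 / 2) - 1 * (1 / 2)\<^sup>2 + 0) at_top"
        by (intro tendsto_intros A_lim D_lim lims)
      then show "eventually (\<lambda>t. A t + D t * (1 / 2) - r t * (1 / 2)\<^sup>2 + 0 > 0) at_top"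
        by (rule order_tendstoD) (use 2 in \<open>simp add: power2_eq_square\<close>)
    qed (use 2 in auto)
  next
    case 3
    have "((\<lambda>t. (W t)\<^sup>2) \<longlongrightarrow> 0\<^sup>2) at_top" by (intro tendsto_intros lims)
    then have "eventually (\<lambda>t. (W t)\<^sup>2 < 1) at_top" by (rule order_tendstoD) simp
    then have "eventually (\<lambda>t. U t = 0 \<longrightarrow> W t \<noteq> 0 \<longrightarrow> A t > 0) at_top"
      using eventually_in_I
    proof eventually_elim
      case (elim t)
      show ?case
      proof (intro impI)
        assume U: "U t = 0" and W: "W t \<noteq> 0"
        \<comment> \<open>\<open>A\<close> has the sign of \<open>r^2 - m\<close>. At a zero of
          \<open>U\<close> the constraint gives \<open>B < 1 - 2 W^2 < m\<close>, and together with
          \<open>B r^2 = m^2\<close> this means \<open>r^2 > m\<close>.\<close>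
        define m where "m = 1 - (W t)\<^sup>2"
        have m0: "m > 0" using elim(1) by (simp add: m_def)
        have rt: "r t > 0" using r_pos[OF elim(2)] .
        have Bm: "B t * (r t)\<^sup>2 = m\<^sup>2" using rt by (simp add: B_def m_def)
        have "N t * N t < 2 * \<kappa> t * N t"
          using N_pos[OF elim(2)] D_nonneg[OF elim(2)] by (intro mult_strict_right_mono) auto
        then have "B t < 1 - 2 * (W t)\<^sup>2"
          using constraint[OF elim(2)] U 3 by (simp add: power2_eq_square)
        also have "\<dots> < m" using W by (simp add: m_def)
        finally have Bl: "B t < m" .
        have "m < (r t)\<^sup>2"
        proof (rule ccontr)
          assume "\<not> m < (r t)\<^sup>2"
          then have "B t * (r t)\<^sup>2 \<le> B t * m" using B_nonneg by (intro mult_left_mono) auto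
          also have "\<dots> < m * m" using Bl m0 by simp
          finally show False using Bm by (simp add: power2_eq_square)
        qed
        moreover have "A t = ((r t)\<^sup>2 - m) / r t" using rt 3 by (simp add: A_def m_def field_simps power2_eq_square)
        ultimately show "A t > 0" using rt by simp
      qed
    qed
    then show ?thesis by (rule monotone_of_repulsive)
  next
    case 4
    have "eventually (\<lambda>t. A t > 0) at_top" by (rule order_tendstoD(1)[OF A_lim]) (use 4 in simp)
    then show ?thesis by (intro monotone_of_repulsive) (auto elim: eventually_mono)
  qed
qed

end

section \<open>Boundary conditions\<close>

lemma tendsto_of_bigo_power:
  fixes f g :: "real \<Rightarrow> real"
  assumes "(\<lambda>\<tau>. f \<tau> - g \<tau>) \<in> O[at_right 0](\<lambda>\<tau>. \<tau> ^ n)" "n > 0" "(g \<longlongrightarrow> l) (at_right 0)"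
  shows "(f \<longlongrightarrow> l) (at_right 0)"
proof -
  obtain c where c: "eventually (\<lambda>\<tau>. norm (f \<tau> - g \<tau>) \<le> c * norm (\<tau> ^ n)) (at_right 0)"
    using assms(1) by (rule landau_o.bigE)
  have "((\<lambda>\<tau>::real. c * norm (\<tau> ^ n)) \<longlongrightarrow> c * norm (0 ^ n :: real)) (at_right 0)"
    by (intro tendsto_intros)
  then have "((\<lambda>\<tau>::real. c * norm (\<tau> ^ n)) \<longlongrightarrow> 0) (at_right 0)" using assms(2) by (simp add: power_0_left)
  then have "((\<lambda>\<tau>. f \<tau> - g \<tau>) \<longlongrightarrow> 0) (at_right 0)" by (rule Lim_null_comparison[OF c])
  then have "((\<lambda>\<tau>. f \<tau> - g \<tau> + g \<tau>) \<longlongrightarrow> 0 + l) (at_right 0)" by (intro tendsto_intros assms(3))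
  then show ?thesis by simp
qed

lemma set_integrable_bounded_continuous:
  fixes f :: "real \<Rightarrow> real"
  assumes "continuous_on {a<..<b} f" "\<And>x. a < x \<Longrightarrow> x < b \<Longrightarrow> \<bar>f x\<bar> \<le> K"
  shows "set_integrable lborel {a<..<b} f"
proof -
  let ?g = "\<lambda>x. indicator {a<..<b} x *\<^sub>R f x"
  have "integrable lborel (\<lambda>x. indicator {a<..<b} x *\<^sub>R ?g x)"
  proof (rule integrableI_bounded_set_indicator[where B = K])
    show "?g \<in> borel_measurable lborel"
      using borel_measurable_continuous_on_indicator[OF _ assms(1)] by simp
    show "emeasure lborel {a<..<b} < \<infinity>" by (rule emeasure_bounded_finite) simp
    show "AE x in lborel. x \<in> {a<..<b} \<longrightarrow> norm (?g x) \<le> K" using assms(2) by (auto simp: indicator_def)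
  qed simp
  moreover have "(\<lambda>x. indicator {a<..<b} x *\<^sub>R ?g x) = ?g" by (auto simp: indicator_def)
  ultimately show ?thesis unfolding set_integrable_def by simp
qed

section \<open>The left end of the interval\<close>

context eymh
begin

text \<open>A common form of being close to the left end, for \<open>a = -\<infinity>\<close> and
  \<open>a = 0\<close> alike.\<close>

definition initially :: "(real \<Rightarrow> bool) \<Rightarrow> bool" where
  "initially P \<longleftrightarrow> (\<exists>s\<in>I. \<forall>\<tau>\<in>I. \<tau> \<le> s \<longrightarrow> P \<tau>)"

lemma initially_imp_ex: "initially P \<Longrightarrow> \<exists>s\<in>I. P s"
  by (auto simp: initially_def)

lemma D_nonneg_of_initially:
  assumes "initially (\<lambda>\<tau>. N \<tau> \<le> \<kappa> \<tau>)" and \<tau>: "\<tau> \<in> I"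
  shows "N \<tau> \<le> \<kappa> \<tau>"
proof -
  obtain s where s: "s \<in> I" "\<And>x. x \<in> I \<Longrightarrow> x \<le> s \<Longrightarrow> N x \<le> \<kappa> x" using assms(1) by (auto simp: initially_def)
  show ?thesis
  proof (cases "\<tau> \<le> s")
    case False
    then show ?thesis using D_nonneg_forward[of s \<tau>] s \<tau> by (simp add: D_def)
  qed (use s \<tau> in auto)
qed

lemma initially_at_bot:
  assumes a: "a = -\<infinity>" and "eventually P at_bot" shows "initially P"
proof -
  obtain b where b: "\<And>x. x \<le> b \<Longrightarrow> P x" using assms(2) by (auto simp: eventually_at_bot_linorder)
  obtain t where t: "t \<in> I" using einterval_nonempty[OF a_less_T] by (auto simp: einterval_def)
  have "min b t \<in> I" using t a by (auto simp: einterval_def min_def) (meson ereal_less_eq(3) le_less_trans linear)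
  then show ?thesis unfolding initially_def using b by (intro bexI[of _ "min b t"]) auto
qed

lemma eventually_in_I_at_bot:
  assumes a: "a = -\<infinity>" shows "eventually (\<lambda>t. t \<in> I) at_bot"
proof -
  obtain t where t: "t \<in> I" using einterval_nonempty[OF a_less_T] by (auto simp: einterval_def)
  have "x \<in> I" if "x \<le> t" for x
    using t a that by (auto simp: einterval_def) (meson ereal_less_eq(3) le_less_trans)
  then show ?thesis by (auto simp: eventually_at_bot_linorder)
qed

lemma initially_at_right_0:
  assumes a: "a = 0" and "eventually P (at_right 0)" shows "initially P"
proof -
  obtain b where b: "b > 0" "\<And>x. 0 < x \<Longrightarrow> x < b \<Longrightarrow> P x" using assms(2) by (auto simp: eventually_at_right_field)
  obtain t where t: "t \<in> I" using einterval_nonempty[OF a_less_T] by (auto simp: einterval_def)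
  then have t0: "t > 0" using a by (auto simp: einterval_def)
  define s where "s = min (b / 2) t"
  have s: "0 < s" "s < b" "s \<le> t" using b(1) t0 by (auto simp: s_def)
  then have "s \<in> I" using t a by (auto simp: einterval_def) (meson ereal_less_eq(3) le_less_trans)
  moreover have "P x" if "x \<in> I" "x \<le> s" for x
    using that b(2)[of x] s a by (auto simp: einterval_def)
  ultimately show ?thesis unfolding initially_def by blast
qed

lemma eventually_in_I_at_right_0:
  assumes a: "a = 0" shows "eventually (\<lambda>t. t \<in> I) (at_right 0)"
proof -
  obtain t where t: "t \<in> I" using einterval_nonempty[OF a_less_T] by (auto simp: einterval_def)
  then have t0: "t > 0" using a by (auto simp: einterval_def)
  have "x \<in> I" if "0 < x" "x < t" for x
    using t a that by (auto simp: einterval_def) (meson ereal_less_eq(3) less_imp_le le_less_trans)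
  then show ?thesis using t0 by (auto simp: eventually_at_right_field)
qed

text \<open>\<open>N\<close> and \<open>\<kappa>\<close> have the same limit, so the sign of
  \<open>D\<close> is not visible there. But if \<open>D < 0\<close> somewhere, then also at all
  earlier times; where \<open>\<kappa> > 0\<close> this makes \<open>D\<close> nondecreasing, so
  starting from the limit 0 it could not have become negative.\<close>

lemma quasi_regular_subcritical:
  assumes a: "a = -\<infinity>" and \<alpha>: "0 \<le> \<alpha>" "\<alpha> < 1 / sqrt 2"
    and lims: "(r \<longlongrightarrow> 0) at_bot" "((\<lambda>\<tau>. (W \<tau> - 1) / r \<tau>) \<longlongrightarrow> 0) at_bot"
      "(N \<longlongrightarrow> sqrt (1 - 2 * \<alpha>\<^sup>2)) at_bot" "(\<kappa> \<longlongrightarrow> sqrt (1 - 2 * \<alpha>\<^sup>2)) at_bot"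
  shows "initially (\<lambda>\<tau>. N \<tau> > sqrt (1 - 2 * \<alpha>\<^sup>2) / 2)" "0 < sqrt (1 - 2 * \<alpha>\<^sup>2)"
    "\<tau> \<in> I \<Longrightarrow> N \<tau> \<le> \<kappa> \<tau>" "\<exists>s\<in>I. W s \<noteq> 0" "\<alpha>\<^sup>2 < 1 / 2"
proof -
  have "\<alpha>\<^sup>2 < (1 / sqrt 2)\<^sup>2" using \<alpha> by (intro power_strict_mono) auto
  then show \<alpha>2: "\<alpha>\<^sup>2 < 1 / 2" by (simp add: power_divide)
  define c where "c = sqrt (1 - 2 * \<alpha>\<^sup>2)"
  have c0: "c > 0" using \<alpha>2 by (simp add: c_def)
  then show "0 < sqrt (1 - 2 * \<alpha>\<^sup>2)" by (simp add: c_def)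
  show "initially (\<lambda>\<tau>. N \<tau> > sqrt (1 - 2 * \<alpha>\<^sup>2) / 2)"
    by (rule initially_at_bot[OF a order_tendstoD(1)[OF lims(3)]]) (use c0 in \<open>simp add: c_def\<close>)
  have "((\<lambda>\<tau>. (W \<tau> - 1) / r \<tau> * r \<tau>) \<longlongrightarrow> 0 * 0) at_bot" by (intro tendsto_intros lims)
  moreover have "eventually (\<lambda>\<tau>. (W \<tau> - 1) / r \<tau> * r \<tau> = W \<tau> - 1) at_bot"
    using eventually_in_I_at_bot[OF a] by eventually_elim (use r_pos in force)
  ultimately have "((\<lambda>\<tau>. W \<tau> - 1) \<longlongrightarrow> 0) at_bot" by (rule tendsto_eventually_eq) simp
  then have "(W \<longlongrightarrow> 1) at_bot" by (simp add: LIM_zero_iff)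
  then have "eventually (\<lambda>\<tau>. W \<tau> > 0) at_bot" by (rule order_tendstoD) simp
  then show "\<exists>s\<in>I. W s \<noteq> 0" using initially_imp_ex[OF initially_at_bot[OF a]] by force
  show "N \<tau> \<le> \<kappa> \<tau>" if \<tau>: "\<tau> \<in> I"
  proof (rule ccontr)
    assume "\<not> N \<tau> \<le> \<kappa> \<tau>"
    then have neg: "D \<tau> < 0" by (simp add: D_def)
    have "initially (\<lambda>\<tau>. \<kappa> \<tau> > 0)"
      by (rule initially_at_bot[OF a order_tendstoD(1)[OF lims(4)]]) (use c0 in \<open>simp add: c_def\<close>)
    then obtain s where s: "s \<in> I" "\<And>x. x \<in> I \<Longrightarrow> x \<le> s \<Longrightarrow> \<kappa> x > 0" by (auto simp: initially_def)
    define t where "t = min s \<tau>"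
    have t: "t \<in> I" "t \<le> s" "t \<le> \<tau>" using s \<tau> by (auto simp: t_def min_def)
    have mem: "x \<in> I" if "x \<le> t" for x
      using t(1) a that by (auto simp: einterval_def) (meson ereal_less_eq(3) le_less_trans)
    have Dneg: "D x < 0" if "x \<le> t" for x using D_neg_backward[OF mem[OF that] \<tau> _ neg] that t(3) by simp
    have "D x \<le> D t" if "x \<le> t" for x
    proof (rule nondecreasing_of_deriv[OF that D_deriv])
      fix y assume y: "y \<le> t"
      show "y \<in> I" using mem[OF y] .
      have "D y * \<kappa> y \<le> 0" using Dneg[OF y] s(2)[OF mem[OF y]] y t(2) by (simp add: mult_le_0_iff)
      then show "0 \<le> B y + 2 * (U y)\<^sup>2 - D y * \<kappa> y"
        using B_nonneg[of y] zero_le_power2[of "U y"] by linarith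
    qed
    moreover have "((\<lambda>x. \<kappa> x - N x) \<longlongrightarrow> c - c) at_bot" unfolding c_def by (intro tendsto_intros lims)
    then have "(D \<longlongrightarrow> 0) at_bot" by (simp add: D_def[abs_def])
    ultimately have "0 \<le> D t" by (intro tendsto_upperbound[of D 0 at_bot]) (auto simp: eventually_at_bot_linorder)
    then show False using Dneg[of t] by simp
  qed
qed

lemma quasi_regular_critical:
  assumes a: "a = -\<infinity>" and \<alpha>: "\<alpha> = 1 / sqrt 2"
    and r0: "(r \<longlongrightarrow> 0) at_bot" and W: "(\<lambda>\<tau>. W \<tau> - (1 - (r \<tau>)\<^sup>2 / 4)) \<in> o[at_bot](\<lambda>\<tau>. (r \<tau>)\<^sup>2)"
    and N: "(\<lambda>\<tau>. N \<tau> - r \<tau> / sqrt 12) \<in> o[at_bot](\<lambda>\<tau>. (r \<tau>)\<^sup>2)"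
  shows "initially (\<lambda>\<tau>. N \<tau> > 0)" "initially (\<lambda>\<tau>. N \<tau> \<le> \<kappa> \<tau>)" "\<exists>s\<in>I. W s \<noteq> 0" "2 * \<alpha>\<^sup>2 = 1"
proof -
  show \<alpha>2: "2 * \<alpha>\<^sup>2 = 1" using \<alpha> by (simp add: power_divide)
  note inI = eventually_in_I_at_bot[OF a]
  have "((\<lambda>\<tau>. (W \<tau> - (1 - (r \<tau>)\<^sup>2 / 4)) / (r \<tau>)\<^sup>2) \<longlongrightarrow> 0) at_bot" by (rule smalloD_tendsto[OF W])
  then have "((\<lambda>\<tau>. 1 / 4 - (W \<tau> - (1 - (r \<tau>)\<^sup>2 / 4)) / (r \<tau>)\<^sup>2) \<longlongrightarrow> 1 / 4 - 0) at_bot" by (intro tendsto_intros)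
  moreover have "eventually (\<lambda>\<tau>. 1 / 4 - (W \<tau> - (1 - (r \<tau>)\<^sup>2 / 4)) / (r \<tau>)\<^sup>2 = (1 - W \<tau>) / (r \<tau>)\<^sup>2) at_bot"
    using inI by eventually_elim (use r_pos in \<open>force simp: field_simps\<close>)
  ultimately have W1: "((\<lambda>\<tau>. (1 - W \<tau>) / (r \<tau>)\<^sup>2) \<longlongrightarrow> 1 / 4) at_bot" by (rule tendsto_eventually_eq) simp
  have "((\<lambda>\<tau>. 1 - (1 - W \<tau>) / (r \<tau>)\<^sup>2 * (r \<tau>)\<^sup>2) \<longlongrightarrow> 1 - 1 / 4 * 0\<^sup>2) at_bot" by (intro tendsto_intros W1 r0)
  moreover have "eventually (\<lambda>\<tau>. 1 - (1 - W \<tau>) / (r \<tau>)\<^sup>2 * (r \<tau>)\<^sup>2 = W \<tau>) at_bot"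
    using inI by eventually_elim (use r_pos in force)
  ultimately have Wlim: "(W \<longlongrightarrow> 1) at_bot" by (rule tendsto_eventually_eq) simp
  then have "eventually (\<lambda>\<tau>. W \<tau> > 0) at_bot" by (rule order_tendstoD) simp
  then show "\<exists>s\<in>I. W s \<noteq> 0" using initially_imp_ex[OF initially_at_bot[OF a]] by force
  have "((\<lambda>\<tau>. (N \<tau> - r \<tau> / sqrt 12) / (r \<tau>)\<^sup>2) \<longlongrightarrow> 0) at_bot" by (rule smalloD_tendsto[OF N])
  then have "((\<lambda>\<tau>. (N \<tau> - r \<tau> / sqrt 12) / (r \<tau>)\<^sup>2 * r \<tau> + 1 / sqrt 12) \<longlongrightarrow> 0 * 0 + 1 / sqrt 12) at_bot"
    by (intro tendsto_add tendsto_mult r0 tendsto_const)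
  moreover have "eventually (\<lambda>\<tau>. (N \<tau> - r \<tau> / sqrt 12) / (r \<tau>)\<^sup>2 * r \<tau> + 1 / sqrt 12 = N \<tau> / r \<tau>) at_bot"
    using inI
  proof eventually_elim
    case (elim \<tau>)
    then show ?case using r_pos[OF elim] by (simp add: field_simps power2_eq_square)
  qed
  ultimately have N1: "((\<lambda>\<tau>. N \<tau> / r \<tau>) \<longlongrightarrow> 1 / sqrt 12) at_bot" by (rule tendsto_eventually_eq) simp
  then have "eventually (\<lambda>\<tau>. N \<tau> / r \<tau> > 0) at_bot" by (rule order_tendstoD) simp
  then have Npos: "eventually (\<lambda>\<tau>. N \<tau> > 0) at_bot"
    using inI by eventually_elim (use r_pos in \<open>force simp: zero_less_divide_iff\<close>)
  then show "initially (\<lambda>\<tau>. N \<tau> > 0)" by (rule initially_at_bot[OF a])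
  \<comment> \<open>The constraint is compared at order \<open>r^2\<close>: \<open>x\<close> is
    \<open>(1 - W^2) / r^2\<close> and tends to 1/2, so \<open>x - x^2 - (N / r)^2\<close> tends to
    1/2 - 1/4 - 1/12 = 1/6. Multiplied by \<open>r^2\<close> it is, up to a term
    \<open>2 U^2 \<ge> 0\<close>, the surplus of \<open>2 \<kappa> N\<close> over
    \<open>2 N^2\<close>.\<close>
  define x where "x \<tau> = (1 - W \<tau>) / (r \<tau>)\<^sup>2 * (1 + W \<tau>)" for \<tau>
  have "((\<lambda>\<tau>. x \<tau> - (x \<tau>)\<^sup>2 - (N \<tau> / r \<tau>)\<^sup>2) \<longlongrightarrow> 1 / 4 * (1 + 1) - (1 / 4 * (1 + 1))\<^sup>2 - (1 / sqrt 12)\<^sup>2) at_bot"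
    unfolding x_def by (intro tendsto_intros W1 Wlim N1)
  then have "eventually (\<lambda>\<tau>. x \<tau> - (x \<tau>)\<^sup>2 - (N \<tau> / r \<tau>)\<^sup>2 > 0) at_bot"
    by (rule order_tendstoD) (simp add: power_divide)
  then have "eventually (\<lambda>\<tau>. N \<tau> \<le> \<kappa> \<tau>) at_bot"
    using inI Npos
  proof eventually_elim
    case (elim \<tau>)
    have rt: "r \<tau> > 0" using r_pos[OF elim(2)] .
    have xr: "x \<tau> * (r \<tau>)\<^sup>2 = 1 - (W \<tau>)\<^sup>2" using rt by (simp add: x_def field_simps power2_eq_square)
    have "(x \<tau>)\<^sup>2 * (r \<tau>)\<^sup>2 = (x \<tau> * (r \<tau>)\<^sup>2)\<^sup>2 / (r \<tau>)\<^sup>2" using rt by (simp add: power2_eq_square)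
    then have Br: "(x \<tau>)\<^sup>2 * (r \<tau>)\<^sup>2 = B \<tau>" unfolding xr B_def .
    have "(x \<tau> - (x \<tau>)\<^sup>2 - (N \<tau> / r \<tau>)\<^sup>2) * (r \<tau>)\<^sup>2 > 0" using elim(1) rt by simp
    moreover have "(x \<tau> - (x \<tau>)\<^sup>2 - (N \<tau> / r \<tau>)\<^sup>2) * (r \<tau>)\<^sup>2 = (1 - (W \<tau>)\<^sup>2) - B \<tau> - (N \<tau>)\<^sup>2"
      using xr Br rt by (simp add: left_diff_distrib power_divide)
    moreover have "2 * \<alpha>\<^sup>2 * (W \<tau>)\<^sup>2 = (W \<tau>)\<^sup>2" using \<alpha>2 by simp
    ultimately have "2 * (N \<tau>)\<^sup>2 \<le> 2 * \<kappa> \<tau> * N \<tau>"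
      using constraint[OF elim(2)] zero_le_power2[of "U \<tau>"] by linarith
    then show "N \<tau> \<le> \<kappa> \<tau>" using elim(3) by (simp add: power2_eq_square)
  qed
  then show "initially (\<lambda>\<tau>. N \<tau> \<le> \<kappa> \<tau>)" by (rule initially_at_bot[OF a])
qed

lemma horizon_start:
  assumes a: "a = 0" and h: "regular_horizon \<alpha> r\<^sub>h W\<^sub>h r N \<kappa> W U"
  shows "initially (\<lambda>\<tau>. N \<tau> > 0)" "initially (\<lambda>\<tau>. N \<tau> \<le> \<kappa> \<tau>)"
    "\<exists>s\<in>I. 2 * \<alpha>\<^sup>2 - 1 < \<alpha> ^ 4 * (r s)\<^sup>2" "(\<forall>\<tau>\<in>I. W \<tau> = 0) \<Longrightarrow> \<exists>s\<in>I. r s > 1"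
proof -
  define N1 where "N1 = horizon_N1 \<alpha> r\<^sub>h W\<^sub>h"
  have rh: "r\<^sub>h > 0" and N1: "N1 > 0" using h by (auto simp: regular_horizon_def N1_def)
  have N1_eq: "2 * N1 = 1 - (1 - W\<^sub>h\<^sup>2)\<^sup>2 / r\<^sub>h\<^sup>2 - 2 * \<alpha>\<^sup>2 * W\<^sub>h\<^sup>2" by (simp add: N1_def horizon_N1_def)
  note inI = eventually_in_I_at_right_0[OF a]
  have id0: "((\<lambda>\<tau>::real. \<tau>) \<longlongrightarrow> 0) (at_right 0)" by (rule tendsto_ident_at)
  have "((\<lambda>\<tau>. r\<^sub>h * (1 + N1 * (\<tau>\<^sup>2 / 2))) \<longlongrightarrow> r\<^sub>h * (1 + N1 * (0\<^sup>2 / 2))) (at_right 0)" by (intro tendsto_intros) simp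
  then have "(r \<longlongrightarrow> r\<^sub>h * (1 + N1 * (0\<^sup>2 / 2))) (at_right 0)"
    by (rule tendsto_of_bigo_power[rotated 2]) (use h in \<open>auto simp: regular_horizon_def N1_def\<close>)
  then have r: "(r \<longlongrightarrow> r\<^sub>h) (at_right 0)" by simp
  have "((\<lambda>\<tau>. W\<^sub>h + r\<^sub>h * horizon_W1 \<alpha> r\<^sub>h W\<^sub>h * (\<tau>\<^sup>2 / 2)) \<longlongrightarrow> W\<^sub>h + r\<^sub>h * horizon_W1 \<alpha> r\<^sub>h W\<^sub>h * (0\<^sup>2 / 2)) (at_right 0)"
    by (intro tendsto_intros) simp
  then have "(W \<longlongrightarrow> W\<^sub>h + r\<^sub>h * horizon_W1 \<alpha> r\<^sub>h W\<^sub>h * (0\<^sup>2 / 2)) (at_right 0)"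
    by (rule tendsto_of_bigo_power[rotated 2]) (use h in \<open>auto simp: regular_horizon_def\<close>)
  then have W: "(W \<longlongrightarrow> W\<^sub>h) (at_right 0)" by simp
  have "((\<lambda>\<tau>. horizon_W1 \<alpha> r\<^sub>h W\<^sub>h * \<tau>) \<longlongrightarrow> horizon_W1 \<alpha> r\<^sub>h W\<^sub>h * 0) (at_right 0)" by (intro tendsto_intros)
  then have "(U \<longlongrightarrow> horizon_W1 \<alpha> r\<^sub>h W\<^sub>h * 0) (at_right 0)"
    by (rule tendsto_of_bigo_power[rotated 2]) (use h in \<open>auto simp: regular_horizon_def\<close>)
  then have U: "(U \<longlongrightarrow> 0) (at_right 0)" by simp
  have NO: "(\<lambda>\<tau>. N \<tau> - N1 * \<tau>) \<in> O[at_right 0](\<lambda>\<tau>. \<tau> ^ 3)" using h by (simp add: regular_horizon_def N1_def)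
  have "((\<lambda>\<tau>. N1 * \<tau>) \<longlongrightarrow> N1 * 0) (at_right 0)" by (intro tendsto_intros)
  then have "(N \<longlongrightarrow> N1 * 0) (at_right 0)" by (rule tendsto_of_bigo_power[OF NO, rotated]) simp
  then have N: "(N \<longlongrightarrow> 0) (at_right 0)" by simp
  have Npos: "eventually (\<lambda>\<tau>. N \<tau> > 0) (at_right 0)"
  proof -
    obtain c where c: "c > 0" "eventually (\<lambda>\<tau>. norm (N \<tau> - N1 * \<tau>) \<le> c * norm (\<tau> ^ 3)) (at_right 0)"
      using NO by (rule landau_o.bigE)
    have "((\<lambda>\<tau>. N1 - c * \<tau>\<^sup>2) \<longlongrightarrow> N1 - c * 0\<^sup>2) (at_right 0)" by (intro tendsto_intros)
    then have "eventually (\<lambda>\<tau>. N1 - c * \<tau>\<^sup>2 > 0) (at_right 0)" by (rule order_tendstoD) (use N1 in simp)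
    moreover have "eventually (\<lambda>\<tau>::real. \<tau> > 0) (at_right 0)" by (rule eventually_at_right_less)
    ultimately show ?thesis using c(2)
    proof eventually_elim
      case (elim \<tau>)
      have "0 < \<tau> * (N1 - c * \<tau>\<^sup>2)" using elim by simp
      also have "\<dots> = N1 * \<tau> - c * \<tau> ^ 3" by (simp add: algebra_simps power2_eq_square power3_eq_cube)
      also have "\<dots> \<le> N \<tau>" using elim(2,3) by (simp add: abs_le_iff)
      finally show ?case .
    qed
  qed
  then show "initially (\<lambda>\<tau>. N \<tau> > 0)" by (rule initially_at_right_0[OF a])
  \<comment> \<open>By the constraint this is \<open>2 N (\<kappa> - N)\<close>, and its limit is
    \<open>2 N1 > 0\<close>.\<close>
  have "((\<lambda>\<tau>. 1 + (N \<tau>)\<^sup>2 + 2 * (U \<tau>)\<^sup>2 - (1 - (W \<tau>)\<^sup>2)\<^sup>2 / (r \<tau>)\<^sup>2 - 2 * \<alpha>\<^sup>2 * (W \<tau>)\<^sup>2 - 2 * (N \<tau>)\<^sup>2) \<longlongrightarrow>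
      1 + 0\<^sup>2 + 2 * 0\<^sup>2 - (1 - W\<^sub>h\<^sup>2)\<^sup>2 / r\<^sub>h\<^sup>2 - 2 * \<alpha>\<^sup>2 * W\<^sub>h\<^sup>2 - 2 * 0\<^sup>2) (at_right 0)"
    by (intro tendsto_intros r W U N) (use rh in simp)
  then have "eventually (\<lambda>\<tau>. 1 + (N \<tau>)\<^sup>2 + 2 * (U \<tau>)\<^sup>2 - (1 - (W \<tau>)\<^sup>2)\<^sup>2 / (r \<tau>)\<^sup>2 - 2 * \<alpha>\<^sup>2 * (W \<tau>)\<^sup>2 - 2 * (N \<tau>)\<^sup>2 > 0) (at_right 0)"
    by (rule order_tendstoD) (use N1 N1_eq in simp)
  then have "eventually (\<lambda>\<tau>. N \<tau> \<le> \<kappa> \<tau>) (at_right 0)"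
    using inI Npos
  proof eventually_elim
    case (elim \<tau>)
    then have "2 * (N \<tau>)\<^sup>2 \<le> 2 * \<kappa> \<tau> * N \<tau>" using constraint[OF elim(2)] by (simp add: B_def)
    then show ?case using elim(3) by (simp add: power2_eq_square)
  qed
  then show "initially (\<lambda>\<tau>. N \<tau> \<le> \<kappa> \<tau>)" by (rule initially_at_right_0[OF a])
  \<comment> \<open>Completing the square: \<open>2 N1\<close> times the squared horizon radius is
    that squared radius times a bracket, minus the square of 1 - W_h^2 - \<alpha>^2 r_h^2. So the
    bracket 1 - 2 \<alpha>^2 + \<alpha>^4 r_h^2 is positive.\<close>
  have "2 * \<alpha>\<^sup>2 - 1 < \<alpha> ^ 4 * r\<^sub>h\<^sup>2"
  proof -
    have "0 < 1 - (1 - W\<^sub>h\<^sup>2)\<^sup>2 / r\<^sub>h\<^sup>2 - 2 * \<alpha>\<^sup>2 * W\<^sub>h\<^sup>2" using N1 N1_eq by simp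
    then have "0 < r\<^sub>h\<^sup>2 * (1 - (1 - W\<^sub>h\<^sup>2)\<^sup>2 / r\<^sub>h\<^sup>2 - 2 * \<alpha>\<^sup>2 * W\<^sub>h\<^sup>2)" using rh by simp
    also have "\<dots> = r\<^sub>h\<^sup>2 - (1 - W\<^sub>h\<^sup>2)\<^sup>2 - 2 * \<alpha>\<^sup>2 * W\<^sub>h\<^sup>2 * r\<^sub>h\<^sup>2" using rh by (simp add: right_diff_distrib)
    also have "\<dots> = r\<^sub>h\<^sup>2 * (1 - 2 * \<alpha>\<^sup>2 + \<alpha> ^ 4 * r\<^sub>h\<^sup>2) - ((1 - W\<^sub>h\<^sup>2) - \<alpha>\<^sup>2 * r\<^sub>h\<^sup>2)\<^sup>2"
      by (simp add: algebra_simps power2_eq_square eval_nat_numeral)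
    finally have "0 < r\<^sub>h\<^sup>2 * (1 - 2 * \<alpha>\<^sup>2 + \<alpha> ^ 4 * r\<^sub>h\<^sup>2)" by (smt (verit) zero_le_power2)
    then show ?thesis using rh by (simp add: zero_less_mult_iff)
  qed
  moreover have "((\<lambda>\<tau>. \<alpha> ^ 4 * (r \<tau>)\<^sup>2) \<longlongrightarrow> \<alpha> ^ 4 * r\<^sub>h\<^sup>2) (at_right 0)" by (intro tendsto_intros r)
  ultimately have "eventually (\<lambda>\<tau>. 2 * \<alpha>\<^sup>2 - 1 < \<alpha> ^ 4 * (r \<tau>)\<^sup>2) (at_right 0)" by (intro order_tendstoD)
  then show "\<exists>s\<in>I. 2 * \<alpha>\<^sup>2 - 1 < \<alpha> ^ 4 * (r s)\<^sup>2" using initially_imp_ex[OF initially_at_right_0[OF a]] by blast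
  \<comment> \<open>Then W_h = 0, and the condition \<open>N1 > 0\<close> reads r_h > 1.\<close>
  assume W0: "\<forall>\<tau>\<in>I. W \<tau> = 0"
  have "(W \<longlongrightarrow> 0) (at_right 0)"
    by (rule tendsto_eventually) (use inI W0 in \<open>auto elim!: eventually_mono\<close>)
  then have "W\<^sub>h = 0" using W tendsto_unique[OF trivial_limit_at_right_real] by blast
  then have "1 / r\<^sub>h\<^sup>2 < 1" using N1 N1_eq by simp
  then have "1\<^sup>2 < r\<^sub>h\<^sup>2" using rh by (simp add: divide_less_eq)
  then have "1 < r\<^sub>h" using rh by (intro power_less_imp_less_base[of 1 2 r\<^sub>h]) auto
  then have "eventually (\<lambda>\<tau>. 1 < r \<tau>) (at_right 0)" by (rule order_tendstoD(1)[OF r])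
  then show "\<exists>s\<in>I. r s > 1" using initially_imp_ex[OF initially_at_right_0[OF a]] by blast
qed

text \<open>Where \<open>N\<close> is bounded below by a positive constant, \<open>r\<close> is dominated by its derivative \<open>r N\<close>.\<close>

lemma set_integrable_near_minus_infinity:
  assumes a: "a = -\<infinity>" and s: "s \<in> I" and c: "c > 0" "\<And>\<tau>. \<tau> \<in> I \<Longrightarrow> \<tau> \<le> s \<Longrightarrow> c \<le> N \<tau>"
    and r: "(r \<longlongrightarrow> 0) at_bot"
  shows "set_integrable lborel (einterval (-\<infinity>) (ereal s)) r"
proof -
  have mem: "x \<in> I" if "x \<le> s" for x
    using s a that by (auto simp: einterval_def) (meson ereal_less_eq(3) le_less_trans)
  have cr: "isCont r x" "isCont N x" if "x \<le> s" for x
    using r_deriv[OF mem[OF that]] N_deriv[OF mem[OF that]] DERIV_isCont by blast+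
  have 1: "set_integrable lborel (einterval (-\<infinity>) (ereal s)) (\<lambda>x. r x * N x)"
  proof (rule interval_integral_FTC_nonneg(1)[where F = r and A = 0 and B = "r s"])
    show "((r \<circ> real_of_ereal) \<longlongrightarrow> 0) (at_right (-\<infinity>))" using r by (simp add: ereal_tendsto_simps1)
    show "((r \<circ> real_of_ereal) \<longlongrightarrow> r s) (at_left (ereal s))"
      using cr(1)[of s] by (simp add: ereal_tendsto_simps1 isCont_def filterlim_at_split)
    show "AE x in lborel. - \<infinity> < ereal x \<longrightarrow> ereal x < ereal s \<longrightarrow> 0 \<le> r x * N x"
    proof (rule AE_I2, intro impI)
      fix x assume "ereal x < ereal s"
      then have "x \<le> s" by simp
      then show "0 \<le> r x * N x" using r_pos[OF mem] c(1) c(2)[OF mem] by (intro mult_nonneg_nonneg) force+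
    qed
  qed (use mem cr in \<open>auto intro!: r_deriv continuous_intros\<close>)
  have "set_integrable lborel (einterval (-\<infinity>) (ereal s)) (\<lambda>x. 1 / c * (r x * N x))"
    by (rule set_integrable_mult_right) (rule 1)
  then show ?thesis
  proof (rule set_integrable_bound)
    have "continuous_on (einterval (-\<infinity>) (ereal s)) r"
      by (rule continuous_on_subset[OF cont(1)]) (use mem in \<open>auto simp: einterval_def\<close>)
    then show "set_borel_measurable lborel (einterval (-\<infinity>) (ereal s)) r"
      unfolding set_borel_measurable_def
      using borel_measurable_continuous_on_indicator[of "einterval (-\<infinity>) (ereal s)" r] by simp
    show "AE x in lborel. x \<in> einterval (-\<infinity>) (ereal s) \<longrightarrow> norm (r x) \<le> norm (1 / c * (r x * N x))"
    proof (rule AE_I2, intro impI)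
      fix x assume "x \<in> einterval (-\<infinity>) (ereal s)"
      then have x: "x \<le> s" by (simp add: einterval_def)
      have "r x * c \<le> r x * N x" using r_pos[OF mem[OF x]] c(2)[OF mem[OF x] x] by (intro mult_left_mono) auto
      then have "r x \<le> 1 / c * (r x * N x)" using c(1) by (simp add: field_simps)
      then show "norm (r x) \<le> norm (1 / c * (r x * N x))" 
        using r_pos[OF mem[OF x]] by (metis abs_ge_self abs_of_pos order_trans real_norm_def)
    qed
  qed
qed

end

section \<open>Classification\<close>

context eymh_flow
begin

lemma bag_of_gold_after_turning:
  assumes t0: "t0 \<in> I" "N t0 = 0"
    and start: "a = 0 \<or> a = -\<infinity> \<and> (\<alpha> = 1 / sqrt 2 \<or>
      (\<exists>s\<in>I. set_integrable lborel (einterval (-\<infinity>) (ereal s)) r))"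
  shows "bag_of_gold \<alpha> a T r N"
proof -
  obtain T' where T: "T = ereal T'" using turning_imp_T_finite[OF t0] a_less_T by (cases T) auto
  have lim_r: "(r \<longlongrightarrow> 0) (at_left T')" and lim_N: "filterlim N at_bot (at_left T')"
    using r_tendsto_0[OF t0 T] N_tendsto_minus_infinity[OF t0 T] by auto
  have integrable: "set_integrable lborel {p<..<T'} r" if "{p<..<T'} \<subseteq> I" for p
    by (rule set_integrable_bounded_continuous[where K = "r t0", OF cont_on(1)[OF that]])
      (use that r_pos r_le_turning[OF t0] in \<open>force simp: subset_eq\<close>)
  have sub: "{p<..<T'} \<subseteq> I" if "p \<in> I" for p
    using that T by (auto simp: einterval_def) (meson ereal_less_eq(3) less_imp_le less_le_trans)
  have tail: "set_integrable lborel (einterval (ereal p) T) r" if "p \<in> I" for p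
    using integrable[OF sub[OF that]] by (simp add: T einterval_eq)
  \<comment> \<open>From a horizon, \<open>I\<close> is a bounded interval on which \<open>r\<close>
    is bounded. From a regular origin the infinite left part is integrable by \<open>start\<close>,
    and \<open>s - 1\<close> makes it overlap with the bounded rest.\<close>
  have whole: "set_integrable lborel I r" if nc: "\<not> (a = -\<infinity> \<and> \<alpha> = 1 / sqrt 2)"
  proof (cases "a = 0")
    case True
    then have "I = {0<..<T'}" by (auto simp: T einterval_def zero_ereal_def)
    then show ?thesis using integrable[of 0] by simp
  next
    case False
    then obtain s where a: "a = -\<infinity>" and s: "s \<in> I" "set_integrable lborel (einterval (-\<infinity>) (ereal s)) r"
      using start nc by blast
    have "s - 1 \<in> I" using s(1) a by (auto simp: einterval_def) (meson ereal_less_eq(3) diff_le_self le_less_trans zero_le_one diff_le_eq add_increasing2 order_refl)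
    then have "set_integrable lborel (einterval (-\<infinity>) (ereal s) \<union> {s - 1<..<T'}) r"
      by (intro set_integrable_Un s(2) integrable sub) auto
    moreover have "einterval (-\<infinity>) (ereal s) \<union> {s - 1<..<T'} = I"
      using s(1) by (auto simp: a T einterval_def)
    ultimately show ?thesis by simp
  qed
  have "filterlim (sphere_curvature r N) at_bot (at_left T')"
    unfolding filterlim_at_bot
  proof
    fix Z :: real
    have "eventually (\<lambda>t. r t < 1) (at_left T')" using order_tendstoD(2)[OF lim_r, of 1] by simp
    moreover have "eventually (\<lambda>t. N t \<le> - (\<bar>Z\<bar> + 1)) (at_left T')" using lim_N by (simp add: filterlim_at_bot)
    moreover have "eventually (\<lambda>t. t \<in> I) (at_left T')"
      using eventually_at_left_real[of t0 T'] t0(1) sub[OF t0(1)] T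
      by (auto simp: einterval_def elim!: eventually_mono)
    ultimately show "eventually (\<lambda>t. sphere_curvature r N t \<le> Z) (at_left T')"
    proof eventually_elim
      case (elim t)
      have rt: "r t > 0" using r_pos[OF elim(3)] .
      have "(\<bar>Z\<bar> + 1)\<^sup>2 \<le> (- N t)\<^sup>2" using elim(2) by (intro power_mono) auto
      moreover have "\<bar>Z\<bar> + 1 \<le> (\<bar>Z\<bar> + 1)\<^sup>2" by (simp add: power2_eq_square algebra_simps)
      ultimately have le: "1 - (N t)\<^sup>2 \<le> - \<bar>Z\<bar>" by simp
      have "(r t)\<^sup>2 \<le> 1" using elim(1) rt by (simp add: power_le_one)
      then have "\<bar>Z\<bar> * (r t)\<^sup>2 \<le> \<bar>Z\<bar>" by (simp add: mult_left_le)
      then have "1 - (N t)\<^sup>2 \<le> - \<bar>Z\<bar> * (r t)\<^sup>2" using le by simp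
      then have "sphere_curvature r N t \<le> - \<bar>Z\<bar>"
        using rt by (simp add: sphere_curvature_def divide_le_eq)
      then show ?case by simp
    qed
  qed
  then have "filterlim (sphere_curvature r N \<circ> real_of_ereal) at_bot (at_left T)"
    unfolding T at_left_ereal filterlim_filtermap by (simp add: comp_def)
  moreover have "((r \<circ> real_of_ereal) \<longlongrightarrow> 0) (at_left T)"
    using lim_r by (simp add: T ereal_tendsto_simps1)
  ultimately show ?thesis unfolding bag_of_gold_def using tail whole by blast
qed

end

lemma (in eymh) flow_of_boundary_conditions:
  assumes \<alpha>: "\<alpha> \<ge> 0"
    and max: "right_maximal_solution \<alpha> a T r N \<kappa> W U"
    and bc: "(a = -\<infinity> \<and> \<alpha> \<le> 1 / sqrt 2 \<and> quasi_regular \<alpha> r N \<kappa> W U) \<or>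
         (a = 0 \<and> (\<exists>r\<^sub>h W\<^sub>h. regular_horizon \<alpha> r\<^sub>h W\<^sub>h r N \<kappa> W U))"
  shows "eymh_flow \<alpha> a T r N \<kappa> W U"
    and "a = 0 \<or> a = -\<infinity> \<and> (\<alpha> = 1 / sqrt 2 \<or>
      (\<exists>s\<in>I. set_integrable lborel (einterval (-\<infinity>) (ereal s)) r))"
proof -
  have maximal: "\<not> (\<exists>T' r' N' \<kappa>' W' U'. T < T' \<and> eymh_solution \<alpha> (einterval a T') r' N' \<kappa>' W' U' \<and>
         (\<forall>\<tau>\<in>einterval a T. r' \<tau> = r \<tau> \<and> N' \<tau> = N \<tau> \<and> \<kappa>' \<tau> = \<kappa> \<tau> \<and> W' \<tau> = W \<tau> \<and> U' \<tau> = U \<tau>))"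
    using max by (simp add: right_maximal_solution_def)
  \<comment> \<open>The left side is not positive: for \<open>\<alpha> = 0\<close> it is -1, and
    otherwise the right side is positive. So for a quasi regular origin every point will do.\<close>
  have r_large: "\<exists>s\<in>I. 2 * \<alpha>\<^sup>2 - 1 < \<alpha> ^ 4 * (r s)\<^sup>2" if "2 * \<alpha>\<^sup>2 \<le> 1"
  proof -
    obtain t where t: "t \<in> I" using einterval_nonempty[OF a_less_T] by (auto simp: einterval_def)
    have "2 * \<alpha>\<^sup>2 - 1 < \<alpha> ^ 4 * (r t)\<^sup>2"
    proof (cases "\<alpha> = 0")
      case False
      then have "0 < \<alpha> ^ 4 * (r t)\<^sup>2" using r_pos[OF t] by simp
      then show ?thesis using that by linarith
    qed simp
    then show ?thesis using t by blast
  qed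
  consider (sub) "a = -\<infinity>" "\<alpha> < 1 / sqrt 2" "quasi_regular \<alpha> r N \<kappa> W U"
    | (crit) "a = -\<infinity>" "\<alpha> = 1 / sqrt 2" "quasi_regular \<alpha> r N \<kappa> W U"
    | (hor) r\<^sub>h W\<^sub>h where "a = 0" "regular_horizon \<alpha> r\<^sub>h W\<^sub>h r N \<kappa> W U"
    using bc by (auto simp: quasi_regular_def)
  then have "eymh_flow \<alpha> a T r N \<kappa> W U \<and> (a = 0 \<or> a = -\<infinity> \<and> (\<alpha> = 1 / sqrt 2 \<or>
      (\<exists>s\<in>I. set_integrable lborel (einterval (-\<infinity>) (ereal s)) r)))"
  proof cases
    case sub
    then have lims: "(r \<longlongrightarrow> 0) at_bot" "((\<lambda>\<tau>. (W \<tau> - 1) / r \<tau>) \<longlongrightarrow> 0) at_bot"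
      "(N \<longlongrightarrow> sqrt (1 - 2 * \<alpha>\<^sup>2)) at_bot" "(\<kappa> \<longlongrightarrow> sqrt (1 - 2 * \<alpha>\<^sup>2)) at_bot"
      by (auto simp: quasi_regular_def)
    note q = quasi_regular_subcritical[OF sub(1) \<alpha> sub(2) lims]
    obtain s where s: "s \<in> I" "\<And>\<tau>. \<tau> \<in> I \<Longrightarrow> \<tau> \<le> s \<Longrightarrow> sqrt (1 - 2 * \<alpha>\<^sup>2) / 2 < N \<tau>"
      using q(1) by (auto simp: initially_def)
    have N_pos: "\<exists>s\<in>I. \<forall>\<tau>\<in>I. \<tau> \<le> s \<longrightarrow> N \<tau> > 0"
    proof (intro bexI[OF _ s(1)] ballI impI)
      fix \<tau> assume "\<tau> \<in> I" "\<tau> \<le> s"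
      then show "N \<tau> > 0" using s(2)[of \<tau>] q(2) by linarith
    qed
    have "eymh_flow \<alpha> a T r N \<kappa> W U"
      by unfold_locales (use maximal q(3) N_pos r_large q(4,5) in auto)
    moreover have "set_integrable lborel (einterval (-\<infinity>) (ereal s)) r"
      by (rule set_integrable_near_minus_infinity[OF sub(1) s(1) _ _ lims(1), where c = "sqrt (1 - 2 * \<alpha>\<^sup>2) / 2"])
        (use q(2) s(2) in \<open>auto intro: less_imp_le\<close>)
    ultimately show ?thesis using sub(1) s(1) by blast
  next
    case crit
    then have lims: "(r \<longlongrightarrow> 0) at_bot" "(\<lambda>\<tau>. W \<tau> - (1 - (r \<tau>)\<^sup>2 / 4)) \<in> o[at_bot](\<lambda>\<tau>. (r \<tau>)\<^sup>2)"
      "(\<lambda>\<tau>. N \<tau> - r \<tau> / sqrt 12) \<in> o[at_bot](\<lambda>\<tau>. (r \<tau>)\<^sup>2)"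
      by (auto simp: quasi_regular_def)
    note q = quasi_regular_critical[OF crit(1,2) lims]
    have "eymh_flow \<alpha> a T r N \<kappa> W U"
      by unfold_locales
        (use maximal D_nonneg_of_initially[OF q(2)] q(1)[unfolded initially_def] r_large q(3,4) in auto)
    then show ?thesis using crit by blast
  next
    case hor
    note q = horizon_start[OF hor]
    have "eymh_flow \<alpha> a T r N \<kappa> W U"
      by unfold_locales
        (use maximal D_nonneg_of_initially[OF q(2)] q(1)[unfolded initially_def] q(3,4) in auto)
    then show ?thesis using hor(1) by blast
  qed
  then show "eymh_flow \<alpha> a T r N \<kappa> W U" "a = 0 \<or> a = -\<infinity> \<and> (\<alpha> = 1 / sqrt 2 \<or>
      (\<exists>s\<in>I. set_integrable lborel (einterval (-\<infinity>) (ereal s)) r))" by blast+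
qed

text \<open>As \<open>r\<close> increases, it is either bounded, which leads to the fixed point, or
  tends to infinity. In the latter case the decay of \<open>\<alpha>^2 W^2\<close> that flatness
  rests on is trivial for \<open>\<alpha> = 0\<close> and comes from the limit of \<open>W\<close>
  otherwise.\<close>

lemma (in eymh_global) dichotomy:
  obtains (flat) "filterlim r at_top at_top" "(N \<longlongrightarrow> 1) at_top" "(U \<longlongrightarrow> 0) at_top" "(\<kappa> \<longlongrightarrow> 1) at_top"
      "\<alpha> \<noteq> 0 \<Longrightarrow> (W \<longlongrightarrow> 0) at_top"
      "\<alpha> = 0 \<Longrightarrow> (W \<longlongrightarrow> 0) at_top \<or> (W \<longlongrightarrow> 1) at_top \<or> (W \<longlongrightarrow> -1) at_top"
  | (horn) "(N \<longlongrightarrow> 0) at_top" "eymh_horn \<alpha> a T r N \<kappa> W U"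
proof (cases "\<exists>R. \<forall>t\<in>I. r t \<le> R")
  case True
  then obtain R where "\<And>t. t \<in> I \<Longrightarrow> r t \<le> R" by blast
  note l = r_bounded_limits[OF this]
  have "eymh_horn \<alpha> a T r N \<kappa> W U" by unfold_locales (use l in auto)
  then show ?thesis using l horn by blast
next
  case False
  then have r: "filterlim r at_top at_top" by (intro r_at_top) (meson not_le)
  show ?thesis
  proof (cases "\<alpha> = 0")
    case False
    have W: "(W \<longlongrightarrow> 0) at_top" by (rule W_tendsto_0_massive[OF r False])
    then have "((\<lambda>t. \<alpha>\<^sup>2 * (W t)\<^sup>2) \<longlongrightarrow> \<alpha>\<^sup>2 * 0\<^sup>2) at_top" by (intro tendsto_intros)
    then have M: "((\<lambda>t. \<alpha>\<^sup>2 * (W t)\<^sup>2) \<longlongrightarrow> 0) at_top" by simp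
    show ?thesis using flat[OF r asymptotically_flat(1)[OF r M] U_tendsto_0[OF r M] asymptotically_flat(3)[OF r M]] W False by simp
  next
    case True
    then have M: "((\<lambda>t. \<alpha>\<^sup>2 * (W t)\<^sup>2) \<longlongrightarrow> 0) at_top" by simp
    show ?thesis
      using flat[OF r asymptotically_flat(1)[OF r M] U_tendsto_0[OF r M] asymptotically_flat(3)[OF r M]]
        W_limit_massless[OF r] True by simp
  qed
qed

theorem theorem1:
  fixes \<alpha> :: real and a T :: ereal and r N \<kappa> W U :: "real \<Rightarrow> real"
  assumes "\<alpha> \<ge> 0"
    and "right_maximal_solution \<alpha> a T r N \<kappa> W U"
    and "(a = -\<infinity> \<and> \<alpha> \<le> 1 / sqrt 2 \<and> quasi_regular \<alpha> r N \<kappa> W U) \<or>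
         (a = 0 \<and> (\<exists>r\<^sub>h W\<^sub>h. regular_horizon \<alpha> r\<^sub>h W\<^sub>h r N \<kappa> W U))"
  shows
    "(let case_i = (\<exists>\<tau>\<^sub>0\<in>einterval a T. changes_sign_at N \<tau>\<^sub>0);
          case_ii = stays_positive_and_tends_to a T N 1;
          case_iii = stays_positive_and_tends_to a T N 0
      in
       (case_i \<or> case_ii \<or> case_iii) \<and>
       \<not> (case_i \<and> case_ii) \<and> \<not> (case_i \<and> case_iii) \<and> \<not> (case_ii \<and> case_iii) \<and>
       (\<forall>\<tau>\<^sub>0\<in>einterval a T. changes_sign_at N \<tau>\<^sub>0 \<longrightarrow>
          (\<forall>\<tau>\<in>einterval a T. r \<tau> \<le> r \<tau>\<^sub>0) \<and>
          (\<forall>\<tau>\<in>einterval a T. \<tau>\<^sub>0 < \<tau> \<longrightarrow> N \<tau> < 0) \<and>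
          bag_of_gold \<alpha> a T r N) \<and>
       (case_ii \<longrightarrow>
          filterlim r at_top at_top \<and>
          (\<alpha> > 0 \<longrightarrow> (W \<longlongrightarrow> 0) at_top) \<and>
          (\<alpha> = 0 \<longrightarrow> (W \<longlongrightarrow> 0) at_top \<or> (W \<longlongrightarrow> 1) at_top \<or> (W \<longlongrightarrow> -1) at_top) \<and>
          (U \<longlongrightarrow> 0) at_top \<and> (\<kappa> \<longlongrightarrow> 1) at_top) \<and>
       (case_iii \<longrightarrow>
          (U \<longlongrightarrow> 0) at_top \<and> (W \<longlongrightarrow> 0) at_top \<and> (r \<longlongrightarrow> 1) at_top \<and> (\<kappa> \<longlongrightarrow> 1) at_top \<and>
          (\<alpha> < sqrt 3 / 2 \<longrightarrow>
             infinite {\<tau>\<in>einterval a T. W \<tau> = 0} \<and>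
             (\<exists>\<^sub>F \<tau> in at_top. W \<tau> > 0) \<and> (\<exists>\<^sub>F \<tau> in at_top. W \<tau> < 0)) \<and>
          (\<alpha> \<ge> sqrt 3 / 2 \<longrightarrow>
             (\<exists>\<tau>\<^sub>1\<in>einterval a T. strict_antimono_on {\<tau>\<^sub>1..} (\<lambda>\<tau>. \<bar>W \<tau>\<bar>)))))"
proof -
  interpret eymh \<alpha> a T r N \<kappa> W U
    using assms(2) by unfold_locales (auto simp: right_maximal_solution_def)
  interpret eymh_flow \<alpha> a T r N \<kappa> W U by (rule flow_of_boundary_conditions[OF assms])
  note start = flow_of_boundary_conditions(2)[OF assms]
  have turning: "(\<forall>\<tau>\<in>I. r \<tau> \<le> r \<tau>\<^sub>0) \<and> (\<forall>\<tau>\<in>I. \<tau>\<^sub>0 < \<tau> \<longrightarrow> N \<tau> < 0) \<and> bag_of_gold \<alpha> a T r N"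
    if "\<tau>\<^sub>0 \<in> I" "changes_sign_at N \<tau>\<^sub>0" for \<tau>\<^sub>0
    using that N_zero_changes_sign[OF that(1)] r_le_turning[OF that(1)] N_sign(2)[OF that(1)]
      bag_of_gold_after_turning[OF that(1) _ start] by blast
  have unique: False if "(N \<longlongrightarrow> 1) at_top" "(N \<longlongrightarrow> 0) at_top"
    using tendsto_unique[OF trivial_limit_at_top_linorder that] by simp
  \<comment> \<open>A zero of \<open>N\<close> is automatically a sign change and excludes the other
    two cases; without zeros \<open>N\<close> stays positive, and its limit, 1 or 0, tells them
    apart.\<close>
  show ?thesis
  proof (cases "\<exists>t0\<in>I. N t0 = 0")
    case True
    then obtain t0 where t0: "t0 \<in> I" "N t0 = 0" by blast
    have "\<not> stays_positive_and_tends_to a T N l" for l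
      using t0 by (force simp: stays_positive_and_tends_to_def)
    moreover have "changes_sign_at N t0" using N_zero_changes_sign t0 by blast
    ultimately show ?thesis unfolding Let_def using turning t0(1) by blast
  next
    case False
    then have pos: "\<And>x. x \<in> I \<Longrightarrow> N x > 0" using N_zero_or_pos by blast
    interpret eymh_global \<alpha> a T r N \<kappa> W U by unfold_locales (rule pos)
    have no_i: "\<not> changes_sign_at N \<tau>\<^sub>0" if "\<tau>\<^sub>0 \<in> I" for \<tau>\<^sub>0
      using N_zero_changes_sign[OF that] that False by blast
    have ii_iff: "stays_positive_and_tends_to a T N l \<longleftrightarrow> (N \<longlongrightarrow> l) at_top" for l
      using T_infinite pos by (simp add: stays_positive_and_tends_to_def)
    from dichotomy show ?thesis
    proof cases
      case flat
      then have "\<not> (N \<longlongrightarrow> 0) at_top" using unique by blast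
      then show ?thesis unfolding Let_def ii_iff using no_i flat by auto
    next
      case horn
      interpret eymh_horn \<alpha> a T r N \<kappa> W U by (rule horn(2))
      have n1: "\<not> (N \<longlongrightarrow> 1) at_top" using unique horn(1) by blast
      have osc: "infinite {\<tau> \<in> I. W \<tau> = 0} \<and> (\<exists>\<^sub>F \<tau> in at_top. W \<tau> > 0) \<and> (\<exists>\<^sub>F \<tau> in at_top. W \<tau> < 0)"
        if "\<alpha> < sqrt 3 / 2"
      proof -
        have "\<alpha>\<^sup>2 < (sqrt 3 / 2)\<^sup>2" using that assms(1) by (intro power_strict_mono) auto
        then show ?thesis using oscillation by (simp add: power_divide)
      qed
      have mono: "\<exists>\<tau>\<^sub>1\<in>I. strict_antimono_on {\<tau>\<^sub>1..} (\<lambda>\<tau>. \<bar>W \<tau>\<bar>)" if "\<alpha> \<ge> sqrt 3 / 2"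
      proof -
        have "(sqrt 3 / 2)\<^sup>2 \<le> \<alpha>\<^sup>2" using that by (intro power_mono) auto
        then show ?thesis using nonoscillation by (simp add: power_divide)
      qed
      show ?thesis unfolding Let_def ii_iff using no_i n1 horn(1) lims osc mono by auto
    qed
  qed
qed

end
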